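(* Let $1\le p<\infty$, $0<q<\infty$, and let $s,t$ be real numbers. Let $\mu$ be a positive Borel measure on $\mathbb{B}_n$. Then the embedding operator $i:B_p(\mathbb{B}_n)\to T^q_{s,t}(\mathbb{B}_n,\mu)$ is compact if and only if $$\lim_{|a|\to1}\frac{\mu(D(a,R))}{(1-|a|^2)^s\left(\log\frac{2}{1-|a|^2}\right)^{t-q+\frac qp}}=0$$ for some (or all) $R>0$.
   Context: $\mathbb{B}_n$ is the open unit ball of $\mathbb{C}^n$ ($n\ge1$), $H(\mathbb{B}_n)$ the space of holomorphic functions on $\mathbb{B}_n$, $dv$ normalized volume measure, $d\tau(z)=(1-|z|^2)^{-n-1}dv(z)$. Besov space: for $0<p<\infty$, $B_p(\mathbb{B}_n)$ is the space of $f\in H(\mathbb{B}_n)$ such that $(1-|z|^2)^N\frac{\partial^m f}{\partial z^m}(z)\in L^p(\mathbb{B}_n,d\tau)$ for all multi-indices $m$ with $|m|=N$, for some positive integer $N>n/p$ (equivalently, for every such $N$). With such an $N$ fixed, the norm is $$\|f\|_{B_p}=\sum_{|m|\le N-1}\left|\frac{\partial^m f}{\partial z^m}(0)\right|+\sum_{|m|=N}\left(\int_{\mathbb{B}_n}\left|(1-|z|^2)^N\frac{\partial^m f}{\partial z^m}(z)\right|^p d\tau(z)\right)^{1/p}.$$ Bergman metric balls: $D(a,R)=\{w\in\mathbb{B}_n:\beta(a,w)<R\}$, where $\beta(z,w)=\frac12\log\frac{1+|\varphi_z(w)|}{1-|\varphi_z(w)|}$ and $\varphi_z$ is the involutive automorphism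 of $\mathbb{B}_n$ interchanging $0$ and $z$. Logarithmic tent space: for $0<q<\infty$, real $s,t$, and a fixed $R>0$, $T^q_{s,t}(\mathbb{B}_n,\mu)=T^q_{s,t,R}(\mathbb{B}_n,\mu)$ is the set of $\mu$-measurable functions $f$ on $\mathbb{B}_n$ with $$\|f\|^q_{T^q_{s,t,R}(\mathbb{B}_n,\mu)}=\sup_{a\in\mathbb{B}_n}\frac{\int_{D(a,R)}|f(z)|^q\,d\mu(z)}{(1-|a|^2)^s\left(\log\frac{2}{1-|a|}\right)^t}<\infty;$$ the space does not depend on $R$. The operator $i$ is the inclusion $f\mapsto f$. A bounded linear operator $T:B_p(\mathbb{B}_n)\to T^q_{s,t}(\mathbb{B}_n,\mu)$ is called compact if $\|Tf_k\|_{T^q_{s,t}(\mathbb{B}_n,\mu)}\to0$ for every bounded sequence $\{f_k\}$ in $B_p(\mathbb{B}_n)$ that converges to $0$ uniformly on compact subsets of $\mathbb{B}_n$. "For some (or all) $R>0$" means the equivalence holds with either quantifier.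
   Formalization: The positive Borel measure μ is assumed finite on compact subsets of the ball; without this the claim fails, e.g. for an infinite point mass at 0 the limit is 0 for every R but constants are not in the tent space. *)

theory Defs
  imports "HOL-Analysis.Analysis"
begin

section \<open>Holomorphic functions of several variables\<close>

text \<open>
  A point of complex \<open>n\<close>-space is a vector of type \<open>complex ^ 'n\<close> with \<open>n = CARD('n)\<close>; its
  Euclidean norm is \<open>norm\<close> and the open unit ball is \<open>ball 0 1\<close>. Functions on the ball are
  represented by functions on the whole type, whose values outside the ball are irrelevant.
\<close>

definition cinner :: "complex ^ 'n \<Rightarrow> complex ^ 'n \<Rightarrow> complex" where
  "cinner z w = (\<Sum>i\<in>UNIV. z $ i * cnj (w $ i))"

definition holomorphic_several :: "(complex ^ 'n \<Rightarrow> complex) \<Rightarrow> (complex ^ 'n) set \<Rightarrow> bool" where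
  "holomorphic_several f S \<longleftrightarrow>
     (\<forall>z\<in>S. \<exists>f'. (f has_derivative f') (at z) \<and> (\<forall>c v. f' (c *s v) = c * f' v))"

definition complex_partial :: "'n \<Rightarrow> (complex ^ 'n \<Rightarrow> complex) \<Rightarrow> complex ^ 'n \<Rightarrow> complex" where
  "complex_partial i f z = deriv (\<lambda>c. f (z + axis i c)) 0"

text \<open>
  Multi-indices are functions \<open>m :: 'n \<Rightarrow> nat\<close>, with \<open>|m|\<close> being \<open>sum m UNIV\<close>. The coordinates
  are differentiated in an arbitrary fixed order; partial derivatives of holomorphic functions
  commute, so the order does not matter on the ball.
\<close>

definition coordinates :: "'n::finite list" where
  "coordinates = (SOME xs. set xs = UNIV \<and> distinct xs)"

definition partial_multi ::
    "('n::finite \<Rightarrow> nat) \<Rightarrow> (complex ^ 'n \<Rightarrow> complex) \<Rightarrow> complex ^ 'n \<Rightarrow> complex" where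
  "partial_multi m f = foldr (\<lambda>i. complex_partial i ^^ m i) coordinates f"

lemma coordinates: "set (coordinates :: 'n::finite list) = UNIV" "distinct (coordinates :: 'n list)"
proof -
  have "\<exists>xs :: 'n list. set xs = UNIV \<and> distinct xs"
    using finite_distinct_list[of "UNIV :: 'n set"] by auto
  from someI_ex[OF this]
  show "set (coordinates :: 'n list) = UNIV" "distinct (coordinates :: 'n list)"
    by (auto simp: coordinates_def)
qed

lemma finite_multi_indices: "finite {m :: 'n::finite \<Rightarrow> nat. sum m UNIV \<le> N}"
proof (rule finite_subset)
  show "{m :: 'n \<Rightarrow> nat. sum m UNIV \<le> N} \<subseteq> PiE UNIV (\<lambda>_. {..N})"
  proof (intro subsetI PiE_I)
    fix m :: "'n \<Rightarrow> nat" and i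
    assume "m \<in> {m. sum m UNIV \<le> N}"
    then show "m i \<in> {..N}"
      using member_le_sum[of i UNIV m] by simp
  qed auto
  show "finite (PiE (UNIV :: 'n set) (\<lambda>_. {..N}))"
    by (intro finite_PiE) auto
qed

section \<open>Besov spaces\<close>

text \<open>Real powers \<open>r > 0\<close> of extended nonnegative reals.\<close>

definition ennreal_powr :: "ennreal \<Rightarrow> real \<Rightarrow> ennreal" where
  "ennreal_powr x r = (if x = top then top else ennreal (enn2real x powr r))"

definition volume_ball :: "(complex ^ 'n) measure" where
  "volume_ball = uniform_measure (restrict_space lborel (ball 0 1)) (ball 0 1)"

definition tau_ball :: "(complex ^ 'n) measure" where
  "tau_ball = density volume_ball (\<lambda>z. ennreal (1 / (1 - (norm z)\<^sup>2) ^ (CARD('n) + 1)))"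

text \<open>The quasinorm takes the value \<open>\<infinity>\<close> exactly when the \<open>p\<close>-th power is not integrable.\<close>

definition Lp_norm :: "real \<Rightarrow> 'a measure \<Rightarrow> ('a \<Rightarrow> complex) \<Rightarrow> ennreal" where
  "Lp_norm p M g = ennreal_powr (\<integral>\<^sup>+ z. ennreal (norm (g z) powr p) \<partial>M) (1 / p)"

definition in_Lp :: "real \<Rightarrow> 'a measure \<Rightarrow> ('a \<Rightarrow> complex) \<Rightarrow> bool" where
  "in_Lp p M g \<longleftrightarrow> g \<in> borel_measurable M \<and> Lp_norm p M g < \<infinity>"

definition weighted_partial ::
    "nat \<Rightarrow> ('n::finite \<Rightarrow> nat) \<Rightarrow> (complex ^ 'n \<Rightarrow> complex) \<Rightarrow> complex ^ 'n \<Rightarrow> complex" where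
  "weighted_partial N m f z = of_real ((1 - (norm z)\<^sup>2) ^ N) * partial_multi m f z"

definition besov_space :: "real \<Rightarrow> (complex ^ 'n \<Rightarrow> complex) set" where
  "besov_space p = {f. holomorphic_several f (ball 0 1) \<and>
     (\<exists>N>0. real N > real CARD('n) / p \<and>
        (\<forall>m. sum m UNIV = N \<longrightarrow> in_Lp p tau_ball (weighted_partial N m f)))}"

text \<open>The norm depends on the order \<open>N > n / p\<close> that is used, the space does not.\<close>

definition besov_norm :: "real \<Rightarrow> nat \<Rightarrow> (complex ^ 'n \<Rightarrow> complex) \<Rightarrow> ennreal" where
  "besov_norm p N f =
     (\<Sum>m | sum m UNIV \<le> N - 1. ennreal (norm (partial_multi m f 0))) +
     (\<Sum>m | sum m UNIV = N. Lp_norm p tau_ball (weighted_partial N m f))"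

section \<open>The Bergman metric\<close>

text \<open>
  The involution \<open>\<phi>\<^sub>a\<close> is \<open>(a - P z - s Q z) / (1 - \<langle>z, a\<rangle>)\<close>, where \<open>P\<close> is the orthogonal projection
  onto the span of \<open>a\<close>, \<open>Q = I - P\<close> and \<open>s = sqrt (1 - |a|\<^sup>2)\<close>. For \<open>a = 0\<close> the quotient defining
  \<open>P\<close> is \<open>0 / 0 = 0\<close>, so that \<open>P = 0\<close> and \<open>\<phi>\<^sub>0 z = - z\<close>.
\<close>

definition proj_span :: "complex ^ 'n \<Rightarrow> complex ^ 'n \<Rightarrow> complex ^ 'n" where
  "proj_span a z = (cinner z a / cinner a a) *s a"

definition ball_involution :: "complex ^ 'n \<Rightarrow> complex ^ 'n \<Rightarrow> complex ^ 'n" where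
  "ball_involution a z =
     (1 / (1 - cinner z a)) *s
       (a - proj_span a z - of_real (sqrt (1 - (norm a)\<^sup>2)) *s (z - proj_span a z))"

definition bergman_dist :: "complex ^ 'n \<Rightarrow> complex ^ 'n \<Rightarrow> real" where
  "bergman_dist z w =
     1 / 2 * ln ((1 + norm (ball_involution z w)) / (1 - norm (ball_involution z w)))"

definition bergman_ball :: "complex ^ 'n \<Rightarrow> real \<Rightarrow> (complex ^ 'n) set" where
  "bergman_ball a R = {w \<in> ball 0 1. bergman_dist a w < R}"

text \<open>
  The remaining lemmas of this section confirm that \<open>ball_involution a\<close> is an involutive
  holomorphic automorphism of the ball that interchanges \<open>0\<close> and \<open>a\<close>.
\<close>

lemma cinner_self: "cinner z z = of_real ((norm z)\<^sup>2)"
proof -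
  have "(norm z)\<^sup>2 = (\<Sum>i\<in>UNIV. (norm (z $ i))\<^sup>2)"
    by (simp add: norm_vec_def L2_set_def sum_nonneg)
  then show ?thesis
    by (simp only: cinner_def of_real_sum complex_norm_square)
qed

lemma cinner_commute: "cinner w z = cnj (cinner z w)"
  by (simp add: cinner_def cnj_sum mult.commute)

lemma cinner_linear_left:
  "cinner (x - y) w = cinner x w - cinner y w" "cinner (c *s x) w = c * cinner x w"
  by (simp_all add: cinner_def algebra_simps sum_subtractf sum_distrib_left)

lemma cinner_linear_right:
  "cinner w (x - y) = cinner w x - cinner w y" "cinner w (c *s x) = cnj c * cinner w x"
  by (simp_all add: cinner_def algebra_simps sum_subtractf sum_distrib_left)

lemma norm_cinner_le: "norm (cinner z w) \<le> norm z * norm w"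
proof -
  have "norm (cinner z w) \<le> (\<Sum>i\<in>UNIV. norm (z $ i) * norm (w $ i))"
    unfolding cinner_def by (rule order.trans[OF norm_sum]) (simp add: norm_mult)
  also have "\<dots> \<le> norm z * norm w"
    using L2_set_mult_ineq[of "\<lambda>i. norm (z $ i)" "\<lambda>i. norm (w $ i)" UNIV]
    by (simp add: norm_vec_def)
  finally show ?thesis .
qed

lemma cinner_ne_1:
  assumes "norm a < 1" "norm z < 1"
  shows "1 - cinner z a \<noteq> 0"
proof
  assume "1 - cinner z a = 0"
  then have "1 = norm (cinner z a)" by simp
  also have "\<dots> \<le> norm z * norm a" by (rule norm_cinner_le)
  also have "\<dots> \<le> norm z * 1"
    using assms by (intro mult_left_mono) auto
  finally show False using assms by simp
qed

lemma ball_involution_eq: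
  assumes "norm a < 1" and s: "s = sqrt (1 - (norm a)\<^sup>2)"
  shows "ball_involution a z =
    (1 / (1 - cinner z a)) *s ((1 - cinner z a / of_real (1 + s)) *s a - of_real s *s z)"
proof (cases "a = 0")
  case True
  then show ?thesis using s
    by (simp add: ball_involution_def proj_span_def)
next
  case False
  have "(norm a)\<^sup>2 < 1" using assms(1) by (simp add: power_less_one_iff abs_square_less_1)
  then have s2: "s\<^sup>2 = 1 - (norm a)\<^sup>2" and s0: "s > 0" unfolding s by auto
  have A: "cinner a a = of_real ((1 - s) * (1 + s))"
  proof -
    have "(norm a)\<^sup>2 = (1 - s) * (1 + s)" using s2 by (simp add: algebra_simps power2_eq_square)
    then show ?thesis unfolding cinner_self by (rule arg_cong)
  qed
  have ne: "of_real (1 + s) \<noteq> (0 :: complex)" using s0 by (metis of_real_eq_0_iff add_pos_pos less_irrefl zero_less_one)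
  have "cinner a a \<noteq> 0" using False by (simp add: cinner_self)
  then have ne': "of_real (1 - s) \<noteq> (0 :: complex)" unfolding A by auto
  have *: "cinner z a / cinner a a - of_real s * (cinner z a / cinner a a)
      = cinner z a / of_real (1 + s)"
  proof -
    have "cinner z a / cinner a a - of_real s * (cinner z a / cinner a a)
        = of_real (1 - s) * cinner z a / (of_real (1 - s) * of_real (1 + s))"
      unfolding A of_real_mult by (simp add: diff_divide_distrib left_diff_distrib)
    then show ?thesis using ne' by simp
  qed
  have "a - proj_span a z - of_real s *s (z - proj_span a z)
      = (1 - (cinner z a / cinner a a - of_real s * (cinner z a / cinner a a))) *s a
        - of_real s *s z"
    by (simp add: proj_span_def vec_eq_iff algebra_simps)
  then show ?thesis
    unfolding ball_involution_def s[symmetric] * by (simp only:)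
qed

lemma ball_involution_0: "ball_involution a 0 = a"
  by (simp add: ball_involution_def proj_span_def cinner_def vec_eq_iff)

lemma ball_involution_self: "ball_involution a a = 0"
  by (cases "a = 0")
    (simp_all add: ball_involution_def proj_span_def cinner_self vec_eq_iff)

lemma ball_involution_facts:
  assumes a: "norm a < 1" and z: "norm z < 1"
  shows ball_involution_norm: "1 - (norm (ball_involution a z))\<^sup>2 =
            (1 - (norm a)\<^sup>2) * (1 - (norm z)\<^sup>2) / (norm (1 - cinner z a))\<^sup>2"
    and ball_involution_involutive: "ball_involution a (ball_involution a z) = z"
proof -
  define s c k where "s = sqrt (1 - (norm a)\<^sup>2)" and "c = cinner z a"
    and "k = 1 / (complex_of_real (1 + s))"
  define al where "al = 1 - c * k"
  have "(norm a)\<^sup>2 < 1" using a by (simp add: abs_square_less_1)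
  then have s2: "s\<^sup>2 = 1 - (norm a)\<^sup>2" and s0: "s > 0" unfolding s_def by auto
  have c1: "1 - c \<noteq> 0" unfolding c_def using cinner_ne_1[OF a z] .
  have "1 + s \<noteq> 0" using s0 by simp
  then have "complex_of_real (1 + s) \<noteq> 0" by (metis of_real_eq_0_iff)
  then have k: "k * (1 + of_real s) = 1" "cnj k = k"
    unfolding k_def by simp_all
  have A: "cinner a a = 1 - (of_real s)\<^sup>2" "cinner a a = of_real ((norm a)\<^sup>2)"
    using arg_cong[OF s2, of complex_of_real] by (simp_all add: cinner_self)
  have phi: "ball_involution a x = (1 / (1 - cinner x a)) *s
      ((1 - cinner x a * k) *s a - of_real s *s x)" for x
    unfolding ball_involution_eq[OF a s_def] k_def by simp
  define u where "u = ball_involution a z"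
  have u: "u = (1 / (1 - c)) *s (al *s a - of_real s *s z)"
    unfolding u_def phi al_def c_def ..
  have kA: "k * cinner a a = 1 - of_real s"
  proof -
    have "k * cinner a a = (k * (1 + of_real s)) * (1 - of_real s)"
      unfolding A(1) by (simp add: algebra_simps power2_eq_square)
    then show ?thesis using k by simp
  qed
  have "cinner u a = (1 / (1 - c)) * (al * cinner a a - of_real s * c)"
    unfolding u by (simp only: cinner_linear_left c_def)
  also have "al * cinner a a - of_real s * c = cinner a a - c * (k * cinner a a) - of_real s * c"
    by (simp add: al_def algebra_simps)
  also have "\<dots> = cinner a a - c" unfolding kA by (simp add: algebra_simps)
  finally have ua: "cinner u a = (cinner a a - c) / (1 - c)" by simp
  have ua1: "1 - cinner u a = (of_real s)\<^sup>2 / (1 - c)"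
    unfolding ua A(1) using c1 by (simp add: field_simps)
  have e: "(1 - cinner u a * k) * (1 - c) = of_real s * al"
  proof -
    have "(1 - cinner u a * k) * (1 - c) = (1 - c) - k * (cinner a a - c)"
      unfolding ua using c1 by (simp add: field_simps)
    also have "\<dots> = of_real s - c + k * c" 
      using kA by (simp add: algebra_simps)
    also have "\<dots> = of_real s * al"
    proof -
      have "of_real s * k = 1 - k" using k(1) by (simp add: algebra_simps)
      then have "c * (of_real s * k) = c * (1 - k)" by simp
      then show ?thesis by (simp add: al_def algebra_simps)
    qed
    finally show ?thesis .
  qed
  have e': "1 - cinner u a * k = of_real s * al / (1 - c)"
    using e c1 by (simp add: field_simps)
  have "ball_involution a u = z"
    unfolding phi[of u] ua1 e' unfolding u
    using c1 s0 by (simp add: vec_eq_iff field_simps power2_eq_square)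
  then show "ball_involution a (ball_involution a z) = z" by (simp add: u_def)
  have "cinner u u = (1 / (1 - c)) * cnj (1 / (1 - c)) *
      cinner (al *s a - of_real s *s z) (al *s a - of_real s *s z)"
    unfolding u by (simp only: cinner_linear_left(2) cinner_linear_right(2) mult_ac)
  also have "cinner (al *s a - of_real s *s z) (al *s a - of_real s *s z) =
      al * cnj al * cinner a a - of_real s * al * cnj c - of_real s * cnj al * c
        + (of_real s)\<^sup>2 * cinner z z"
    by (simp add: cinner_linear_left cinner_linear_right cinner_commute[of a z] c_def
        power2_eq_square algebra_simps)
  also have "al * cnj al * cinner a a - of_real s * al * cnj c - of_real s * cnj al * c
        + (of_real s)\<^sup>2 * cinner z z
      = cinner a a - c - cnj c + c * cnj c + (of_real s)\<^sup>2 * cinner z z"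
  proof -
    have "al * cnj al * cinner a a - of_real s * al * cnj c - of_real s * cnj al * c
      = cinner a a - (c + cnj c) * (k * cinner a a + of_real s)
        + c * cnj c * k * (k * cinner a a + 2 * of_real s)"
      by (simp add: al_def k(2) algebra_simps)
    also have "\<dots> = cinner a a - (c + cnj c) + c * cnj c * (k * (1 + of_real s))"
      unfolding kA by (simp add: algebra_simps)
    finally show ?thesis unfolding k(1) by (simp add: algebra_simps)
  qed
  finally have "cinner u u * ((1 - c) * cnj (1 - c)) =
      ((1 / (1 - c) * (1 - c)) * cnj (1 / (1 - c) * (1 - c))) *
      (cinner a a - c - cnj c + c * cnj c + (of_real s)\<^sup>2 * cinner z z)"
    by (simp only: complex_cnj_mult mult_ac)
  also have "1 / (1 - c) * (1 - c) = 1" using c1 by (simp only: times_divide_eq_left) simp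
  finally have uu: "cinner u u * ((1 - c) * cnj (1 - c))
      = cinner a a - c - cnj c + c * cnj c + (of_real s)\<^sup>2 * cinner z z"
    by simp
  have "(1 - cinner u u) * ((1 - c) * cnj (1 - c)) = (of_real s)\<^sup>2 * (1 - cinner z z)"
    using uu A(1) by (simp add: algebra_simps)
  then have "complex_of_real ((1 - (norm u)\<^sup>2) * (norm (1 - c))\<^sup>2)
      = of_real (s\<^sup>2 * (1 - (norm z)\<^sup>2))"
    unfolding cinner_self complex_norm_square[symmetric] by simp
  then have "(1 - (norm u)\<^sup>2) * (norm (1 - c))\<^sup>2 = s\<^sup>2 * (1 - (norm z)\<^sup>2)"
    unfolding of_real_eq_iff .
  then show "1 - (norm (ball_involution a z))\<^sup>2 =
            (1 - (norm a)\<^sup>2) * (1 - (norm z)\<^sup>2) / (norm (1 - cinner z a))\<^sup>2"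
    using c1 unfolding s2 u_def c_def by (simp add: field_simps)
qed

lemma ball_involution_bij:
  assumes a: "norm a < 1"
  shows "bij_betw (ball_involution a) (ball 0 1) (ball 0 1)"
proof -
  have "ball_involution a z \<in> ball 0 1" if "z \<in> ball 0 1" for z
  proof -
    have z: "norm z < 1" using that by simp
    have "(1 - (norm a)\<^sup>2) * (1 - (norm z)\<^sup>2) / (norm (1 - cinner z a))\<^sup>2 > 0"
      using cinner_ne_1[OF a z] a z by (intro divide_pos_pos mult_pos_pos) (auto simp: abs_square_less_1)
    then have "(norm (ball_involution a z))\<^sup>2 < 1"
      unfolding ball_involution_norm[OF a z, symmetric] by simp
    then show ?thesis by (simp add: abs_square_less_1)
  qed
  then show ?thesis
    using ball_involution_involutive[OF a]
    by (intro bij_betw_byWitness[where f' = "ball_involution a"]) auto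
qed

lemma ball_involution_holomorphic:
  fixes a :: "complex ^ 'n"
  assumes a: "norm a < 1"
  shows "holomorphic_several (\<lambda>z. ball_involution a z $ i) (ball 0 1)"
  unfolding holomorphic_several_def
proof
  fix z :: "complex ^ 'n" assume "z \<in> ball 0 1"
  then have z: "norm z < 1" by simp
  define s where "s = sqrt (1 - (norm a)\<^sup>2)"
  define f where "f z = (1 - cinner z a / of_real (1 + s)) * a $ i - of_real s * z $ i" for z
  define f' where "f' h = - (cinner h a / of_real (1 + s)) * a $ i - of_real s * h $ i" for h
  define g where "g z = 1 - cinner z a" for z
  have eq: "(\<lambda>z. ball_involution a z $ i) = (\<lambda>z. f z / g z)"
    unfolding ball_involution_eq[OF a s_def] f_def g_def by (simp only: vector_smult_component vector_minus_component) simp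
  have i: "((\<lambda>x. x $ j) has_derivative (\<lambda>h. h $ j)) (at z)" for j :: 'n
    by (rule bounded_linear_imp_has_derivative[OF bounded_linear_vec_nth])
  have c: "((\<lambda>x. cinner x a) has_derivative (\<lambda>h. cinner h a)) (at z)"
    unfolding cinner_def by (intro has_derivative_sum has_derivative_mult_left i)
  have "(norm a)\<^sup>2 < 1" using a by (simp add: abs_square_less_1)
  then have "s > 0" unfolding s_def by simp
  then have "1 + s \<noteq> 0" by simp
  then have ne: "complex_of_real (1 + s) \<noteq> 0" by (metis of_real_eq_0_iff)
  have "(f has_derivative f') (at z)"
    unfolding f_def f'_def
    by (rule derivative_eq_intros c i refl ne | simp add: fun_eq_iff field_simps ne)+
  moreover have "(g has_derivative (\<lambda>h. - cinner h a)) (at z)"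
    unfolding g_def by (rule derivative_eq_intros c refl | simp)+
  moreover have "g z \<noteq> 0" unfolding g_def using cinner_ne_1[OF a z] .
  ultimately have "((\<lambda>z. f z / g z) has_derivative
      (\<lambda>h. (f' h * g z - f z * - cinner h a) / (g z * g z))) (at z)"
    by (rule has_derivative_divide')
  moreover have "(f' (c *s h) * g z - f z * - cinner (c *s h) a) / (g z * g z)
      = c * ((f' h * g z - f z * - cinner h a) / (g z * g z))" for c h
    by (simp add: f'_def cinner_linear_left algebra_simps add_divide_distrib diff_divide_distrib)
  ultimately show "\<exists>D. ((\<lambda>z. ball_involution a z $ i) has_derivative D) (at z) \<and>
      (\<forall>c v. D (c *s v) = c * D v)"
    unfolding eq by blast
qed

section \<open>Logarithmic tent spaces and compact operators\<close>

definition tent_norm ::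
    "real \<Rightarrow> real \<Rightarrow> real \<Rightarrow> real \<Rightarrow> (complex ^ 'n) measure \<Rightarrow> (complex ^ 'n \<Rightarrow> complex) \<Rightarrow> ennreal" where
  "tent_norm q s t R \<mu> f = ennreal_powr
     (SUP a\<in>ball 0 1. (\<integral>\<^sup>+ z\<in>bergman_ball a R. ennreal (norm (f z) powr q) \<partial>\<mu>) /
        ennreal ((1 - (norm a)\<^sup>2) powr s * ln (2 / (1 - norm a)) powr t))
     (1 / q)"

definition tent_space ::
    "real \<Rightarrow> real \<Rightarrow> real \<Rightarrow> real \<Rightarrow> (complex ^ 'n) measure \<Rightarrow> (complex ^ 'n \<Rightarrow> complex) set" where
  "tent_space q s t R \<mu> = {f \<in> borel_measurable \<mu>. tent_norm q s t R \<mu> f < \<infinity>}"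

text \<open>
  Borel measures on the ball are measures on the subspace \<open>ball 0 1\<close>. They are required to be
  finite on compact sets; with an atom of infinite mass at \<open>0\<close>, conditions on \<open>\<mu> (bergman_ball a R)\<close>
  as \<open>|a|\<close> tends to \<open>1\<close> would say nothing about the mass at \<open>0\<close>.
\<close>

definition borel_measure_on_ball :: "(complex ^ 'n) measure \<Rightarrow> bool" where
  "borel_measure_on_ball \<mu> \<longleftrightarrow> sets \<mu> = sets (restrict_space borel (ball 0 1)) \<and>
     (\<forall>K. compact K \<and> K \<subseteq> ball 0 1 \<longrightarrow> emeasure \<mu> K < \<infinity>)"

text \<open>Elements of a tent space are identified when they agree almost everywhere.\<close>

definition bounded_besov_tent ::
    "real \<Rightarrow> nat \<Rightarrow> real \<Rightarrow> real \<Rightarrow> real \<Rightarrow> real \<Rightarrow> (complex ^ 'n) measure \<Rightarrow>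
     ((complex ^ 'n \<Rightarrow> complex) \<Rightarrow> (complex ^ 'n \<Rightarrow> complex)) \<Rightarrow> bool" where
  "bounded_besov_tent p N q s t R \<mu> T \<longleftrightarrow>
     (\<forall>f\<in>besov_space p. T f \<in> tent_space q s t R \<mu>) \<and>
     (\<forall>f\<in>besov_space p. \<forall>g\<in>besov_space p. AE z in \<mu>. T (\<lambda>z. f z + g z) z = T f z + T g z) \<and>
     (\<forall>f\<in>besov_space p. \<forall>c. AE z in \<mu>. T (\<lambda>z. c * f z) z = c * T f z) \<and>
     (\<exists>C::real. \<forall>f\<in>besov_space p. tent_norm q s t R \<mu> (T f) \<le> ennreal C * besov_norm p N f)"

definition compact_besov_tent ::
    "real \<Rightarrow> nat \<Rightarrow> real \<Rightarrow> real \<Rightarrow> real \<Rightarrow> real \<Rightarrow> (complex ^ 'n) measure \<Rightarrow>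
     ((complex ^ 'n \<Rightarrow> complex) \<Rightarrow> (complex ^ 'n \<Rightarrow> complex)) \<Rightarrow> bool" where
  "compact_besov_tent p N q s t R \<mu> T \<longleftrightarrow>
     bounded_besov_tent p N q s t R \<mu> T \<and>
     (\<forall>f. (\<forall>k. f k \<in> besov_space p) \<and>
          (\<exists>C::real. \<forall>k. besov_norm p N (f k) \<le> ennreal C) \<and>
          (\<forall>K. compact K \<and> K \<subseteq> ball 0 1 \<longrightarrow> uniform_limit K f (\<lambda>_. 0) sequentially)
        \<longrightarrow> (\<lambda>k::nat. tent_norm q s t R \<mu> (T (f k))) \<longlonglongrightarrow> 0)"

definition inclusion :: "(complex ^ 'n \<Rightarrow> complex) \<Rightarrow> (complex ^ 'n \<Rightarrow> complex)" where
  "inclusion f = f"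

text \<open>
  The limit of \<open>\<mu> (D(a, R)) / ((1 - |a|\<^sup>2)^s (log (2 / (1 - |a|\<^sup>2)))^u)\<close> as \<open>|a|\<close> tends to \<open>1\<close> from
  inside the ball is \<open>0\<close>.
\<close>

definition vanishing_log_carleson ::
    "real \<Rightarrow> real \<Rightarrow> real \<Rightarrow> (complex ^ 'n) measure \<Rightarrow> bool" where
  "vanishing_log_carleson s u R \<mu> \<longleftrightarrow>
     ((\<lambda>a. emeasure \<mu> (bergman_ball a R) /
           ennreal ((1 - (norm a)\<^sup>2) powr s * ln (2 / (1 - (norm a)\<^sup>2)) powr u))
        \<longlongrightarrow> 0) (filtercomap norm (at_left 1))"

end

theory Submission
  imports Defs "HOL-Complex_Analysis.Complex_Analysis"
begin

text \<open>
  Besov functions grow at most like the power \<open>1 - 1/p\<close> of \<open>log (2 / (1 - |z|\<^sup>2))\<close>: Taylor's formula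
  along the ray to \<open>z\<close> bounds \<open>f z\<close> by the integral of \<open>(1 - t)^N |\<partial>\<^sup>N f|\<close> against \<open>dt / (1 - t)\<close>, a
  measure of logarithmic total mass, Hoelder's inequality produces the power of the logarithm, and
  the mean value property of \<open>\<partial>\<^sup>N f\<close> on regions of size \<open>1 - t\<close> in the direction of the ray and
  \<open>\<surd>(1 - t)\<close> in the orthogonal directions turns the remaining radial integral into the Besov norm.
  On a Bergman ball all weights are essentially constant, so that the growth estimate and the
  vanishing condition give compactness.

  Conversely, the functions \<open>log (2 / (1 - \<langle>z, a\<rangle>))\<close>, divided by the \<open>1/p\<close>-th power of
  \<open>log (2 / (1 - |a|\<^sup>2))\<close>, are bounded in the Besov space, tend to \<open>0\<close> locally uniformly as
  \<open>|a| \<rightarrow> 1\<close> and attain the maximal growth on the Bergman ball around \<open>a\<close>.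
\<close>

section \<open>Holomorphic functions of several variables\<close>

text \<open>The Besov norm involves iterated coordinate derivatives, while
  \<open>holomorphic_several\<close> provides one total derivative. Every several-variable fact is
  therefore reduced to complex lines, where Cauchy's estimates and integral formula apply. The
  averaging regions are anisotropic because \<open>tau_ball\<close> has density (1 - |z|^2)^(-n-1):
  a region of size 1 - t along the ray and of the square root of that size across it has volume of
  order (1 - t)^(n+1), while a Euclidean ball of radius 1 - t would only have volume of order (1 -
  t)^(2n), too little as soon as n > 1. The same geometry governs the sets |1 - <z,a>| <= h in the
  norm estimate for the test functions. There the exponent is critical: every dyadic shell
  contributes the same bound, so the number of shells produces exactly one logarithm, and its p-th
  root is the normalising factor. The exponent t - q + q/p is t - q(1 - 1/p), the logarithmic
  exponent of the tent weight minus q times the growth exponent. All constants are crude; what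
  matters is that they do not depend on the function, the ray or the centre.\<close>

lemma holomorphic_second_order_remainder:
  assumes h: "h holomorphic_on ball 0 r" and r: "0 < r"
    and B: "\<And>w. w \<in> ball 0 r \<Longrightarrow> norm (h w) \<le> M" and w: "norm w \<le> r / 2"
  shows "norm (h w - h 0 - w * deriv h 0) \<le> 32 * M / r\<^sup>2 * (norm w)\<^sup>2"
proof -
  have hol: "(deriv ^^ i) h holomorphic_on ball 0 r" for i
    by (intro holomorphic_higher_deriv h) auto
  \<comment> \<open>The disc of radius r/4 about \<open>x\<close> stays inside
    \<open>ball 0 r\<close>, so Cauchy's inequality gives 2! M / (r/4)^2 = 32 M / r^2. Since this
    depends on \<open>M\<close> and \<open>r\<close> only, the remainder is uniform over all lines
    to which the lemma is applied.\<close>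
  have *: "norm ((deriv ^^ 2) h x) \<le> 32 * M / r\<^sup>2" if x: "x \<in> cball 0 (r/2)" for x
  proof -
    have sub: "cball x (r/4) \<subseteq> ball 0 r"
    proof
      fix y assume "y \<in> cball x (r/4)"
      then have "norm y \<le> norm x + r/4"
        using norm_triangle_ineq[of x "y - x"] by (simp add: dist_norm norm_minus_commute)
      then show "y \<in> ball 0 r" using x r by simp
    qed
    have "norm ((deriv ^^ 2) h x) \<le> fact 2 * M / (r/4) ^ 2"
    proof (rule Cauchy_inequality)
      show "h holomorphic_on ball x (r/4)"
        using sub ball_subset_cball by (blast intro: holomorphic_on_subset[OF h])
      show "continuous_on (cball x (r/4)) h"
        using sub holomorphic_on_imp_continuous_on[OF h] continuous_on_subset by blast
      show "norm (h y) \<le> M" if "norm (x - y) = r/4" for y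
        using sub that by (intro B) (auto simp: dist_norm)
    qed (use r in auto)
    then show ?thesis by (simp add: power2_eq_square)
  qed
  have "norm ((deriv ^^ 0) h w - (\<Sum>i\<le>1. (deriv ^^ i) h 0 * (w-0) ^ i / (fact i)))
      \<le> 32 * M / r\<^sup>2 * norm (w - 0) ^ Suc 1 / fact 1"
  proof (rule complex_Taylor[of "cball 0 (r/2)"])
    show "((deriv ^^ i) h has_field_derivative (deriv ^^ Suc i) h x) (at x within cball 0 (r/2))"
      if "x \<in> cball 0 (r/2)" for i x
    proof -
      have "x \<in> ball 0 r" using that r by simp
      then have "((deriv ^^ i) h has_field_derivative deriv ((deriv ^^ i) h) x) (at x)"
        using holomorphic_derivI[OF hol] by blast
      then show ?thesis by (auto intro: has_field_derivative_at_within)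
    qed
    show "norm ((deriv ^^ Suc 1) h x) \<le> 32 * M / r\<^sup>2" if "x \<in> cball 0 (r/2)" for x
      using *[OF that] by (simp add: numeral_2_eq_2)
  qed (use r w in auto)
  then show ?thesis by (simp add: diff_diff_eq power2_eq_square mult.commute)
qed

lemma norm_vector_smult: "norm (c *s (v :: complex ^ 'n)) = norm c * norm v"
proof -
  have "(norm (c *s v))\<^sup>2 = (norm c * norm v)\<^sup>2"
    by (simp add: norm_vec_def L2_set_def sum_nonneg norm_mult power_mult_distrib sum_distrib_left)
  then show ?thesis by (simp add: power2_eq_iff_nonneg)
qed

lemma bounded_linear_smult_left: "bounded_linear (\<lambda>c. c *s (v :: complex ^ 'n))"
  by (rule bounded_linear_intro[where K = "norm v"])
     (simp_all add: vec_eq_iff ring_distribs norm_vector_smult mult.commute scaleR_conv_of_real[where 'a = complex])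

text \<open>Arbitrary complex directions are allowed, so that coordinate derivatives (direction
  \<open>axis i 1\<close>), derivatives along rays and total derivatives are all instances of one
  notion defined on a complex line.\<close>

definition directional_deriv :: "complex ^ 'n \<Rightarrow> (complex ^ 'n \<Rightarrow> complex) \<Rightarrow> complex ^ 'n \<Rightarrow> complex" where
  "directional_deriv v f z = deriv (\<lambda>c. f (z + c *s v)) 0"

lemma axis_eq_smult: "axis i c = (c :: complex) *s axis i 1"
  by (simp add: axis_def vec_eq_iff)

lemma complex_partial_eq: "complex_partial i f = directional_deriv (axis i 1) f"
  by (simp add: complex_partial_def directional_deriv_def fun_eq_iff axis_eq_smult[of i, symmetric])

lemma has_field_derivative_line:
  fixes f :: "complex ^ 'n \<Rightarrow> complex"
  assumes "(f has_derivative D) (at (z + c *s v))" "\<And>c v. D (c *s v) = c * D v"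
  shows "((\<lambda>c. f (z + c *s v)) has_field_derivative D v) (at c)"
proof -
  have "((\<lambda>c. z + c *s v) has_derivative (\<lambda>c. c *s v)) (at c)"
    using bounded_linear_imp_has_derivative[OF bounded_linear_smult_left]
    by (auto intro!: derivative_eq_intros)
  from has_derivative_compose[OF this assms(1)] show ?thesis
    unfolding has_field_derivative_def
    by (rule has_derivative_eq_rhs) (simp add: assms(2) fun_eq_iff mult.commute)
qed

lemma holomorphic_several_has_derivative:
  fixes f :: "complex ^ 'n \<Rightarrow> complex"
  assumes "holomorphic_several f S" "z \<in> S"
  shows "(f has_derivative (\<lambda>v. directional_deriv v f z)) (at z)"
    and "directional_deriv (c *s v) f z = c * directional_deriv v f z"
proof -
  obtain D where D: "(f has_derivative D) (at z)" "\<And>c v. D (c *s v) = c * D v"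
    using assms unfolding holomorphic_several_def by blast
  have "D v = directional_deriv v f z" for v
    unfolding directional_deriv_def using has_field_derivative_line[of f D z 0 v] D
    by (simp add: DERIV_imp_deriv)
  then have "D = (\<lambda>v. directional_deriv v f z)" by blast
  with D show "(f has_derivative (\<lambda>v. directional_deriv v f z)) (at z)"
    "directional_deriv (c *s v) f z = c * directional_deriv v f z"
    by auto
qed

lemma holomorphic_several_line_deriv:
  fixes f :: "complex ^ 'n \<Rightarrow> complex"
  assumes "holomorphic_several f S" "z + c *s v \<in> S"
  shows "((\<lambda>c. f (z + c *s v)) has_field_derivative directional_deriv v f (z + c *s v)) (at c)"
  using holomorphic_several_has_derivative[OF assms] by (intro has_field_derivative_line) auto

lemma holomorphic_several_continuous_on:
  "holomorphic_several f S \<Longrightarrow> continuous_on S f"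
  using holomorphic_several_has_derivative(1)
  by (meson has_derivative_continuous continuous_at_imp_continuous_on)

lemma holomorphic_several_line:
  fixes f :: "complex ^ 'n \<Rightarrow> complex"
  assumes "holomorphic_several f S" "\<And>c. c \<in> A \<Longrightarrow> z + c *s v \<in> S"
  shows "(\<lambda>c. f (z + c *s v)) holomorphic_on A"
  using holomorphic_several_line_deriv[OF assms(1)] assms(2)
  unfolding holomorphic_on_def field_differentiable_def
  by (meson has_field_derivative_at_within)

text \<open>The difference quotients of \<open>f\<close> in direction \<open>u\<close> converge locally uniformly, so that the
  derivatives in direction \<open>v\<close> may be taken termwise.\<close>

lemma directional_deriv_swap:
  fixes f :: "complex ^ 'n \<Rightarrow> complex"
  assumes f: "holomorphic_several f S" and S: "open S" and z: "z \<in> S"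
  shows "((\<lambda>c. directional_deriv u f (z + c *s v)) has_field_derivative
           directional_deriv v (directional_deriv u f) z) (at 0)"
    and "directional_deriv v (directional_deriv u f) z = directional_deriv u (directional_deriv v f) z"
proof -
  obtain e where e: "e > 0" "cball z e \<subseteq> S" using S z open_contains_cball by blast
  have cont: "continuous_on (cball z e) f"
    using continuous_on_subset[OF holomorphic_several_continuous_on[OF f] e(2)] .
  have "compact (f ` cball z e)" using cont by (intro compact_continuous_image) auto
  then obtain M where M: "M > 0" "\<And>x. x \<in> cball z e \<Longrightarrow> norm (f x) \<le> M"
    using bounded_pos[of "f ` cball z e"] compact_imp_bounded by (metis image_eqI)
  define U where "U = 1 + norm u + norm v"
  have U: "U > 0" unfolding U_def by (simp add: add_pos_nonneg)
  define r where "r = e / (4 * U)"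
  have r: "r > 0" using e U by (simp add: r_def)
  have "r * norm u \<le> r * U" "r * norm v \<le> r * U" unfolding U_def using r by auto
  moreover have "r * U = e / 4" using U by (simp add: r_def)
  ultimately have ru: "r * norm u \<le> e/4" "r * norm v \<le> e/4" by auto
  have inS: "z + a *s v + b *s u \<in> cball z e" if "norm a \<le> r" "norm b \<le> r" for a b
  proof -
    have "norm (a *s v + b *s u) \<le> norm a * norm v + norm b * norm u"
      using norm_triangle_ineq[of "a *s v" "b *s u"] by (simp add: norm_vector_smult)
    also have "\<dots> \<le> r * norm v + r * norm u"
      using that by (intro add_mono mult_right_mono) auto
    also have "\<dots> \<le> e" using ru e by simp
    finally have "norm (a *s v + b *s u) \<le> e" .
    moreover have "dist z (z + a *s v + b *s u) = norm (a *s v + b *s u)"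
      unfolding dist_norm by (subst norm_minus_commute) (simp add: algebra_simps)
    ultimately show ?thesis by simp
  qed
  have inS': "z + a *s v + b *s u \<in> S" if "norm a \<le> r" "norm b \<le> r" for a b
    using inS[OF that] e by blast
  define G where "G t c = (f (z + c *s v + t *s u) - f (z + c *s v)) / t" for t c
  define G' where "G' t c = (directional_deriv v f (z + c *s v + t *s u)
      - directional_deriv v f (z + c *s v)) / t" for t c
  have rem: "norm (f (z + c *s v + t *s u) - f (z + c *s v) - t * directional_deriv u f (z + c *s v))
      \<le> 32 * M / r\<^sup>2 * (norm t)\<^sup>2" if c: "norm c \<le> r" and t: "norm t \<le> r/2" for c t
  proof -
    have "norm ((\<lambda>t. f (z + c *s v + t *s u)) t - (\<lambda>t. f (z + c *s v + t *s u)) 0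
        - t * deriv (\<lambda>t. f (z + c *s v + t *s u)) 0) \<le> 32 * M / r\<^sup>2 * (norm t)\<^sup>2"
      by (rule holomorphic_second_order_remainder[OF holomorphic_several_line[OF f] r _ t])
         (use c inS inS' M in auto)
    then show ?thesis by (simp add: directional_deriv_def)
  qed
  have lim: "uniform_limit (cball 0 r) G (\<lambda>c. directional_deriv u f (z + c *s v)) (at 0)"
  proof (rule uniform_limitI)
    fix \<epsilon> :: real assume \<epsilon>: "\<epsilon> > 0"
    define d where "d = min (r/2) (\<epsilon> / (32 * M / r\<^sup>2 + 1))"
    have K: "32 * M / r\<^sup>2 \<ge> 0" using M by simp
    have d: "d > 0" using r \<epsilon> K by (simp add: d_def add_nonneg_pos)
    have "dist (G t c) (directional_deriv u f (z + c *s v)) < \<epsilon>"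
      if t: "t \<noteq> 0" "norm t < d" and c: "c \<in> cball 0 r" for t c
    proof -
      have "G t c - directional_deriv u f (z + c *s v) =
          (f (z + c *s v + t *s u) - f (z + c *s v) - t * directional_deriv u f (z + c *s v)) / t"
        using t by (simp add: G_def field_simps)
      then have "dist (G t c) (directional_deriv u f (z + c *s v)) =
         norm (f (z + c *s v + t *s u) - f (z + c *s v) - t * directional_deriv u f (z + c *s v)) / norm t"
        by (simp add: dist_norm norm_divide)
      also have "\<dots> \<le> 32 * M / r\<^sup>2 * (norm t)\<^sup>2 / norm t"
        using rem[of c t] c t by (intro divide_right_mono) (auto simp: d_def)
      also have "\<dots> = 32 * M / r\<^sup>2 * norm t" using t by (simp add: power2_eq_square)
      also have "\<dots> \<le> (32 * M / r\<^sup>2 + 1) * norm t" by (simp add: algebra_simps)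
      also have "\<dots> < \<epsilon>" using t K unfolding d_def
        by (simp add: pos_less_divide_eq add_nonneg_pos mult.commute)
      finally show ?thesis .
    qed
    then show "\<forall>\<^sub>F t in at 0. \<forall>c\<in>cball 0 r. dist (G t c) (directional_deriv u f (z + c *s v)) < \<epsilon>"
      unfolding eventually_at using d by (auto intro!: exI[of _ d])
  qed
  have ev: "\<forall>\<^sub>F t in at 0. continuous_on (cball 0 r) (G t) \<and>
      (\<forall>w\<in>ball 0 r. (G t has_field_derivative G' t w) (at w))"
    unfolding eventually_at
  proof (intro exI[of _ r] conjI ballI impI r)
    fix t :: complex assume t: "t \<noteq> 0 \<and> dist t 0 < r"
    have d: "(G t has_field_derivative G' t w) (at w)" if "norm w \<le> r" for w
    proof -
      have *: "((\<lambda>c. f (z + t *s u + c *s v)) has_field_derivative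
           directional_deriv v f (z + t *s u + w *s v)) (at w)"
        by (rule holomorphic_several_line_deriv[OF f]) (use inS'[of w t] that t in \<open>auto simp: ac_simps\<close>)
      have **: "((\<lambda>c. f (z + c *s v)) has_field_derivative
           directional_deriv v f (z + w *s v)) (at w)"
        by (rule holomorphic_several_line_deriv[OF f]) (use inS'[of w 0] that r in auto)
      have eq: "z + t *s u + c *s v = z + c *s v + t *s u" for c by simp
      show ?thesis unfolding G_def G'_def
        using DERIV_cdivide[OF DERIV_diff[OF *[unfolded eq] **], of t] .
    qed
    show "continuous_on (cball 0 r) (G t)"
      by (intro continuous_at_imp_continuous_on ballI DERIV_isCont[OF d]) auto
    show "(G t has_field_derivative G' t w) (at w)" if "w \<in> ball 0 r" for w
      using that by (intro d) auto
  qed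
  \<comment> \<open>One limit theorem yields both claims: the limit is differentiable in
    \<open>c\<close>, and its derivative is the limit of \<open>G' t 0\<close>, which is the
    difference quotient in direction \<open>u\<close> of the derivative in direction
    \<open>v\<close>, that is, the mixed derivative in the other order.\<close>
  obtain g' where g': "\<And>w. w \<in> ball 0 r \<Longrightarrow>
      ((\<lambda>c. directional_deriv u f (z + c *s v)) has_field_derivative (g' w)) (at w) \<and>
      ((\<lambda>t. G' t w) \<longlongrightarrow> g' w) (at 0)"
    using has_complex_derivative_uniform_limit[OF ev lim _ r] by auto
  have 1: "((\<lambda>c. directional_deriv u f (z + c *s v)) has_field_derivative (g' 0)) (at 0)"
    and 2: "((\<lambda>t. G' t 0) \<longlongrightarrow> g' 0) (at 0)" using g'[of 0] r by auto
  have 3: "directional_deriv v (directional_deriv u f) z = g' 0"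
    unfolding directional_deriv_def[of v] using 1 by (rule DERIV_imp_deriv)
  show "((\<lambda>c. directional_deriv u f (z + c *s v)) has_field_derivative
           directional_deriv v (directional_deriv u f) z) (at 0)"
    using 1 unfolding 3 .
  have "((\<lambda>t. directional_deriv v f (z + t *s u)) has_field_derivative g' 0) (at 0)"
    using 2 by (simp add: DERIV_def G'_def)
  then have "directional_deriv u (directional_deriv v f) z = g' 0"
    unfolding directional_deriv_def[of u] by (rule DERIV_imp_deriv)
  with 3 show "directional_deriv v (directional_deriv u f) z = directional_deriv u (directional_deriv v f) z"
    by simp
qed

text \<open>Differentiability along every line does not by itself give a total derivative. It does
  here because Cauchy's estimate in direction \<open>u\<close> bounds the new function on a whole
  ball around \<open>z\<close>; the second-order remainders on all lines through \<open>z\<close>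
  then have one common constant, and the directional derivatives depend linearly on the
  direction.\<close>

lemma holomorphic_several_directional_deriv:
  fixes f :: "complex ^ 'n \<Rightarrow> complex"
  assumes f: "holomorphic_several f S" and S: "open S"
  shows "holomorphic_several (directional_deriv u f) S"
  unfolding holomorphic_several_def
proof
  fix z assume z: "z \<in> S"
  define g where "g = directional_deriv u f"
  define D where "D v = directional_deriv v g z" for v
  note fd = holomorphic_several_has_derivative[OF f]
  have Dh: "D (c *s v) = c * D v" for c v
  proof -
    have "((\<lambda>w. g (z + w *s v)) has_field_derivative D v) (at (0 * c))"
      unfolding D_def g_def using directional_deriv_swap(1)[OF f S z] by simp
    then have "((\<lambda>t. g (z + (t * c) *s v)) has_field_derivative D v * c) (at 0)"
      by (rule DERIV_chain2) (auto intro!: derivative_eq_intros)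
    then show ?thesis unfolding D_def directional_deriv_def
      by (simp add: DERIV_imp_deriv mult.commute)
  qed
  \<comment> \<open>Additivity is read off after interchanging the derivatives: in the other order
    it is the additivity of the total derivative of \<open>f\<close>, differentiated in direction
    \<open>u\<close>.\<close>
  have Dadd: "D (v + w) = D v + D w" for v w
  proof -
    have line: "directional_deriv (v + w) f x = directional_deriv v f x + directional_deriv w f x" if "x \<in> S" for x
      by (rule linear_add[OF has_derivative_linear[OF fd(1)[OF that]]])
    have sw: "D x = directional_deriv u (directional_deriv x f) z" for x
      unfolding D_def g_def by (rule directional_deriv_swap(2)[OF f S z])
    have der: "((\<lambda>c. directional_deriv x f (z + c *s u)) has_field_derivative
         directional_deriv u (directional_deriv x f) z) (at 0)" for x
      by (rule directional_deriv_swap(1)[OF f S z])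
    have ev: "\<forall>\<^sub>F c in nhds 0. directional_deriv (v + w) f (z + c *s u)
       = directional_deriv v f (z + c *s u) + directional_deriv w f (z + c *s u)"
    proof -
      have "isCont (\<lambda>c. z + c *s u) 0"
        by (intro continuous_intros bounded_linear.isCont[OF bounded_linear_smult_left])
      then have "((\<lambda>c. z + c *s u) \<longlongrightarrow> z + 0 *s u) (nhds 0)"
        unfolding continuous_within by (rule tendsto_at_iff_tendsto_nhds[THEN iffD1])
      then have "((\<lambda>c. z + c *s u) \<longlongrightarrow> z) (nhds 0)" by simp
      then have "\<forall>\<^sub>F c in nhds 0. z + c *s u \<in> S"
        using S z by (rule topological_tendstoD)
      then show ?thesis by eventually_elim (rule line)
    qed
    have "deriv (\<lambda>c. directional_deriv (v + w) f (z + c *s u)) 0 =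
      deriv (\<lambda>c. directional_deriv v f (z + c *s u) + directional_deriv w f (z + c *s u)) 0"
      using ev by (intro deriv_cong_ev) auto
    also have "\<dots> = directional_deriv u (directional_deriv v f) z + directional_deriv u (directional_deriv w f) z"
      by (intro DERIV_imp_deriv DERIV_add der)
    finally show ?thesis unfolding sw by (simp only: directional_deriv_def[of u])
  qed
  obtain e where e: "e > 0" "cball z e \<subseteq> S" using S z open_contains_cball by blast
  have "compact (f ` cball z e)"
    using continuous_on_subset[OF holomorphic_several_continuous_on[OF f] e(2)]
    by (intro compact_continuous_image) auto
  then obtain M where M: "M > 0" "\<And>x. x \<in> cball z e \<Longrightarrow> norm (f x) \<le> M"
    using bounded_pos[of "f ` cball z e"] compact_imp_bounded by (metis image_eqI)
  define r where "r = e / (2 * (1 + norm u))"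
  have u1: "1 + norm u > 0" by (simp add: add_pos_nonneg)
  have r: "r > 0" using e u1 by (simp add: r_def)
  have "r * norm u \<le> r * (1 + norm u)" using r by simp
  also have "\<dots> = e/2" using u1 unfolding r_def by (simp add: field_simps)
  finally have ru: "r * norm u \<le> e/2" .
  have gM: "norm (g x) \<le> M / r" if x: "x \<in> ball z (e/2)" for x
  proof -
    have mem: "x + c *s u \<in> cball z e" if "norm c \<le> r" for c
    proof -
      have "norm (c *s u) \<le> e/2" unfolding norm_vector_smult
        using mult_right_mono[OF that, of "norm u"] ru by simp
      then show ?thesis using x norm_triangle_ineq[of "x - z" "c *s u"]
        by (simp add: dist_norm norm_minus_commute algebra_simps)
    qed
    have hol: "(\<lambda>c. f (x + c *s u)) holomorphic_on cball 0 r"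
      using mem e by (intro holomorphic_several_line[OF f]) auto
    have "norm ((deriv ^^ 1) (\<lambda>c. f (x + c *s u)) 0) \<le> fact 1 * M / r ^ 1"
      by (rule Cauchy_inequality)
         (use hol mem M r in \<open>auto intro: holomorphic_on_subset holomorphic_on_imp_continuous_on\<close>)
    then show ?thesis by (simp add: g_def directional_deriv_def)
  qed
  have gline: "(\<lambda>c. g (z + c *s v)) holomorphic_on ball 0 (e/2)" if v: "norm v = 1" for v
    unfolding holomorphic_on_def field_differentiable_def
  proof (intro ballI)
    fix c :: complex assume c: "c \<in> ball 0 (e/2)"
    have "z + c *s v \<in> cball z e" using c v e by (simp add: dist_norm norm_vector_smult)
    then have "z + c *s v \<in> S" using e by blast
    then have "((\<lambda>t. g (z + c *s v + t *s v)) has_field_derivative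
       directional_deriv v g (z + c *s v)) (at 0)"
      unfolding g_def by (rule directional_deriv_swap(1)[OF f S])
    moreover have "(\<lambda>t. g (z + c *s v + t *s v)) = (\<lambda>t. g (z + (c + t) *s v))"
      by (simp add: vector_sadd_rdistrib add.assoc)
    ultimately have "((\<lambda>t. g (z + t *s v)) has_field_derivative
       directional_deriv v g (z + c *s v)) (at (c + 0))"
      using DERIV_shift[of "\<lambda>t. g (z + t *s v)" _ 0 c] by (simp add: add.commute)
    then show "\<exists>D. ((\<lambda>c. g (z + c *s v)) has_field_derivative D) (at c within ball 0 (e/2))"
      by (auto intro: has_field_derivative_at_within)
  qed
  define K where "K = 32 * (M / r) / (e/2)\<^sup>2"
  have K: "K \<ge> 0" using M r by (simp add: K_def)
  have rem: "norm (g (z + h) - g z - D h) \<le> K * (norm h)\<^sup>2" if h: "norm h \<le> e/4" for h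
  proof (cases "h = 0")
    case True
    then show ?thesis using Dh[of 0 0] by simp
  next
    case False
    \<comment> \<open>Normalising the direction makes the disc of radius e/2 admissible on every
      line, so that \<open>K\<close> does not depend on \<open>h\<close>.\<close>
    define v where "v = (1 / complex_of_real (norm h)) *s h"
    have v: "norm v = 1" using False by (simp add: v_def norm_vector_smult norm_divide)
    have hv: "h = of_real (norm h) *s v" using False by (simp add: v_def vec_eq_iff)
    have "norm ((\<lambda>c. g (z + c *s v)) (of_real (norm h)) - (\<lambda>c. g (z + c *s v)) 0
       - of_real (norm h) * deriv (\<lambda>c. g (z + c *s v)) 0) \<le>
       32 * (M / r) / (e/2)\<^sup>2 * (norm (complex_of_real (norm h)))\<^sup>2"
      by (rule holomorphic_second_order_remainder[OF gline[OF v]])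
         (use e h v in \<open>auto intro!: gM simp: dist_norm norm_vector_smult\<close>)
    moreover have "of_real (norm h) * deriv (\<lambda>c. g (z + c *s v)) 0 = D h"
      unfolding D_def[symmetric] directional_deriv_def[symmetric] Dh[symmetric] hv[symmetric] ..
    ultimately show ?thesis using hv by (simp add: K_def)
  qed
  have "(g has_derivative D) (at z)"
    unfolding has_derivative_at_alt
  proof (intro conjI allI impI)
    have scale: "D (a *\<^sub>R v) = a *\<^sub>R D v" for a v
    proof -
      have "a *\<^sub>R v = of_real a *s v" by (simp add: vec_eq_iff scaleR_conv_of_real[where 'a = complex])
      then show ?thesis by (simp add: Dh scaleR_conv_of_real)
    qed
    then have "linear D" by (intro linearI) (auto simp: Dadd)
    then show "bounded_linear D" by (simp add: linear_conv_bounded_linear)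
    fix \<epsilon> :: real assume \<epsilon>: "0 < \<epsilon>"
    define d where "d = min (e/4) (\<epsilon> / (K + 1))"
    have "d > 0" using e \<epsilon> K by (simp add: d_def)
    moreover have "norm (g y - g z - D (y - z)) \<le> \<epsilon> * norm (y - z)" if "norm (y - z) < d" for y
    proof -
      have "norm (g y - g z - D (y - z)) \<le> K * (norm (y - z))\<^sup>2"
        using rem[of "y - z"] that by (simp add: d_def)
      also have "\<dots> \<le> ((K + 1) * norm (y - z)) * norm (y - z)"
        using K by (simp add: power2_eq_square mult_right_mono algebra_simps)
      also have "(K + 1) * norm (y - z) \<le> \<epsilon>"
        using that K unfolding d_def by (simp add: pos_less_divide_eq mult.commute)
      finally show ?thesis by (simp add: mult_right_mono)
    qed
    ultimately show "\<exists>d>0. \<forall>y. norm (y - z) < d \<longrightarrow> norm (g y - g z - D (y - z)) \<le> \<epsilon> * norm (y - z)"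
      by blast
  qed
  with Dh show "\<exists>f'. (directional_deriv u f has_derivative f') (at z) \<and> (\<forall>c v. f' (c *s v) = c * f' v)"
    unfolding g_def by blast
qed

section \<open>Mean values over discs\<close>

lemma nn_integral_lborel_translate:
  fixes F :: "'a::euclidean_space \<Rightarrow> ennreal"
  assumes [measurable]: "F \<in> borel_measurable borel"
  shows "(\<integral>\<^sup>+x. F (x + t) \<partial>lborel) = (\<integral>\<^sup>+x. F x \<partial>lborel)"
proof -
  have "lborel = distr lborel borel (\<lambda>x. t + x :: 'a)"
    using lborel_affine[of 1 t] by (simp add: density_1)
  then have "(\<integral>\<^sup>+x. F x \<partial>lborel) = (\<integral>\<^sup>+x. F x \<partial>distr lborel borel (\<lambda>x. t + x))"
    by simp
  also have "\<dots> = (\<integral>\<^sup>+x. F (x + t) \<partial>lborel)"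
    by (subst nn_integral_distr) (simp_all add: add.commute)
  finally show ?thesis by simp
qed

lemma nn_integral_lborel_scale:
  fixes F :: "'a::euclidean_space \<Rightarrow> ennreal"
  assumes [measurable]: "F \<in> borel_measurable borel" and s: "0 < s"
  shows "(\<integral>\<^sup>+x. F x \<partial>lborel) = ennreal (s ^ DIM('a)) * (\<integral>\<^sup>+x. F (s *\<^sub>R x) \<partial>lborel)"
proof -
  have "lborel = density (distr lborel borel (\<lambda>x. s *\<^sub>R x :: 'a)) (\<lambda>_. ennreal (s ^ DIM('a)))"
    using lborel_affine[of s 0] s by simp
  then have "(\<integral>\<^sup>+x. F x \<partial>lborel) =
      (\<integral>\<^sup>+x. F x \<partial>density (distr lborel borel (\<lambda>x. s *\<^sub>R x)) (\<lambda>_. ennreal (s ^ DIM('a))))"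
    by simp
  also have "\<dots> = ennreal (s ^ DIM('a)) * (\<integral>\<^sup>+x. F (s *\<^sub>R x) \<partial>lborel)"
    by (subst nn_integral_density) (simp_all add: nn_integral_distr nn_integral_cmult)
  finally show ?thesis .
qed

lemma lborel_complex_eq: "(lborel :: complex measure) = distr (lborel \<Otimes>\<^sub>M lborel) borel (\<lambda>(x, y). Complex x y)"
proof (rule lborel_eqI)
  have m[measurable]: "(\<lambda>(x, y). Complex x y) \<in> borel_measurable (lborel \<Otimes>\<^sub>M lborel)"
    unfolding Complex_eq split_beta by measurable
  fix l u :: complex assume le: "\<And>b. b \<in> Basis \<Longrightarrow> l \<bullet> b \<le> u \<bullet> b"
  have le': "Re l \<le> Re u" "Im l \<le> Im u" using le[of 1] le[of \<i>] by (auto simp: Basis_complex_def inner_complex_def)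
  have "(\<lambda>(x, y). Complex x y) -` box l u \<inter> space (lborel \<Otimes>\<^sub>M lborel) = {Re l<..<Re u} \<times> {Im l<..<Im u}"
    by (auto simp: box_def Basis_complex_def inner_complex_def space_pair_measure)
  then show "emeasure (distr (lborel \<Otimes>\<^sub>M lborel) borel (\<lambda>(x, y). Complex x y)) (box l u)
      = ennreal (\<Prod>b\<in>Basis. (u - l) \<bullet> b)"
    using le' by (subst emeasure_distr)
      (simp_all add: lborel.emeasure_pair_measure_Times Basis_complex_def inner_complex_def ennreal_mult)
qed simp

lemma nn_integral_complex:
  assumes [measurable]: "F \<in> borel_measurable borel"
  shows "(\<integral>\<^sup>+z. F z \<partial>lborel) = (\<integral>\<^sup>+x. \<integral>\<^sup>+y. F (Complex x y) \<partial>lborel \<partial>lborel)"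
    and "(\<integral>\<^sup>+z. F z \<partial>lborel) = (\<integral>\<^sup>+y. \<integral>\<^sup>+x. F (Complex x y) \<partial>lborel \<partial>lborel)"
proof -
  have m[measurable]: "(\<lambda>(x, y). Complex x y) \<in> borel_measurable (lborel \<Otimes>\<^sub>M lborel)"
    unfolding Complex_eq split_beta by measurable
  have *: "(\<integral>\<^sup>+z. F z \<partial>lborel) = (\<integral>\<^sup>+p. F (Complex (fst p) (snd p)) \<partial>(lborel \<Otimes>\<^sub>M lborel))"
    by (subst lborel_complex_eq, subst nn_integral_distr) (simp_all add: split_beta')
  show "(\<integral>\<^sup>+z. F z \<partial>lborel) = (\<integral>\<^sup>+x. \<integral>\<^sup>+y. F (Complex x y) \<partial>lborel \<partial>lborel)"
    unfolding * using m by (subst lborel.nn_integral_fst[symmetric]) (auto simp: split_beta')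
  show "(\<integral>\<^sup>+z. F z \<partial>lborel) = (\<integral>\<^sup>+y. \<integral>\<^sup>+x. F (Complex x y) \<partial>lborel \<partial>lborel)"
    unfolding * using m by (subst lborel_pair.nn_integral_snd[symmetric]) (auto simp: split_beta')
qed

text \<open>With one real coordinate fixed, a shear translates the other one, so Tonelli's theorem
  and translation invariance on the line suffice and no determinant is computed.\<close>

lemma nn_integral_complex_shear:
  assumes [measurable]: "F \<in> borel_measurable borel"
  shows "(\<integral>\<^sup>+z. F (z + of_real (k * Im z)) \<partial>lborel) = (\<integral>\<^sup>+z. F z \<partial>lborel)"
    and "(\<integral>\<^sup>+z. F (z + \<i> * of_real (k * Re z)) \<partial>lborel) = (\<integral>\<^sup>+z. F z \<partial>lborel)"
proof -
  have [measurable]: "(\<lambda>x. Complex x y) \<in> borel_measurable borel" "(\<lambda>x. Complex y x) \<in> borel_measurable borel" for y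
    unfolding Complex_eq by measurable
  have "(\<integral>\<^sup>+z. F (z + of_real (k * Im z)) \<partial>lborel) = (\<integral>\<^sup>+y. \<integral>\<^sup>+x. F (Complex (x + k * y) y) \<partial>lborel \<partial>lborel)"
    by (subst nn_integral_complex(2)) (simp_all add: complex_of_real_def complex_add)
  also have "\<dots> = (\<integral>\<^sup>+z. F z \<partial>lborel)"
    by (subst nn_integral_lborel_translate, measurable) (simp add: nn_integral_complex(2))
  finally show "(\<integral>\<^sup>+z. F (z + of_real (k * Im z)) \<partial>lborel) = (\<integral>\<^sup>+z. F z \<partial>lborel)" .
  have "(\<integral>\<^sup>+z. F (z + \<i> * of_real (k * Re z)) \<partial>lborel) = (\<integral>\<^sup>+x. \<integral>\<^sup>+y. F (Complex x (y + k * x)) \<partial>lborel \<partial>lborel)"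
  proof (subst nn_integral_complex(1))
    have "Complex x y + \<i> * complex_of_real (k * x) = Complex x (y + k * x)" for x y
      by (simp add: complex_eq_iff)
    then show "(\<integral>\<^sup>+x. \<integral>\<^sup>+y. F (Complex x y + \<i> * of_real (k * Re (Complex x y))) \<partial>lborel \<partial>lborel)
       = (\<integral>\<^sup>+x. \<integral>\<^sup>+y. F (Complex x (y + k * x)) \<partial>lborel \<partial>lborel)" by simp
  qed simp
  also have "\<dots> = (\<integral>\<^sup>+z. F z \<partial>lborel)"
    by (subst nn_integral_lborel_translate, measurable) (simp add: nn_integral_complex(1))
  finally show "(\<integral>\<^sup>+z. F (z + \<i> * of_real (k * Re z)) \<partial>lborel) = (\<integral>\<^sup>+z. F z \<partial>lborel)" .
qed

text \<open>A rotation by an angle different from \<open>\<pi>\<close> is a product of three shears.\<close>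

lemma nn_integral_complex_rotate:
  fixes u :: complex
  assumes F[measurable]: "F \<in> borel_measurable borel" and u: "norm u = 1"
  shows "(\<integral>\<^sup>+z. F (u * z) \<partial>lborel) = (\<integral>\<^sup>+z. F z \<partial>lborel)"
proof -
  have *: "(\<integral>\<^sup>+z. F (u * z) \<partial>lborel) = (\<integral>\<^sup>+z. F z \<partial>lborel)"
    if F[measurable]: "F \<in> borel_measurable borel" and u: "norm u = 1" "u \<noteq> -1" for F and u :: complex
  proof -
    have n: "(Re u)\<^sup>2 + (Im u)\<^sup>2 = 1" using u(1) by (simp add: cmod_def)
    have c1: "1 + Re u \<noteq> 0"
    proof
      assume "1 + Re u = 0"
      then have "Re u = -1" by simp
      with n have "u = -1" by (simp add: complex_eq_iff)
      with u show False by simp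
    qed
    \<comment> \<open>The tangent of half the rotation angle. Shears of strength -t,
      \<open>Im u\<close>, -t compose to the rotation, by the half-angle identities
      \<open>t1\<close> and \<open>t2\<close>; at the angle \<pi> the quotient degenerates.\<close>
    define t where "t = Im u / (1 + Re u)"
    have t1: "t * (1 + Re u) = Im u" using c1 by (simp add: t_def)
    have t2: "t * Im u = 1 - Re u"
    proof -
      have "t * Im u * (1 + Re u) = (1 - Re u) * (1 + Re u)"
      proof -
        have "t * Im u * (1 + Re u) = (t * (1 + Re u)) * Im u" by (simp add: algebra_simps)
        also have "\<dots> = (Im u)\<^sup>2" unfolding t1 by (simp add: power2_eq_square)
        also have "\<dots> = (1 - Re u) * (1 + Re u)"
          using n by (simp add: algebra_simps power2_eq_square)
        finally show ?thesis .
      qed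
      then show ?thesis using c1 by simp
    qed
    define A where "A z = z + of_real ((- t) * Im z)" for z
    define B where "B z = z + \<i> * of_real (Im u * Re z)" for z
    have mA[measurable]: "A \<in> borel_measurable borel" "B \<in> borel_measurable borel"
      unfolding A_def[abs_def] B_def[abs_def] by measurable
    have "A (B (A z)) = u * z" for z
    proof (rule complex_eqI)
      have "Re (A (B (A z))) = Re z * (1 - t * Im u) - Im z * (2 * t - t * (t * Im u))"
        by (simp add: A_def B_def algebra_simps)
      also have "2 * t - t * (t * Im u) = Im u" unfolding t2 using t1 by (simp add: algebra_simps)
      finally show "Re (A (B (A z))) = Re (u * z)" unfolding t2 by simp
      have "Im (A (B (A z))) = Im u * Re z + Im z * (1 - t * Im u)"
        by (simp add: A_def B_def algebra_simps)
      then show "Im (A (B (A z))) = Im (u * z)" unfolding t2 by simp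
    qed
    then have "(\<integral>\<^sup>+z. F (u * z) \<partial>lborel) = (\<integral>\<^sup>+z. F (A (B (A z))) \<partial>lborel)" by simp
    also have "\<dots> = (\<integral>\<^sup>+z. F (A (B z)) \<partial>lborel)"
      unfolding A_def[of "_ :: complex", symmetric]
      using nn_integral_complex_shear(1)[of "\<lambda>z. F (A (B z))" "-t"] unfolding A_def[symmetric] by simp
    also have "\<dots> = (\<integral>\<^sup>+z. F (A z) \<partial>lborel)"
      using nn_integral_complex_shear(2)[of "\<lambda>z. F (A z)" "Im u"] unfolding B_def[symmetric] by simp
    also have "\<dots> = (\<integral>\<^sup>+z. F z \<partial>lborel)"
      using nn_integral_complex_shear(1)[of "\<lambda>z. F z" "-t"] unfolding A_def[symmetric] by simp
    finally show ?thesis .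
  qed
  show ?thesis
  proof (cases "u = -1")
    \<comment> \<open>The excluded half turn is the composition of two quarter turns.\<close>
    case True
    have "(\<integral>\<^sup>+z. F (u * z) \<partial>lborel) = (\<integral>\<^sup>+z. F (\<i> * (\<i> * z)) \<partial>lborel)"
      using True by (simp add: mult.assoc[symmetric])
    also have "\<dots> = (\<integral>\<^sup>+z. F (\<i> * z) \<partial>lborel)"
      by (rule *[of "\<lambda>z. F (\<i> * z)"]) (auto simp: complex_eq_iff)
    also have "\<dots> = (\<integral>\<^sup>+z. F z \<partial>lborel)" by (rule *) (auto simp: complex_eq_iff)
    finally show ?thesis .
  qed (use * u F in blast)
qed

section \<open>Convexity of powers and mean value inequalities for |h|^p\<close>

text \<open>Convexity in the form "the graph lies above its tangents", obtained from Young's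
  inequality with the conjugate exponent p/(p - 1). For p = 1 there is no finite conjugate exponent,
  but both sides agree.\<close>

lemma powr_tangent_le:
  fixes x y p :: real
  assumes "0 \<le> x" "0 < y" "1 \<le> p"
  shows "y powr p + p * y powr (p - 1) * (x - y) \<le> x powr p"
proof (cases "p = 1")
  case False
  define q where "q = p / (p - 1)"
  have p: "p > 1" using False assms by simp
  then have q: "q > 1" "1/p + 1/q = 1" by (simp_all add: q_def field_simps)
  have "x * y powr (p - 1) \<le> x powr p / p + (y powr (p - 1)) powr q / q"
    using assms p q by (intro Youngs_inequality) auto
  also have "(y powr (p - 1)) powr q = y powr p" using p by (simp add: powr_powr q_def)
  finally have "p * (x * y powr (p - 1)) \<le> p * (x powr p / p + y powr p / q)"
    using p by simp
  also have "\<dots> = x powr p + (p - 1) * y powr p" using p by (simp add: q_def field_simps)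
  finally have "p * (x * y powr (p - 1)) \<le> x powr p + (p - 1) * y powr p" .
  moreover have "y powr (p - 1) * y = y powr p"
    using assms by (simp add: powr_diff)
  ultimately show ?thesis by (simp add: algebra_simps)
qed (use assms in auto)

text \<open>The tangent inequality at the weighted mean \<open>m\<close> is integrated against
  \<open>w\<close>; the linear term integrates to zero. Multiplying by the mass to the power p - 1
  removes the normalisation. A vanishing mean is treated apart because the tangent needs a positive
  base point. With a weight of variable mass this is Hoelder's inequality, the form used for the
  radial integrals.\<close>

lemma Jensen_powr_weighted:
  fixes u w :: "real \<Rightarrow> real"
  assumes u: "continuous_on {a..b} u" "\<And>x. x \<in> {a..b} \<Longrightarrow> 0 \<le> u x"
    and w: "continuous_on {a..b} w" "\<And>x. x \<in> {a..b} \<Longrightarrow> 0 \<le> w x"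
    and p: "1 \<le> p" and L: "0 < integral {a..b} w"
  shows "(integral {a..b} (\<lambda>x. u x * w x)) powr p
     \<le> (integral {a..b} w) powr (p - 1) * integral {a..b} (\<lambda>x. u x powr p * w x)"
proof -
  define L m where "L = integral {a..b} w" and "m = integral {a..b} (\<lambda>x. u x * w x) / L"
  have cp: "continuous_on {a..b} (\<lambda>x. u x powr p)"
    using u p by (intro continuous_on_powr') auto
  have int: "(\<lambda>x. u x powr p * w x) integrable_on {a..b}" "(\<lambda>x. u x * w x) integrable_on {a..b}"
    "w integrable_on {a..b}"
    by (intro integrable_continuous_interval continuous_intros u w cp)+
  have m0: "0 \<le> integral {a..b} (\<lambda>x. u x * w x)"
    using u w by (intro integral_nonneg int) auto
  show ?thesis
  proof (cases "m = 0")
    case True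
    then show ?thesis using L u w p
      by (auto simp: m_def L_def intro!: mult_nonneg_nonneg integral_nonneg int)
  next
    case False
    then have m: "0 < m" using m0 L by (simp add: m_def L_def less_le)
    have "m powr p * L = integral {a..b} (\<lambda>x. (m powr p - p * m powr (p - 1) * m) * w x
        + p * m powr (p - 1) * (u x * w x))"
    proof -
      have "integral {a..b} (\<lambda>x. (m powr p - p * m powr (p - 1) * m) * w x
          + p * m powr (p - 1) * (u x * w x)) =
         (m powr p - p * m powr (p - 1) * m) * L + p * m powr (p - 1) * (m * L)"
        using L unfolding m_def
        by (subst integral_add) (auto intro!: int integrable_on_mult_right simp: L_def)
      then show ?thesis by (simp add: algebra_simps)
    qed
    also have "\<dots> \<le> integral {a..b} (\<lambda>x. u x powr p * w x)"
    proof (rule integral_le)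
      fix x assume x: "x \<in> {a..b}"
      have "(m powr p - p * m powr (p - 1) * m) * w x + p * m powr (p - 1) * (u x * w x)
        = (m powr p + p * m powr (p - 1) * (u x - m)) * w x" by (simp add: algebra_simps)
      also have "\<dots> \<le> u x powr p * w x"
        using x by (intro mult_right_mono powr_tangent_le u w m p)
      finally show "(m powr p - p * m powr (p - 1) * m) * w x + p * m powr (p - 1) * (u x * w x)
          \<le> u x powr p * w x" .
    qed (auto intro!: int integrable_add integrable_on_mult_right)
    finally have "L powr (p - 1) * (m powr p * L) \<le> L powr (p - 1) * integral {a..b} (\<lambda>x. u x powr p * w x)"
      by (intro mult_left_mono) auto
    moreover have "L powr (p - 1) * (m powr p * L) = (m * L) powr p"
      using L m by (simp add: powr_mult powr_diff L_def)
    moreover have "m * L = integral {a..b} (\<lambda>x. u x * w x)" using L by (simp add: m_def L_def)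
    ultimately show ?thesis by (simp add: L_def)
  qed
qed

text \<open>Cauchy's formula on the unit circle makes \<open>h 0\<close> the mean of the boundary
  values; Jensen's inequality with constant weight then carries the bound to p-th powers.\<close>

lemma circle_mean_powr:
  assumes c: "continuous_on (cball 0 1) h" and hol: "h holomorphic_on ball 0 1" and p: "1 \<le> p"
  shows "ennreal (norm (h 0) powr p) \<le>
     (\<integral>\<^sup>+t\<in>{0..1}. ennreal (norm (h (exp (2 * of_real pi * \<i> * of_real t))) powr p) \<partial>lborel)"
proof -
  define e where "e t = exp (2 * of_real pi * \<i> * complex_of_real t)" for t :: real
  have ce: "continuous_on {0..1} (\<lambda>t. h (e t))"
    by (rule continuous_on_compose2[OF c]) (auto intro!: continuous_intros simp: e_def norm_exp_eq_Re)
  have "((\<lambda>u. h u / (u - 0)) has_contour_integral (2 * of_real pi * \<i> * h 0)) (circlepath 0 1)"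
    by (rule Cauchy_integral_circlepath[OF c hol]) auto
  then have "((\<lambda>t. h (e t) / e t * (2 * of_real pi * \<i> * e t)) has_integral 2 * of_real pi * \<i> * h 0) {0..1}"
    unfolding has_contour_integral_def
    by (rule has_integral_eq[rotated])
      (simp add: vector_derivative_circlepath01 e_def, simp add: circlepath)
  then have "((\<lambda>t. (1 / (2 * of_real pi * \<i>)) * (h (e t) / e t * (2 * of_real pi * \<i> * e t))) has_integral
     (1 / (2 * of_real pi * \<i>)) * (2 * of_real pi * \<i> * h 0)) {0..1}"
    by (rule has_integral_mult_right)
  then have hI: "((\<lambda>t. h (e t)) has_integral h 0) {0..1}"
    by (simp add: e_def)
  have "norm (h 0) \<le> integral {0..1} (\<lambda>t. norm (h (e t)))"
    unfolding integral_unique[OF hI, symmetric]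
    by (intro integral_norm_bound_integral integrable_continuous_interval continuous_on_norm ce) auto
  then have "norm (h 0) powr p \<le> (integral {0..1} (\<lambda>t. norm (h (e t)))) powr p"
    using p by (intro powr_mono2) auto
  also have "\<dots> \<le> integral {0..1} (\<lambda>t. norm (h (e t)) powr p)"
    using Jensen_powr_weighted[of 0 1 "\<lambda>t. norm (h (e t))" "\<lambda>_. 1" p] continuous_on_norm[OF ce] p
    by simp
  finally have *: "norm (h 0) powr p \<le> integral {0..1} (\<lambda>t. norm (h (e t)) powr p)" .
  have "((\<lambda>t. norm (h (e t)) powr p) has_integral integral {0..1} (\<lambda>t. norm (h (e t)) powr p)) {0..1}"
    using p by (intro integrable_integral integrable_continuous_interval continuous_on_powr' continuous_intros ce) auto
  then have "(\<integral>\<^sup>+t\<in>{0..1}. ennreal (norm (h (e t)) powr p) \<partial>lborel) = ennreal (integral {0..1} (\<lambda>t. norm (h (e t)) powr p))"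
    by (intro nn_integral_has_integral_lebesgue') auto
  with * show ?thesis by (simp add: e_def ennreal_leI)
qed

text \<open>Polar coordinates are avoided: for every \<open>c\<close> in the disc the circle
  inequality is applied to w \<mapsto> h (c w), the result is integrated over \<open>c\<close>, and
  after interchanging the integrals rotation invariance makes the inner integral independent of the
  angle.\<close>

lemma disc_mean_powr:
  assumes h: "h holomorphic_on ball 0 r" and r: "0 < r" and p: "1 \<le> p"
  shows "ennreal (pi * r\<^sup>2) * ennreal (norm (h 0) powr p) \<le>
     (\<integral>\<^sup>+c\<in>ball 0 r. ennreal (norm (h c) powr p) \<partial>lborel)"
proof -
  define H where "H c = ennreal (norm (h c) powr p) * indicator (ball 0 r) c" for c
  have H[measurable]: "H \<in> borel_measurable borel"
  proof -
    have "continuous_on (ball 0 r) (\<lambda>c. norm (h c) powr p)"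
      using p holomorphic_on_imp_continuous_on[OF h] by (intro continuous_on_powr' continuous_intros) auto
    then have "(\<lambda>c. indicator (ball 0 r) c *\<^sub>R norm (h c) powr p) \<in> borel_measurable borel"
      by (intro borel_measurable_continuous_on_indicator) auto
    then have "(\<lambda>c. ennreal (indicator (ball 0 r) c *\<^sub>R norm (h c) powr p)) \<in> borel_measurable borel"
      by (rule measurable_compose) simp
    moreover have "(\<lambda>c. ennreal (indicator (ball 0 r) c *\<^sub>R norm (h c) powr p)) = H"
      by (auto simp: H_def fun_eq_iff indicator_def)
    ultimately show ?thesis by (simp only:)
  qed
  define e where "e t = exp (2 * of_real pi * \<i> * complex_of_real t)" for t :: real
  have e1: "norm (e t) = 1" for t unfolding e_def by (simp add: norm_exp_eq_Re)
  have [measurable]: "e \<in> borel_measurable borel"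
    unfolding e_def[abs_def] by (intro borel_measurable_continuous_onI continuous_intros)
  have m2: "(\<lambda>(t, c). H (e t * c) * indicator {0..1::real} t) \<in> borel_measurable (lborel \<Otimes>\<^sub>M lborel)"
    by measurable
  have "ennreal (pi * r\<^sup>2) * ennreal (norm (h 0) powr p) =
      (\<integral>\<^sup>+c. ennreal (norm (h 0) powr p) * indicator (ball 0 r :: complex set) c \<partial>lborel)"
    using r by (subst nn_integral_cmult_indicator) (simp_all add: emeasure_ball unit_ball_vol_2 mult.commute)
  also have "\<dots> \<le> (\<integral>\<^sup>+c. \<integral>\<^sup>+t. H (e t * c) * indicator {0..1} t \<partial>lborel \<partial>lborel)"
  proof (rule nn_integral_mono)
    fix c :: complex
    show "ennreal (norm (h 0) powr p) * indicator (ball 0 r) c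
        \<le> (\<integral>\<^sup>+t. H (e t * c) * indicator {0..1} t \<partial>lborel)"
    proof (cases "c \<in> ball 0 r")
      case True
      have sub: "c * w \<in> ball 0 r" if "w \<in> cball 0 1" for w
      proof -
        have "norm c * norm w \<le> norm c * 1" using that by (intro mult_left_mono) auto
        then show ?thesis using True by (simp add: norm_mult)
      qed
      have "ennreal (norm ((\<lambda>w. h (c * w)) 0) powr p) \<le>
        (\<integral>\<^sup>+t\<in>{0..1}. ennreal (norm ((\<lambda>w. h (c * w)) (exp (2 * of_real pi * \<i> * of_real t))) powr p) \<partial>lborel)"
      proof (rule circle_mean_powr[OF _ _ p])
        have "(h \<circ> (\<lambda>w. c * w)) holomorphic_on cball 0 1"
          using sub by (intro holomorphic_on_compose_gen[OF _ h] holomorphic_intros) auto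
        then have *: "(\<lambda>w. h (c * w)) holomorphic_on cball 0 1" by (simp add: o_def)
        then show "continuous_on (cball 0 1) (\<lambda>w. h (c * w))" by (rule holomorphic_on_imp_continuous_on)
        show "(\<lambda>w. h (c * w)) holomorphic_on ball 0 1"
          by (rule holomorphic_on_subset[OF *]) auto
      qed
      also have "\<dots> = (\<integral>\<^sup>+t. H (e t * c) * indicator {0..1} t \<partial>lborel)"
        unfolding e_def[symmetric]
        using True by (intro nn_integral_cong) (simp add: H_def norm_mult e1 mult.commute)
      finally show ?thesis using True by simp
    qed simp
  qed
  also have "\<dots> = (\<integral>\<^sup>+t. \<integral>\<^sup>+c. H (e t * c) * indicator {0..1} t \<partial>lborel \<partial>lborel)"
    using lborel_pair.Fubini'[OF m2] by simp
  also have "\<dots> = (\<integral>\<^sup>+t. (\<integral>\<^sup>+c. H c \<partial>lborel) * indicator {0..1::real} t \<partial>lborel)"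
    by (simp add: nn_integral_multc nn_integral_complex_rotate e1)
  also have "\<dots> = (\<integral>\<^sup>+c. H c \<partial>lborel)"
    by (simp add: nn_integral_cmult)
  finally show ?thesis by (simp add: H_def)
qed

section \<open>Mean values over non-isotropic regions\<close>

lemma continuous_on_vector_smult [continuous_intros]:
  fixes f :: "_ \<Rightarrow> complex" and g :: "_ \<Rightarrow> complex ^ 'n"
  assumes "continuous_on A f" "continuous_on A g"
  shows "continuous_on A (\<lambda>x. f x *s g x)"
  unfolding vector_scalar_mult_def by (intro continuous_intros assms)

lemma continuous_on_cinner [continuous_intros]:
  fixes f g :: "_ \<Rightarrow> complex ^ 'n"
  assumes "continuous_on A f" "continuous_on A g"
  shows "continuous_on A (\<lambda>x. cinner (f x) (g x))"
  unfolding cinner_def by (intro continuous_intros assms)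

lemma borel_measurable_vector_smult [measurable]:
  fixes f :: "_ \<Rightarrow> complex" and g :: "_ \<Rightarrow> complex ^ 'n"
  assumes "f \<in> borel_measurable M" "g \<in> borel_measurable M"
  shows "(\<lambda>x. f x *s g x) \<in> borel_measurable M"
  using assms by (rule borel_measurable_continuous_Pair) (intro continuous_intros)

lemma borel_measurable_cinner [measurable]:
  fixes f g :: "_ \<Rightarrow> complex ^ 'n"
  assumes "f \<in> borel_measurable M" "g \<in> borel_measurable M"
  shows "(\<lambda>x. cinner (f x) (g x)) \<in> borel_measurable M"
  using assms by (rule borel_measurable_continuous_Pair) (intro continuous_intros)

lemma cinner_add_left: "cinner (x + y) w = cinner x w + cinner y w"
  by (simp add: cinner_def algebra_simps sum.distrib)

lemma cinner_add_right: "cinner w (x + y) = cinner w x + cinner w y"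
  by (simp add: cinner_def algebra_simps sum.distrib)

lemma norm_add_smult_orthogonal:
  fixes x \<zeta> :: "complex ^ 'n"
  assumes "norm \<zeta> = 1" "cinner x \<zeta> = 0"
  shows "(norm (b *s \<zeta> + x))\<^sup>2 = (norm b)\<^sup>2 + (norm x)\<^sup>2"
proof -
  have x: "cinner \<zeta> x = 0" using assms(2) by (subst cinner_commute) simp
  have "complex_of_real ((norm (b *s \<zeta> + x))\<^sup>2) = cinner (b *s \<zeta> + x) (b *s \<zeta> + x)"
    by (rule cinner_self[symmetric])
  also have "\<dots> = b * cnj b * cinner \<zeta> \<zeta> + cinner x x"
    by (simp add: cinner_add_left cinner_add_right cinner_linear_left cinner_linear_right assms x)
  also have "\<dots> = complex_of_real ((norm b)\<^sup>2 + (norm x)\<^sup>2)"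
    unfolding cinner_self assms complex_norm_square[symmetric] by simp
  finally show ?thesis unfolding of_real_eq_iff .
qed

text \<open>For a unit vector \<zeta> this is the projection onto its complex orthogonal complement.
  In contrast to \<open>proj_span\<close> there is no quotient.\<close>

definition orth_proj :: "complex ^ 'n \<Rightarrow> complex ^ 'n \<Rightarrow> complex ^ 'n" where
  "orth_proj \<zeta> x = x - cinner x \<zeta> *s \<zeta>"

lemma orth_proj:
  assumes "norm \<zeta> = 1"
  shows "cinner (orth_proj \<zeta> x) \<zeta> = 0" "cinner x \<zeta> *s \<zeta> + orth_proj \<zeta> x = x"
    "(norm x)\<^sup>2 = (norm (cinner x \<zeta>))\<^sup>2 + (norm (orth_proj \<zeta> x))\<^sup>2" "norm (orth_proj \<zeta> x) \<le> norm x"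
proof -
  show 1: "cinner (orth_proj \<zeta> x) \<zeta> = 0"
    by (simp add: orth_proj_def cinner_linear_left cinner_self assms)
  show 2: "cinner x \<zeta> *s \<zeta> + orth_proj \<zeta> x = x" by (simp add: orth_proj_def)
  show 3: "(norm x)\<^sup>2 = (norm (cinner x \<zeta>))\<^sup>2 + (norm (orth_proj \<zeta> x))\<^sup>2"
    using norm_add_smult_orthogonal[OF assms 1, of "cinner x \<zeta>" ] unfolding 2 .
  then have "(norm (orth_proj \<zeta> x))\<^sup>2 \<le> (norm x)\<^sup>2" by simp
  then show "norm (orth_proj \<zeta> x) \<le> norm x" by (simp add: abs_le_square_iff[symmetric])
qed

text \<open>A mean value inequality on discs in direction \<open>v\<close> raises the dimension of the set on which
  \<open>G\<close> is averaged by one. Only Tonelli's theorem and translations in the variables \<open>c = \<phi> y + k\<close>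
  and \<open>y = w - k v\<^sub>0\<close> are needed, so that no Jacobian has to be computed.\<close>

lemma mean_value_add_direction:
  fixes G :: "complex ^ 'n \<Rightarrow> ennreal" and P :: "complex ^ 'n \<Rightarrow> complex ^ 'n"
  assumes [measurable]: "G \<in> borel_measurable borel" "P \<in> borel_measurable borel" "\<phi> \<in> borel_measurable borel"
    and P: "\<And>y k. P (y + k *s v\<^sub>0) = P y" and \<phi>: "\<And>y k. \<phi> (y + k *s v\<^sub>0) = \<phi> y + k"
    and v0: "norm v\<^sub>0 = 1" and \<phi>_le: "\<And>y. norm (\<phi> y) \<le> norm y"
    and r: "0 < r" and \<rho>: "0 < \<rho>"
    and mean: "\<And>y. norm y < r \<Longrightarrow>
      ennreal (pi * \<rho>\<^sup>2) * G (P y) \<le> (\<integral>\<^sup>+c\<in>ball 0 \<rho>. G (P y + c *s v) \<partial>lborel)"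
  shows "ennreal (pi * \<rho>\<^sup>2) * (\<integral>\<^sup>+y\<in>ball 0 r. G (P y) \<partial>lborel) \<le>
    ennreal (pi * (r + \<rho>)\<^sup>2) *
      (\<integral>\<^sup>+w\<in>{w. norm w < 2 * r + \<rho> \<and> norm (\<phi> w) < \<rho>}. G (P w + \<phi> w *s v) \<partial>lborel)"
proof -
  define K where "K k w = G (P w + \<phi> w *s v) * (if norm (w - k *s v\<^sub>0) < r \<and> norm (\<phi> w) < \<rho> then 1 else 0)" for k w
  define E where "E = {w. norm w < 2 * r + \<rho> \<and> norm (\<phi> w) < \<rho>}"
  have [measurable]: "E \<in> sets borel" unfolding E_def by measurable
  have [measurable]: "ball (0 :: complex ^ 'n) r \<in> sets borel" "ball (0 :: complex) \<rho> \<in> sets borel" by simp_all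
  have mK: "(\<lambda>(k, y). K k (y + k *s v\<^sub>0)) \<in> borel_measurable (lborel \<Otimes>\<^sub>M lborel)"
    unfolding K_def by measurable
  have [measurable]: "(\<lambda>w. K k w) \<in> borel_measurable borel" for k
    unfolding K_def by measurable
  have "ennreal (pi * \<rho>\<^sup>2) * (\<integral>\<^sup>+y\<in>ball 0 r. G (P y) \<partial>lborel)
      = (\<integral>\<^sup>+y. ennreal (pi * \<rho>\<^sup>2) * (G (P y) * indicator (ball 0 r) y) \<partial>lborel)"
    by (rule nn_integral_cmult[symmetric]) measurable
  also have "\<dots> \<le> (\<integral>\<^sup>+y. \<integral>\<^sup>+k. K k (y + k *s v\<^sub>0) \<partial>lborel \<partial>lborel)"
  proof (rule nn_integral_mono)
    fix y
    show "ennreal (pi * \<rho>\<^sup>2) * (G (P y) * indicator (ball 0 r) y) \<le> (\<integral>\<^sup>+k. K k (y + k *s v\<^sub>0) \<partial>lborel)"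
    proof (cases "y \<in> ball 0 r")
      case True
      then have "ennreal (pi * \<rho>\<^sup>2) * (G (P y) * indicator (ball 0 r) y)
         \<le> (\<integral>\<^sup>+c. G (P y + c *s v) * indicator (ball 0 \<rho>) c \<partial>lborel)"
        using mean[of y] by simp
      also have "\<dots> = (\<integral>\<^sup>+k. G (P y + (k + \<phi> y) *s v) * indicator (ball 0 \<rho>) (k + \<phi> y) \<partial>lborel)"
        by (rule nn_integral_lborel_translate[symmetric]) measurable
      also have "\<dots> = (\<integral>\<^sup>+k. K k (y + k *s v\<^sub>0) \<partial>lborel)"
        using True by (intro nn_integral_cong) (simp add: K_def P \<phi> add.commute[of "\<phi> y"] indicator_def)
      finally show ?thesis .
    qed simp
  qed
  also have "\<dots> = (\<integral>\<^sup>+k. \<integral>\<^sup>+y. K k (y + k *s v\<^sub>0) \<partial>lborel \<partial>lborel)"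
    using lborel_pair.Fubini'[OF mK] by simp
  also have "\<dots> = (\<integral>\<^sup>+k. \<integral>\<^sup>+w. K k w \<partial>lborel \<partial>lborel)"
    by (subst nn_integral_lborel_translate) auto
  \<comment> \<open>After the translation \<open>G\<close> is evaluated at a point that depends on
    \<open>w\<close> alone, and \<open>k\<close> survives only in the support condition. That
    condition confines \<open>k\<close> to a disc of radius r + \<rho>, whose area becomes the
    constant.\<close>
  also have "\<dots> \<le> (\<integral>\<^sup>+k. (\<integral>\<^sup>+w\<in>E. G (P w + \<phi> w *s v) \<partial>lborel) * indicator (ball 0 (r + \<rho>)) (k :: complex) \<partial>lborel)"
  proof (rule nn_integral_mono)
    fix k :: complex
    show "(\<integral>\<^sup>+w. K k w \<partial>lborel) \<le> (\<integral>\<^sup>+w\<in>E. G (P w + \<phi> w *s v) \<partial>lborel) * indicator (ball 0 (r + \<rho>)) k"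
    proof -
      have "K k w \<le> G (P w + \<phi> w *s v) * indicator E w * indicator (ball 0 (r + \<rho>)) k" for w
      proof (cases "norm (w - k *s v\<^sub>0) < r \<and> norm (\<phi> w) < \<rho>")
        case True
        define y where "y = w - k *s v\<^sub>0"
        have w: "w = y + k *s v\<^sub>0" by (simp add: y_def)
        have "\<phi> w = \<phi> y + k" unfolding w by (rule \<phi>)
        then have "norm k \<le> norm (\<phi> w) + norm (\<phi> y)"
          using norm_triangle_ineq4[of "\<phi> w" "\<phi> y"] by simp
        also have "\<dots> < \<rho> + r" using True \<phi>_le[of y] by (simp add: y_def)
        finally have k: "norm k < r + \<rho>" by simp
        have "norm w \<le> norm y + norm k"
          unfolding w using norm_triangle_ineq[of y "k *s v\<^sub>0"] by (simp add: norm_vector_smult v0)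
        also have "\<dots> < r + (r + \<rho>)" using True k by (simp add: y_def)
        finally have "w \<in> E" using True by (simp add: E_def)
        then show ?thesis using True k by (simp add: K_def)
      qed (auto simp: K_def)
      then have "(\<integral>\<^sup>+w. K k w \<partial>lborel) \<le> (\<integral>\<^sup>+w. G (P w + \<phi> w *s v) * indicator E w * indicator (ball 0 (r + \<rho>)) k \<partial>lborel)"
        by (intro nn_integral_mono)
      also have "\<dots> = (\<integral>\<^sup>+w\<in>E. G (P w + \<phi> w *s v) \<partial>lborel) * indicator (ball 0 (r + \<rho>)) k"
        by (subst nn_integral_multc) auto
      finally show ?thesis .
    qed
  qed
  also have "\<dots> = ennreal (pi * (r + \<rho>)\<^sup>2) * (\<integral>\<^sup>+w\<in>E. G (P w + \<phi> w *s v) \<partial>lborel)"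
    using r \<rho> by (subst nn_integral_cmult_indicator) (simp_all add: emeasure_ball unit_ball_vol_2 mult.commute)
  finally show ?thesis by (simp add: E_def)
qed

definition coord_proj :: "'n set \<Rightarrow> complex ^ 'n \<Rightarrow> complex ^ 'n" where
  "coord_proj I x = (\<chi> i. if i \<in> I then x $ i else 0)"

lemma norm_coord_proj_le: "norm (coord_proj I x) \<le> norm x"
  unfolding norm_vec_def by (intro L2_set_mono) (auto simp: coord_proj_def)

text \<open>An average over the complement of \<zeta>, of complex dimension n - 1, written as an
  integral over a ball of full dimension. The averages are taken successively in the n directions
  \<open>orth_proj \<zeta> (axis k 1)\<close>; these are linearly dependent, but each step only uses
  the mean value property on discs. With both radii equal to R, a step enlarges R to 2R + R and
  costs (R + R)^2 / R^2, which explains the powers of 3 and 4.\<close>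

lemma mean_value_hyperplane:
  fixes G :: "complex ^ 'n \<Rightarrow> ennreal" and \<zeta> :: "complex ^ 'n"
  assumes [measurable]: "G \<in> borel_measurable borel" and \<zeta>: "norm \<zeta> = 1" and r: "0 < r"
    and mean: "\<And>x v \<rho>. cinner x \<zeta> = 0 \<Longrightarrow> cinner v \<zeta> = 0 \<Longrightarrow> norm v \<le> 1 \<Longrightarrow> 0 < \<rho> \<Longrightarrow>
       norm x + \<rho> < 2 * 3 ^ CARD('n) * r \<Longrightarrow>
       ennreal (pi * \<rho>\<^sup>2) * G x \<le> (\<integral>\<^sup>+c\<in>ball 0 \<rho>. G (x + c *s v) \<partial>lborel)"
  shows "emeasure lborel (ball (0 :: complex ^ 'n) r) * G 0 \<le>
     4 ^ CARD('n) * (\<integral>\<^sup>+y\<in>ball 0 (3 ^ CARD('n) * r). G (orth_proj \<zeta> y) \<partial>lborel)"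
proof -
  have mcp[measurable]: "coord_proj I \<in> borel_measurable borel" for I :: "'n set"
    unfolding coord_proj_def[abs_def]
  proof (intro borel_measurable_continuous_onI continuous_on_vec_lambda)
    show "continuous_on UNIV (\<lambda>x. if i \<in> I then x $ i else 0 :: complex)" for i
      by (cases "i \<in> I") (auto intro: continuous_intros)
  qed
  have mop[measurable]: "orth_proj \<zeta> \<in> borel_measurable borel"
    unfolding orth_proj_def[abs_def] by measurable
  have "emeasure lborel (ball (0 :: complex ^ 'n) r) * G 0 \<le>
     4 ^ card I * (\<integral>\<^sup>+y\<in>ball 0 (3 ^ card I * r). G (orth_proj \<zeta> (coord_proj I y)) \<partial>lborel)"
    if "finite I" for I :: "'n set"
    using that
  proof (induction I)
    case empty
    have "coord_proj {} y = 0" for y :: "complex ^ 'n" by (simp add: coord_proj_def vec_eq_iff)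
    then have "(\<integral>\<^sup>+y\<in>ball 0 (3 ^ card ({} :: 'n set) * r). G (orth_proj \<zeta> (coord_proj {} y)) \<partial>lborel)
       = (\<integral>\<^sup>+y\<in>ball (0 :: complex ^ 'n) r. G 0 \<partial>lborel)"
      by (simp add: orth_proj_def cinner_def)
    also have "\<dots> = emeasure lborel (ball (0 :: complex ^ 'n) r) * G 0"
      by (subst nn_integral_cmult_indicator) (simp_all add: mult.commute)
    finally show ?case by simp
  next
    case (insert k I)
    define R where "R = 3 ^ card I * r"
    have R: "R > 0" using r by (simp add: R_def)
    have "card (insert k I) \<le> CARD('n)" by (intro card_mono) auto
    then have "card I < CARD('n)" using insert by simp
    then have "(3::real) ^ card I \<le> 3 ^ CARD('n)" by (intro power_increasing) auto
    then have Rn: "2 * R \<le> 2 * 3 ^ CARD('n) * r" using r by (simp add: R_def)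
    have add: "orth_proj \<zeta> (x + y) = orth_proj \<zeta> x + orth_proj \<zeta> y"
      and smult: "orth_proj \<zeta> (c *s x) = c *s orth_proj \<zeta> x" for x y c
      by (simp_all add: orth_proj_def cinner_add_left cinner_linear_left vec_eq_iff algebra_simps)
    have "ennreal (pi * R\<^sup>2) * (\<integral>\<^sup>+y\<in>ball 0 R. G (orth_proj \<zeta> (coord_proj I y)) \<partial>lborel) \<le>
      ennreal (pi * (R + R)\<^sup>2) *
      (\<integral>\<^sup>+w\<in>{w. norm w < 2 * R + R \<and> norm (w $ k) < R}.
         G (orth_proj \<zeta> (coord_proj I w) + w $ k *s orth_proj \<zeta> (axis k 1)) \<partial>lborel)"
    proof (rule mean_value_add_direction[where v\<^sub>0 = "axis k 1"])
      show "orth_proj \<zeta> (coord_proj I (y + c *s axis k 1)) = orth_proj \<zeta> (coord_proj I y)" for y c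
      proof -
        have "coord_proj I (y + c *s axis k 1) = coord_proj I y"
          using insert by (auto simp: coord_proj_def vec_eq_iff axis_def)
        then show ?thesis by simp
      qed
      show "(y + c *s axis k 1) $ k = y $ k + c" for y :: "complex ^ 'n" and c by (simp add: axis_def)
      show "norm (axis k 1 :: complex ^ 'n) = 1" by simp
      show "norm (y $ k) \<le> norm y" for y :: "complex ^ 'n" by (rule Finite_Cartesian_Product.norm_nth_le)
      show "ennreal (pi * R\<^sup>2) * G (orth_proj \<zeta> (coord_proj I y))
         \<le> (\<integral>\<^sup>+c\<in>ball 0 R. G (orth_proj \<zeta> (coord_proj I y) + c *s orth_proj \<zeta> (axis k 1)) \<partial>lborel)"
        if "norm y < R" for y
      proof (rule mean)
        show "norm (orth_proj \<zeta> (axis k 1)) \<le> 1" using orth_proj(4)[OF \<zeta>, of "axis k 1"] by simp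
        have "norm (orth_proj \<zeta> (coord_proj I y)) \<le> norm y"
          using orth_proj(4)[OF \<zeta>, of "coord_proj I y"] norm_coord_proj_le[of I y] by linarith
        then show "norm (orth_proj \<zeta> (coord_proj I y)) + R < 2 * 3 ^ CARD('n) * r" using that Rn by linarith
      qed (use R orth_proj \<zeta> in auto)
      show "(\<lambda>y :: complex ^ 'n. y $ k) \<in> borel_measurable borel"
        by (intro borel_measurable_continuous_onI continuous_intros)
    qed (use R in \<open>simp_all\<close>)
    also have "(\<integral>\<^sup>+w\<in>{w. norm w < 2 * R + R \<and> norm (w $ k) < R}.
         G (orth_proj \<zeta> (coord_proj I w) + w $ k *s orth_proj \<zeta> (axis k 1)) \<partial>lborel)
      \<le> (\<integral>\<^sup>+w\<in>ball 0 (3 * R). G (orth_proj \<zeta> (coord_proj (insert k I) w)) \<partial>lborel)"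
    proof (rule nn_integral_mono)
      fix w :: "complex ^ 'n"
      have "coord_proj (insert k I) w = coord_proj I w + w $ k *s axis k 1"
        using insert by (auto simp: coord_proj_def vec_eq_iff axis_def)
      then have "orth_proj \<zeta> (coord_proj I w) + w $ k *s orth_proj \<zeta> (axis k 1) = orth_proj \<zeta> (coord_proj (insert k I) w)"
        by (simp add: add smult)
      then show "G (orth_proj \<zeta> (coord_proj I w) + w $ k *s orth_proj \<zeta> (axis k 1)) *
          indicator {w. norm w < 2 * R + R \<and> norm (w $ k) < R} w
        \<le> G (orth_proj \<zeta> (coord_proj (insert k I) w)) * indicator (ball 0 (3 * R)) w"
        by (auto simp: indicator_def)
    qed
    finally have "ennreal (pi * R\<^sup>2) * (\<integral>\<^sup>+y\<in>ball 0 R. G (orth_proj \<zeta> (coord_proj I y)) \<partial>lborel) \<le>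
      ennreal (pi * (R + R)\<^sup>2) * (\<integral>\<^sup>+w\<in>ball 0 (3 * R). G (orth_proj \<zeta> (coord_proj (insert k I) w)) \<partial>lborel)"
      by (simp add: mult_left_mono)
    also have "ennreal (pi * (R + R)\<^sup>2) = ennreal (pi * R\<^sup>2) * 4"
      by (simp add: ennreal_mult'[symmetric] power2_eq_square algebra_simps flip: ennreal_numeral)
    finally have "(\<integral>\<^sup>+y\<in>ball 0 R. G (orth_proj \<zeta> (coord_proj I y)) \<partial>lborel) \<le>
       4 * (\<integral>\<^sup>+w\<in>ball 0 (3 * R). G (orth_proj \<zeta> (coord_proj (insert k I) w)) \<partial>lborel)"
      using R unfolding mult.assoc by (subst (asm) ennreal_mult_le_mult_iff) auto
    then have "4 ^ card I * (\<integral>\<^sup>+y\<in>ball 0 R. G (orth_proj \<zeta> (coord_proj I y)) \<partial>lborel) \<le>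
       4 ^ card I * (4 * (\<integral>\<^sup>+w\<in>ball 0 (3 * R). G (orth_proj \<zeta> (coord_proj (insert k I) w)) \<partial>lborel))"
      by (rule mult_left_mono) simp
    with insert.IH show ?case using insert by (simp add: R_def mult_ac)
  qed
  from this[of UNIV] show ?thesis
    by (simp add: coord_proj_def)
qed

text \<open>Values outside the ball are arbitrary, so measurability can only be expected of the
  truncated function; truncating inside the norm as well reduces it to continuity on the open
  ball.\<close>

lemma borel_measurable_powr_norm_indicator:
  fixes g :: "complex ^ 'n \<Rightarrow> complex"
  assumes "continuous_on (ball 0 1) g"
  shows "(\<lambda>w. ennreal (norm (g w) powr p) * indicator (ball 0 1) w) \<in> borel_measurable borel"
proof -
  have [measurable]: "ball (0 :: complex ^ 'n) 1 \<in> sets borel" by simp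
  have "(\<lambda>w. indicator (ball 0 1) w *\<^sub>R g w) \<in> borel_measurable borel"
    using assms by (intro borel_measurable_continuous_on_indicator) auto
  then have "(\<lambda>w. ennreal (norm (indicator (ball 0 1) w *\<^sub>R g w) powr p) * indicator (ball 0 1) w) \<in> borel_measurable borel"
    by measurable
  moreover have "(\<lambda>w. ennreal (norm (indicator (ball 0 1) w *\<^sub>R g w) powr p) * indicator (ball 0 1) w)
    = (\<lambda>w. ennreal (norm (g w) powr p) * indicator (ball 0 1) w)"
    by (auto simp: fun_eq_iff indicator_def)
  ultimately show ?thesis by simp
qed

text \<open>Put \<delta> = 1 - t. Averaging across the ray at scale sqrt \<delta> and then along it
  at scale \<delta> puts \<rho>^2 r^(2n), of order \<delta>^(n+2), on the left and (R + \<rho>)^2,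
  of order \<delta>, on the right; cancelling leaves \<delta>^(n+1). By Pythagoras the region stays
  where 1 - |w|^2 is comparable to \<delta>, and recording this in the domain of integration is what
  later permits integration over t.\<close>

lemma radial_mean_value:
  "\<exists>C>0. \<forall>(g :: complex ^ 'n \<Rightarrow> complex) p \<zeta> t.
     holomorphic_several g (ball 0 1) \<longrightarrow> 1 \<le> p \<longrightarrow> norm \<zeta> = 1 \<longrightarrow> 0 \<le> t \<longrightarrow> t < 1 \<longrightarrow>
     ennreal ((1 - t) ^ (CARD('n) + 1) * norm (g (t *\<^sub>R \<zeta>)) powr p) \<le> ennreal C *
       (\<integral>\<^sup>+w\<in>{w\<in>ball 0 1. (1 - t) / 2 \<le> 1 - (norm w)\<^sup>2 \<and> 1 - (norm w)\<^sup>2 \<le> 4 * (1 - t)}.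
          ennreal (norm (g w) powr p) \<partial>lborel)"
proof -
  define n where "n = CARD('n)"
  define v where "v = unit_ball_vol (real (2 * n))"
  define b where "b = v * (1 / 64 / 9 ^ n) ^ n * pi / 64"
  have v: "v > 0" by (simp add: v_def)
  then have b: "b > 0" by (simp add: b_def)
  define C where "C = 4 ^ n * (pi / 16) / b"
  have C: "C > 0" using b by (simp add: C_def)
  have main: "ennreal ((1 - t) ^ (CARD('n) + 1) * norm (g (t *\<^sub>R \<zeta>)) powr p) \<le> ennreal C *
       (\<integral>\<^sup>+w\<in>{w\<in>ball 0 1. (1 - t) / 2 \<le> 1 - (norm w)\<^sup>2 \<and> 1 - (norm w)\<^sup>2 \<le> 4 * (1 - t)}.
          ennreal (norm (g w) powr p) \<partial>lborel)"
    if g: "holomorphic_several g (ball 0 1)" and p: "1 \<le> p" and \<zeta>: "norm \<zeta> = 1" and t: "0 \<le> t" "t < 1"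
    for g :: "complex ^ 'n \<Rightarrow> complex" and p t \<zeta>
  proof -
    define \<delta> where "\<delta> = 1 - t"
    have \<delta>: "0 < \<delta>" "\<delta> \<le> 1" using t by (auto simp: \<delta>_def)
    define a where "a = t *\<^sub>R \<zeta>"
    have a: "a = complex_of_real t *s \<zeta>"
      by (simp add: a_def vec_eq_iff scaleR_conv_of_real[where 'a = complex])
    \<comment> \<open>The margins add up: along the ray \<open>t3\<close> gives |t + c|^2 <= 1 -
      \<delta> + \<delta>/8, and the orthogonal part of a point of the final region contributes less
      than (3R)^2 = 9\<delta>/64, which leaves more than \<delta>/2 of room.\<close>
    define R where "R = sqrt \<delta> / 8"
    have R: "R > 0" "R\<^sup>2 = \<delta> / 64" using \<delta> by (simp_all add: R_def power_divide)
    \<comment> \<open>Averaging over the complement enlarges the radius by 3^n, so it has to start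
      this much smaller in order to end at \<open>R\<close>.\<close>
    define r where "r = R / 3 ^ n"
    have r: "r > 0" "3 ^ n * r = R" using R by (simp_all add: r_def)
    define \<rho> where "\<rho> = \<delta> / 8"
    have "\<delta> \<le> sqrt \<delta>" using \<delta> by (intro real_le_rsqrt) (simp add: power2_eq_square mult_left_le)
    then have \<rho>: "\<rho> > 0" "\<rho> \<le> R" using \<delta> by (simp_all add: \<rho>_def R_def)
    define G where "G w = ennreal (norm (g (a + w)) powr p) * indicator (ball 0 1) (a + w)" for w
    have contg: "continuous_on (ball 0 1) g" by (rule holomorphic_several_continuous_on[OF g])
    note mg[measurable] = borel_measurable_powr_norm_indicator[OF contg, of p]
    have [measurable]: "G \<in> borel_measurable borel"
      unfolding G_def[abs_def] by (rule measurable_compose[OF _ mg]) simp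
    have disc: "ennreal (pi * \<rho>'\<^sup>2) * G x \<le> (\<integral>\<^sup>+c\<in>ball 0 \<rho>'. G (x + c *s v) \<partial>lborel)"
      if \<rho>': "0 < \<rho>'" and mem: "\<And>c. norm c < \<rho>' \<Longrightarrow> a + x + c *s v \<in> ball 0 1" for x v \<rho>'
    proof -
      have "(\<lambda>c. g (a + x + c *s v)) holomorphic_on ball 0 \<rho>'"
        using mem by (intro holomorphic_several_line[OF g]) auto
      from disc_mean_powr[OF this \<rho>' p]
      have "ennreal (pi * \<rho>'\<^sup>2) * ennreal (norm (g (a + x)) powr p) \<le>
         (\<integral>\<^sup>+c\<in>ball 0 \<rho>'. ennreal (norm (g (a + x + c *s v)) powr p) \<partial>lborel)" by simp
      also have "\<dots> = (\<integral>\<^sup>+c\<in>ball 0 \<rho>'. G (x + c *s v) \<partial>lborel)"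
        using mem by (intro nn_integral_cong) (auto simp: G_def indicator_def add.assoc)
      finally show ?thesis using mem[of 0] \<rho>' by (simp add: G_def)
    qed
    have sq: "(norm (a + b *s \<zeta> + x))\<^sup>2 = (norm (of_real t + b))\<^sup>2 + (norm x)\<^sup>2" if "cinner x \<zeta> = 0" for b x
      using norm_add_smult_orthogonal[OF \<zeta> that, of "of_real t + b"]
      by (simp add: a vector_sadd_rdistrib add.assoc)
    have lt1: "norm w < 1" if "(norm w)\<^sup>2 < 1" for w :: "complex ^ 'n"
      using that by (simp add: abs_square_less_1)
    have t2: "t\<^sup>2 \<le> 1 - \<delta>" using t by (simp add: \<delta>_def power2_eq_square mult_left_le)
    have t3: "(norm (of_real t + c))\<^sup>2 \<le> 1 - \<delta> + \<rho>" if "norm c < \<rho>" for c :: complex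
    proof -
      have "norm (of_real t + c) \<le> t + norm c" using norm_triangle_ineq[of "of_real t" c] t by simp
      then have *: "norm (of_real t + c) \<le> 1 - \<delta> + \<rho>" using that by (simp add: \<delta>_def)
      moreover have "1 - \<delta> + \<rho> \<le> 1" using \<delta> by (simp add: \<rho>_def)
      ultimately have "norm (of_real t + c) * norm (of_real t + c) \<le> (1 - \<delta> + \<rho>) * 1"
        using \<rho> \<delta> by (intro mult_mono) (auto intro: order_trans)
      then show ?thesis by (simp add: power2_eq_square)
    qed
    have A: "emeasure lborel (ball (0 :: complex ^ 'n) r) * G 0 \<le>
     4 ^ CARD('n) * (\<integral>\<^sup>+y\<in>ball 0 (3 ^ CARD('n) * r). G (orth_proj \<zeta> y) \<partial>lborel)"
    proof (rule mean_value_hyperplane[OF _ \<zeta> r(1)])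
      fix x v :: "complex ^ 'n" and \<rho>' :: real
      assume x: "cinner x \<zeta> = 0" and v: "cinner v \<zeta> = 0" "norm v \<le> 1" and \<rho>': "0 < \<rho>'"
        and le: "norm x + \<rho>' < 2 * 3 ^ CARD('n) * r"
      show "ennreal (pi * \<rho>'\<^sup>2) * G x \<le> (\<integral>\<^sup>+c\<in>ball 0 \<rho>'. G (x + c *s v) \<partial>lborel)"
      proof (rule disc[OF \<rho>'])
        fix c :: complex assume c: "norm c < \<rho>'"
        have o: "cinner (x + c *s v) \<zeta> = 0" using x v by (simp add: cinner_add_left cinner_linear_left)
        have "norm (x + c *s v) \<le> norm x + norm c * norm v"
          using norm_triangle_ineq[of x "c *s v"] by (simp add: norm_vector_smult)
        also have "norm c * norm v \<le> norm c * 1" using v by (intro mult_left_mono) auto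
        also have "norm x + norm c * 1 < 2 * R" using le c r(2) by (simp add: n_def)
        finally have "(norm (x + c *s v))\<^sup>2 < (2 * R)\<^sup>2" by (intro power_strict_mono) auto
        also have "(2 * R)\<^sup>2 = \<delta> / 16" using R by (simp add: power_mult_distrib)
        finally have "(norm (a + 0 *s \<zeta> + (x + c *s v)))\<^sup>2 < 1"
          using t2 \<delta> t unfolding sq[OF o] by simp
        then show "a + x + c *s v \<in> ball 0 1" using lt1 by (simp add: add.assoc)
      qed
    qed simp
    define E where "E = {w. norm w < 2 * R + \<rho> \<and> norm (cinner w \<zeta>) < \<rho>}"
    have B: "ennreal (pi * \<rho>\<^sup>2) * (\<integral>\<^sup>+y\<in>ball 0 R. G (orth_proj \<zeta> y) \<partial>lborel) \<le>
      ennreal (pi * (R + \<rho>)\<^sup>2) * (\<integral>\<^sup>+w\<in>{w. norm w < 2 * R + \<rho> \<and> norm (cinner w \<zeta>) < \<rho>}.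
         G (orth_proj \<zeta> w + cinner w \<zeta> *s \<zeta>) \<partial>lborel)"
    proof (rule mean_value_add_direction[where v\<^sub>0 = \<zeta>])
      show "orth_proj \<zeta> \<in> borel_measurable borel" unfolding orth_proj_def[abs_def] by measurable
      show "orth_proj \<zeta> (y + k *s \<zeta>) = orth_proj \<zeta> y" for y k
        by (simp add: orth_proj_def cinner_add_left cinner_linear_left cinner_self \<zeta> vec_eq_iff algebra_simps)
      show "cinner (y + k *s \<zeta>) \<zeta> = cinner y \<zeta> + k" for y k
        by (simp add: cinner_add_left cinner_linear_left cinner_self \<zeta>)
      show "norm (cinner y \<zeta>) \<le> norm y" for y using norm_cinner_le[of y \<zeta>] \<zeta> by simp
      fix y :: "complex ^ 'n" assume y: "norm y < R"
      show "ennreal (pi * \<rho>\<^sup>2) * G (orth_proj \<zeta> y) \<le> (\<integral>\<^sup>+c\<in>ball 0 \<rho>. G (orth_proj \<zeta> y + c *s \<zeta>) \<partial>lborel)"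
      proof (rule disc[OF \<rho>(1)])
        fix c :: complex assume c: "norm c < \<rho>"
        have "norm (orth_proj \<zeta> y) < R" using orth_proj(4)[OF \<zeta>, of y] y by simp
        then have "(norm (orth_proj \<zeta> y))\<^sup>2 < R\<^sup>2" by (intro power_strict_mono) auto
        then have "(norm (a + c *s \<zeta> + orth_proj \<zeta> y))\<^sup>2 < 1"
          unfolding sq[OF orth_proj(1)[OF \<zeta>]] using t3[OF c] R \<delta> by (simp add: \<rho>_def)
        then show "a + orth_proj \<zeta> y + c *s \<zeta> \<in> ball 0 1" using lt1 by (simp add: ac_simps)
      qed
    qed (use R \<rho> \<zeta> in auto)
    define T where "T = {w :: complex ^ 'n. w \<in> ball 0 1 \<and> (1 - t) / 2 \<le> 1 - (norm w)\<^sup>2 \<and> 1 - (norm w)\<^sup>2 \<le> 4 * (1 - t)}"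
    have [measurable]: "E \<in> sets borel" unfolding E_def by measurable
    have ET: "a + w \<in> T" if w: "w \<in> E" for w
    proof -
      have c: "norm (cinner w \<zeta>) < \<rho>" and "norm w < 3 * R" using w \<rho> by (auto simp: E_def)
      then have "norm (orth_proj \<zeta> w) < 3 * R" using orth_proj(4)[OF \<zeta>, of w] by simp
      then have o: "(norm (orth_proj \<zeta> w))\<^sup>2 < (3 * R)\<^sup>2" by (intro power_strict_mono) auto
      have aw: "a + w = a + cinner w \<zeta> *s \<zeta> + orth_proj \<zeta> w"
        using orth_proj(2)[OF \<zeta>, of w] by (simp add: add.assoc)
      have nsq: "(norm (a + w))\<^sup>2 = (norm (of_real t + cinner w \<zeta>))\<^sup>2 + (norm (orth_proj \<zeta> w))\<^sup>2"
        unfolding aw by (rule sq[OF orth_proj(1)[OF \<zeta>]])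
      have up: "(norm (a + w))\<^sup>2 \<le> 1 - \<delta> / 2"
        unfolding nsq using t3[OF c] o R \<delta> by (simp add: \<rho>_def power_mult_distrib)
      have "t - \<rho> \<le> norm (of_real t + cinner w \<zeta>)"
        using norm_triangle_ineq2[of "of_real t" "- cinner w \<zeta>"] c t by simp
      moreover have "norm (of_real t + cinner w \<zeta>) \<le> norm (a + w)"
        by (rule power2_le_imp_le) (simp_all only: nsq norm_ge_zero le_add_same_cancel1 zero_le_power2)
      ultimately have "t - \<rho> \<le> norm (a + w)" by (rule order_trans)
      moreover have "1 - t = \<delta>" "\<rho> \<le> \<delta>" using \<delta> by (simp_all add: \<delta>_def \<rho>_def)
      ultimately have lo: "1 - norm (a + w) \<le> 2 * \<delta>" by linarith
      have n1: "norm (a + w) < 1" using up \<delta> by (intro lt1) auto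
      have "1 - (norm (a + w))\<^sup>2 = (1 - norm (a + w)) * (1 + norm (a + w))"
        by (simp add: algebra_simps power2_eq_square)
      also have "\<dots> \<le> (2 * \<delta>) * 2" using lo n1 by (intro mult_mono) auto
      finally have "1 - (norm (a + w))\<^sup>2 \<le> 4 * \<delta>" by simp
      moreover have "\<delta> / 2 \<le> 1 - (norm (a + w))\<^sup>2" using up by simp
      ultimately show ?thesis unfolding T_def \<delta>_def[symmetric] using n1 by simp
    qed
    have "(\<integral>\<^sup>+w\<in>{w. norm w < 2 * R + \<rho> \<and> norm (cinner w \<zeta>) < \<rho>}. G (orth_proj \<zeta> w + cinner w \<zeta> *s \<zeta>) \<partial>lborel)
       = (\<integral>\<^sup>+w\<in>E. G w \<partial>lborel)"
      using orth_proj(2)[OF \<zeta>] by (simp add: E_def add.commute)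
    also have "\<dots> \<le> (\<integral>\<^sup>+w. (\<lambda>w. ennreal (norm (g w) powr p) * indicator (ball 0 1) w * indicator T w) (w + a) \<partial>lborel)"
      using ET by (intro nn_integral_mono) (auto simp: G_def indicator_def add.commute)
    also have "\<dots> = (\<integral>\<^sup>+w. ennreal (norm (g w) powr p) * indicator (ball 0 1) w * indicator T w \<partial>lborel)"
    proof (rule nn_integral_lborel_translate)
      have [measurable]: "T \<in> sets borel" unfolding T_def mem_ball_0 by measurable
      show "(\<lambda>w. ennreal (norm (g w) powr p) * indicator (ball 0 1) w * indicator T w) \<in> borel_measurable borel"
        by measurable
    qed
    also have "\<dots> = (\<integral>\<^sup>+w\<in>T. ennreal (norm (g w) powr p) \<partial>lborel)"
      by (intro nn_integral_cong) (auto simp: T_def indicator_def)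
    finally have I: "(\<integral>\<^sup>+w\<in>{w. norm w < 2 * R + \<rho> \<and> norm (cinner w \<zeta>) < \<rho>}. G (orth_proj \<zeta> w + cinner w \<zeta> *s \<zeta>) \<partial>lborel)
       \<le> (\<integral>\<^sup>+w\<in>T. ennreal (norm (g w) powr p) \<partial>lborel)" (is "?I \<le> ?J") .
    have "(R + \<rho>)\<^sup>2 \<le> (2 * R)\<^sup>2" using R \<rho> by (intro power_mono) auto
    then have R2: "(R + \<rho>)\<^sup>2 \<le> \<delta> / 16" using R by (simp add: power_mult_distrib)
    have vol: "emeasure lborel (ball (0 :: complex ^ 'n) r) = ennreal (v * (\<delta> / 64 / 9 ^ n) ^ n)"
    proof -
      have "(3 ^ n)\<^sup>2 = ((3 :: real)\<^sup>2) ^ n" by (simp only: power_mult[symmetric] mult.commute)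
      then have "r\<^sup>2 = \<delta> / 64 / 9 ^ n" unfolding R(2)[symmetric] by (simp add: r_def power_divide)
      moreover have "r ^ (2 * n) = (r\<^sup>2) ^ n" by (simp add: power_mult)
      ultimately show ?thesis using r by (simp add: emeasure_ball v_def n_def mult.commute)
    qed
    have "ennreal (pi * \<rho>\<^sup>2) * (emeasure lborel (ball (0 :: complex ^ 'n) r) * G 0)
       \<le> ennreal (pi * \<rho>\<^sup>2) * (4 ^ n * (\<integral>\<^sup>+y\<in>ball 0 R. G (orth_proj \<zeta> y) \<partial>lborel))"
      using A r(2) by (intro mult_left_mono) (auto simp: n_def)
    also have "\<dots> = 4 ^ n * (ennreal (pi * \<rho>\<^sup>2) * (\<integral>\<^sup>+y\<in>ball 0 R. G (orth_proj \<zeta> y) \<partial>lborel))"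
      by (simp add: mult_ac)
    also have "\<dots> \<le> 4 ^ n * (ennreal (pi * (R + \<rho>)\<^sup>2) * ?I)"
      by (intro mult_left_mono B) auto
    also have "\<dots> \<le> 4 ^ n * (ennreal (pi * (\<delta> / 16)) * ?J)"
      using R2 by (intro mult_left_mono mult_mono I ennreal_leI) auto
    also have "\<dots> = ennreal \<delta> * (ennreal (4 ^ n * (pi / 16)) * ?J)"
    proof -
      have "4 ^ n * ennreal (pi * (\<delta> / 16)) = ennreal (4 ^ n * (pi * (\<delta> / 16)))"
        using ennreal_power[of 4 n] \<delta> by (simp add: ennreal_mult'[symmetric] del: ennreal_power)
      also have "\<dots> = ennreal \<delta> * ennreal (4 ^ n * (pi / 16))"
        using \<delta> by (simp add: ennreal_mult'[symmetric] algebra_simps)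
      finally show ?thesis by (simp add: mult.assoc[symmetric])
    qed
    also have "ennreal (pi * \<rho>\<^sup>2) * (emeasure lborel (ball (0 :: complex ^ 'n) r) * G 0)
       = ennreal \<delta> * (ennreal (b * \<delta> ^ (n + 1)) * G 0)"
    proof -
      have "pi * \<rho>\<^sup>2 * (v * (\<delta> / 64 / 9 ^ n) ^ n) = \<delta> * (b * \<delta> ^ (n + 1))"
        by (simp add: b_def \<rho>_def power2_eq_square power_divide mult_ac)
      then have "ennreal (pi * \<rho>\<^sup>2) * ennreal (v * (\<delta> / 64 / 9 ^ n) ^ n) = ennreal \<delta> * ennreal (b * \<delta> ^ (n + 1))"
        using \<delta> v b by (simp add: ennreal_mult'[symmetric])
      then show ?thesis unfolding vol by (simp add: mult.assoc[symmetric])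
    qed
    finally have "ennreal (b * \<delta> ^ (n + 1)) * G 0 \<le> ennreal (4 ^ n * (pi / 16)) * ?J"
      using \<delta> by (subst (asm) ennreal_mult_le_mult_iff) auto
    then have "ennreal (1 / b) * (ennreal (b * \<delta> ^ (n + 1)) * G 0) \<le> ennreal (1 / b) * (ennreal (4 ^ n * (pi / 16)) * ?J)"
      by (rule mult_left_mono) simp
    also have "\<dots> = ennreal C * ?J"
      using b by (simp add: C_def mult.assoc[symmetric] ennreal_mult'[symmetric] mult.commute[of b])
    also have "ennreal (1 / b) * (ennreal (b * \<delta> ^ (n + 1)) * G 0) = ennreal (\<delta> ^ (n + 1)) * G 0"
      using b \<delta> by (simp add: mult.assoc[symmetric] ennreal_mult'[symmetric])
    also have "\<dots> = ennreal (\<delta> ^ (n + 1) * norm (g (t *\<^sub>R \<zeta>)) powr p)"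
      using \<delta> t \<zeta> by (simp add: G_def a_def ennreal_mult')
    finally show ?thesis by (simp add: T_def \<delta>_def n_def)
  qed
  show ?thesis by (intro exI[of _ C] conjI allI impI C main)
qed

section \<open>Taylor expansion along rays\<close>

lemma directional_deriv_cong:
  fixes f :: "complex ^ 'n \<Rightarrow> complex"
  assumes "open S" "\<And>z. z \<in> S \<Longrightarrow> f z = g z" "z \<in> S"
  shows "directional_deriv v f z = directional_deriv v g z"
proof -
  have "isCont (\<lambda>c. z + c *s v) 0"
    by (intro continuous_intros bounded_linear.isCont[OF bounded_linear_smult_left])
  then have "((\<lambda>c. z + c *s v) \<longlongrightarrow> z + 0 *s v) (nhds 0)"
    unfolding continuous_within by (rule tendsto_at_iff_tendsto_nhds[THEN iffD1])
  then have "((\<lambda>c. z + c *s v) \<longlongrightarrow> z) (nhds 0)" by simp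
  then have "\<forall>\<^sub>F c in nhds 0. z + c *s v \<in> S"
    using assms by (intro topological_tendstoD)
  then have "\<forall>\<^sub>F c in nhds 0. f (z + c *s v) = g (z + c *s v)"
    by eventually_elim (rule assms)
  then show ?thesis unfolding directional_deriv_def by (intro deriv_cong_ev) auto
qed

lemma complex_partial_funpow_cong:
  fixes f :: "complex ^ 'n \<Rightarrow> complex"
  assumes "open S" "\<And>z. z \<in> S \<Longrightarrow> f z = g z" "z \<in> S"
  shows "(complex_partial i ^^ k) f z = (complex_partial i ^^ k) g z"
  using assms(3)
proof (induction k arbitrary: z)
  case (Suc k)
  show ?case
    using directional_deriv_cong[OF assms(1) Suc.IH Suc.prems] by (simp add: complex_partial_eq)
qed (use assms in auto)

lemma holomorphic_several_funpow:
  assumes "holomorphic_several f S" "open S"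
  shows "holomorphic_several ((complex_partial i ^^ k) f) S"
  using assms by (induction k) (simp_all add: complex_partial_eq holomorphic_several_directional_deriv)

lemma holomorphic_several_foldr:
  assumes "holomorphic_several f S" "open S"
  shows "holomorphic_several (foldr (\<lambda>i. complex_partial i ^^ m i) xs f) S"
  using assms by (induction xs) (simp_all add: holomorphic_several_funpow)

lemma holomorphic_several_partial_multi:
  assumes "holomorphic_several f S" "open S"
  shows "holomorphic_several (partial_multi m f) S"
  unfolding partial_multi_def using assms by (rule holomorphic_several_foldr)

lemma complex_partial_funpow_swap:
  assumes f: "holomorphic_several f S" and S: "open S" and z: "z \<in> S"
  shows "complex_partial j ((complex_partial i ^^ k) f) z = (complex_partial i ^^ k) (complex_partial j f) z"
  using z
proof (induction k arbitrary: z)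
  case (Suc k)
  define g where "g = (complex_partial i ^^ k) f"
  have g: "holomorphic_several g S" unfolding g_def using f S by (rule holomorphic_several_funpow)
  have "complex_partial j ((complex_partial i ^^ Suc k) f) z = complex_partial i (complex_partial j g) z"
    using directional_deriv_swap(2)[OF g S Suc.prems] by (simp add: g_def complex_partial_eq)
  also have "\<dots> = complex_partial i ((complex_partial i ^^ k) (complex_partial j f)) z"
    unfolding complex_partial_eq[of i]
    by (rule directional_deriv_cong[OF S _ Suc.prems]) (simp add: g_def Suc.IH flip: complex_partial_eq)
  finally show ?case by simp
qed simp

text \<open>The additional derivative is moved by commutation to the place of \<open>j\<close> in
  the coordinate order, where it raises the exponent; distinctness guarantees that the later entries
  still see the old multi-index.\<close>

lemma complex_partial_foldr:
  assumes f: "holomorphic_several f S" and S: "open S" and z: "z \<in> S"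
    and "distinct xs" "j \<in> set xs"
  shows "complex_partial j (foldr (\<lambda>i. complex_partial i ^^ m i) xs f) z
    = foldr (\<lambda>i. complex_partial i ^^ (m(j := Suc (m j))) i) xs f z"
  using assms(4,5) z
proof (induction xs arbitrary: z)
  case (Cons i ys)
  show ?case
  proof (cases "i = j")
    case True
    then have "foldr (\<lambda>i. complex_partial i ^^ (m(j := Suc (m j))) i) ys f
       = foldr (\<lambda>i. complex_partial i ^^ m i) ys f"
      using Cons.prems by (intro foldr_cong) auto
    then show ?thesis using True by simp
  next
    case False
    have "complex_partial j (foldr (\<lambda>i. complex_partial i ^^ m i) (i # ys) f) z
      = (complex_partial i ^^ m i) (complex_partial j (foldr (\<lambda>i. complex_partial i ^^ m i) ys f)) z"
      using complex_partial_funpow_swap[OF holomorphic_several_foldr[OF f S] S Cons.prems(3)] by simp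
    also have "\<dots> = (complex_partial i ^^ m i) (foldr (\<lambda>i. complex_partial i ^^ (m(j := Suc (m j))) i) ys f) z"
      using Cons False by (intro complex_partial_funpow_cong[OF S]) auto
    finally show ?thesis using False by simp
  qed
qed simp

lemma complex_partial_partial_multi:
  assumes "holomorphic_several f S" "open S" "z \<in> S"
  shows "complex_partial j (partial_multi m f) z = partial_multi (m(j := Suc (m j))) f z"
  unfolding partial_multi_def using assms coordinates by (intro complex_partial_foldr) auto

lemma directional_deriv_eq_sum:
  fixes \<zeta> :: "complex ^ 'n"
  assumes "holomorphic_several g S" "z \<in> S"
  shows "directional_deriv \<zeta> g z = (\<Sum>i\<in>UNIV. \<zeta> $ i * complex_partial i g z)"
proof -
  note d = holomorphic_several_has_derivative[OF assms]
  have lin: "linear (\<lambda>v. directional_deriv v g z)" using d(1) by (rule has_derivative_linear)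
  have "\<zeta> = (\<Sum>i\<in>UNIV. \<zeta> $ i *s axis i 1)"
    by (simp add: vec_eq_iff axis_def if_distrib cong: if_cong)
  then have "directional_deriv \<zeta> g z = directional_deriv (\<Sum>i\<in>UNIV. \<zeta> $ i *s axis i 1) g z"
    by simp
  also have "\<dots> = (\<Sum>i\<in>UNIV. directional_deriv (\<zeta> $ i *s axis i 1) g z)"
    by (rule linear_sum[OF lin])
  finally show ?thesis by (simp add: d(2) complex_partial_eq)
qed

text \<open>The coefficients of the \<open>k\<close>-fold directional derivative along \<open>\<zeta>\<close> with respect to the
  partial derivatives of order \<open>k\<close>.\<close>

fun ray_coeff :: "complex ^ 'n \<Rightarrow> nat \<Rightarrow> ('n \<Rightarrow> nat) \<Rightarrow> complex" where
  "ray_coeff \<zeta> 0 m = 1"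
| "ray_coeff \<zeta> (Suc k) m = (\<Sum>i\<in>UNIV. if m i > 0 then \<zeta> $ i * ray_coeff \<zeta> k (m(i := m i - 1)) else 0)"

lemma norm_ray_coeff_le:
  fixes \<zeta> :: "complex ^ 'n"
  assumes "norm \<zeta> = 1"
  shows "norm (ray_coeff \<zeta> k m) \<le> real CARD('n) ^ k"
proof (induction k arbitrary: m)
  case (Suc k)
  have *: "norm (\<zeta> $ i) \<le> 1" for i
    using Finite_Cartesian_Product.norm_nth_le[of \<zeta> i] assms by simp
  have "norm (ray_coeff \<zeta> (Suc k) m) \<le> (\<Sum>i\<in>(UNIV :: 'n set). 1 * real CARD('n) ^ k)"
    unfolding ray_coeff.simps
  proof (rule sum_norm_le)
    fix i
    have "norm (\<zeta> $ i) * norm (ray_coeff \<zeta> k (m(i := m i - 1))) \<le> 1 * real CARD('n) ^ k"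
      by (rule mult_mono[OF * Suc.IH]) auto
    then show "norm (if m i > 0 then \<zeta> $ i * ray_coeff \<zeta> k (m(i := m i - 1)) else 0) \<le> 1 * real CARD('n) ^ k"
      by (auto simp: norm_mult)
  qed
  then show ?case by simp
qed simp

text \<open>The k-th derivative along the ray, defined through the partial derivatives that occur in
  the Besov norm; \<open>ray_deriv_0\<close> and \<open>ray_deriv_Suc\<close> identify it with the
  iterated directional derivative.\<close>

definition ray_deriv :: "complex ^ 'n \<Rightarrow> nat \<Rightarrow> (complex ^ 'n \<Rightarrow> complex) \<Rightarrow> complex ^ 'n \<Rightarrow> complex" where
  "ray_deriv \<zeta> k f z = (\<Sum>m | sum m UNIV = k. ray_coeff \<zeta> k m * partial_multi m f z)"

lemma finite_multi_indices_eq: "finite {m :: 'n::finite \<Rightarrow> nat. sum m UNIV = k}"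
  by (rule finite_subset[OF _ finite_multi_indices[of k]]) auto

lemma ray_deriv_0:
  fixes f :: "complex ^ 'n \<Rightarrow> complex"
  shows "ray_deriv \<zeta> 0 f = f"
proof
  fix z
  have "{m :: 'n \<Rightarrow> nat. sum m UNIV = 0} = {\<lambda>_. 0}"
    by (auto simp: fun_eq_iff)
  moreover have "foldr (\<lambda>i. complex_partial i ^^ 0) xs f = f" for xs by (induction xs) auto
  ultimately show "ray_deriv \<zeta> 0 f z = f z" by (simp add: ray_deriv_def partial_multi_def)
qed

lemma sum_fun_upd:
  fixes m :: "'n::finite \<Rightarrow> nat"
  shows "sum (m(i := k)) UNIV + m i = sum m UNIV + k"
proof -
  have "sum (m(i := k)) UNIV = k + sum (m(i := k)) (UNIV - {i})"
    by (subst sum.remove[of _ i]) auto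
  moreover have "sum (m(i := k)) (UNIV - {i}) = sum m (UNIV - {i})"
    by (intro sum.cong) auto
  moreover have "sum m UNIV = m i + sum m (UNIV - {i})"
    by (subst sum.remove[of _ i]) auto
  ultimately show ?thesis by simp
qed

text \<open>One more derivative along \<zeta> turns the index m into m + e_i with factor \<zeta>_i.
  A multi-index of order k + 1 arises in this way once for every i with a positive entry, and
  collecting these contributions is exactly the recursion of \<open>ray_coeff\<close>.\<close>

lemma ray_deriv_Suc:
  fixes f :: "complex ^ 'n \<Rightarrow> complex"
  assumes f: "holomorphic_several f S" and S: "open S"
  shows "holomorphic_several (ray_deriv \<zeta> k f) S"
    and "z \<in> S \<Longrightarrow> directional_deriv \<zeta> (ray_deriv \<zeta> k f) z = ray_deriv \<zeta> (Suc k) f z"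
proof -
  define A where "A k = {m :: 'n \<Rightarrow> nat. sum m UNIV = k}" for k
  have finA: "finite (A k)" for k unfolding A_def by (rule finite_multi_indices_eq)
  have pm: "holomorphic_several (partial_multi m f) S" for m
    using f S by (rule holomorphic_several_partial_multi)
  have der: "(ray_deriv \<zeta> k f has_derivative
     (\<lambda>v. \<Sum>m\<in>A k. ray_coeff \<zeta> k m * directional_deriv v (partial_multi m f) z)) (at z)" if "z \<in> S" for z
    unfolding ray_deriv_def[abs_def] A_def
    by (intro has_derivative_sum has_derivative_mult_right holomorphic_several_has_derivative[OF pm that])
  have hom: "(\<Sum>m\<in>A k. ray_coeff \<zeta> k m * directional_deriv (c *s v) (partial_multi m f) z)
     = c * (\<Sum>m\<in>A k. ray_coeff \<zeta> k m * directional_deriv v (partial_multi m f) z)" if "z \<in> S" for z c v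
    by (simp add: holomorphic_several_has_derivative[OF pm that] sum_distrib_left mult_ac)
  show "holomorphic_several (ray_deriv \<zeta> k f) S"
    unfolding holomorphic_several_def using der hom by blast
  assume z: "z \<in> S"
  have "((\<lambda>c. ray_deriv \<zeta> k f (z + c *s \<zeta>)) has_field_derivative
     (\<Sum>m\<in>A k. ray_coeff \<zeta> k m * directional_deriv \<zeta> (partial_multi m f) z)) (at 0)"
    using der[OF z] hom[OF z] by (intro has_field_derivative_line) auto
  then have "directional_deriv \<zeta> (ray_deriv \<zeta> k f) z
     = (\<Sum>m\<in>A k. ray_coeff \<zeta> k m * directional_deriv \<zeta> (partial_multi m f) z)"
    unfolding directional_deriv_def[of \<zeta> "ray_deriv \<zeta> k f"] by (rule DERIV_imp_deriv)
  also have "\<dots> = (\<Sum>m\<in>A k. \<Sum>i\<in>UNIV. ray_coeff \<zeta> k m * \<zeta> $ i * partial_multi (m(i := Suc (m i))) f z)"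
    by (simp add: directional_deriv_eq_sum[OF pm z] complex_partial_partial_multi[OF f S z]
        sum_distrib_left mult_ac)
  also have "\<dots> = (\<Sum>i\<in>UNIV. \<Sum>m\<in>A k. ray_coeff \<zeta> k m * \<zeta> $ i * partial_multi (m(i := Suc (m i))) f z)"
    by (rule sum.swap)
  also have "\<dots> = (\<Sum>i\<in>UNIV. \<Sum>m\<in>{m \<in> A (Suc k). m i > 0}.
       ray_coeff \<zeta> k (m(i := m i - 1)) * \<zeta> $ i * partial_multi m f z)"
  proof (rule sum.cong[OF refl])
    fix i :: 'n
    show "(\<Sum>m\<in>A k. ray_coeff \<zeta> k m * \<zeta> $ i * partial_multi (m(i := Suc (m i))) f z) =
       (\<Sum>m\<in>{m \<in> A (Suc k). m i > 0}. ray_coeff \<zeta> k (m(i := m i - 1)) * \<zeta> $ i * partial_multi m f z)"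
    proof (rule sum.reindex_bij_witness[where j = "\<lambda>m. m(i := Suc (m i))" and i = "\<lambda>m. m(i := m i - 1)"])
      fix m assume "m \<in> A k"
      then show "m(i := Suc (m i)) \<in> {m \<in> A (Suc k). m i > 0}"
        using sum_fun_upd[of m i "Suc (m i)"] by (simp add: A_def)
    next
      fix m assume "m \<in> {m \<in> A (Suc k). m i > 0}"
      then show "m(i := m i - 1) \<in> A k"
        using sum_fun_upd[of m i "m i - 1"] by (simp add: A_def)
    qed (auto simp: fun_eq_iff)
  qed
  also have "\<dots> = (\<Sum>i\<in>UNIV. \<Sum>m\<in>A (Suc k). if m i > 0 then
       ray_coeff \<zeta> k (m(i := m i - 1)) * \<zeta> $ i * partial_multi m f z else 0)"
    by (subst sum.inter_filter[OF finA]) simp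
  also have "\<dots> = (\<Sum>m\<in>A (Suc k). \<Sum>i\<in>UNIV. if m i > 0 then
       ray_coeff \<zeta> k (m(i := m i - 1)) * \<zeta> $ i * partial_multi m f z else 0)"
    by (rule sum.swap)
  also have "\<dots> = ray_deriv \<zeta> (Suc k) f z"
    unfolding ray_deriv_def A_def ray_coeff.simps sum_distrib_right
    by (intro sum.cong refl) simp
  finally show "directional_deriv \<zeta> (ray_deriv \<zeta> k f) z = ray_deriv \<zeta> (Suc k) f z" .
qed

lemma norm_ray_deriv_le:
  fixes \<zeta> :: "complex ^ 'n"
  assumes "norm \<zeta> = 1"
  shows "norm (ray_deriv \<zeta> k f z) \<le> real CARD('n) ^ k * (\<Sum>m | sum m UNIV = k. norm (partial_multi m f z))"
  unfolding ray_deriv_def sum_distrib_left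
  by (intro sum_norm_le) (auto simp: norm_mult intro!: mult_right_mono norm_ray_coeff_le[OF assms])

lemma smult_of_real: "complex_of_real t *s x = t *\<^sub>R x"
  by (simp add: vec_eq_iff scaleR_conv_of_real[where 'a = complex])

lemma continuous_on_ray:
  fixes \<zeta> :: "complex ^ 'n"
  assumes g: "continuous_on (ball 0 1) g" and "norm \<zeta> = 1" "r < 1"
  shows "continuous_on {0..r} (\<lambda>t. g (t *\<^sub>R \<zeta>))"
  by (rule continuous_on_compose2[OF g]) (use assms in \<open>auto intro!: continuous_intros\<close>)

text \<open>Taylor's formula with integral remainder on the segment to
  \<open>r *\<^sub>R \<zeta>\<close>. The kernel (r - x)^(N-1) / (N-1)! is enlarged to (1 -
  x)^(N-1), which is (1 - x)^N against dx / (1 - x) and so matches the weight in the Besov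
  norm.\<close>

lemma radial_Taylor_bound:
  fixes f :: "complex ^ 'n \<Rightarrow> complex"
  assumes f: "holomorphic_several f (ball 0 1)" and \<zeta>: "norm \<zeta> = 1" and r: "0 \<le> r" "r < 1" and N: "0 < N"
  shows "norm (f (r *\<^sub>R \<zeta>)) \<le> real CARD('n) ^ N * ((\<Sum>m | sum m UNIV \<le> N - 1. norm (partial_multi m f 0))
     + (\<Sum>m | sum m UNIV = N. integral {0..r} (\<lambda>t. (1 - t) ^ (N - 1) * norm (partial_multi m f (t *\<^sub>R \<zeta>)))))"
proof -
  define n where "n = real CARD('n)"
  have "CARD('n) > 0" by simp
  then have n1: "n \<ge> 1" unfolding n_def by linarith
  have S: "open (ball 0 1 :: (complex ^ 'n) set)" by simp
  define Df where "Df k t = ray_deriv \<zeta> k f (t *\<^sub>R \<zeta>)" for k and t :: real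
  have mem: "t *\<^sub>R \<zeta> \<in> ball 0 1" if "t \<in> {0..r}" for t using that r \<zeta> by simp
  have Dfd: "(Df k has_vector_derivative Df (Suc k) t) (at t within {0..r})" if "t \<in> {0..r}" for k t
  proof -
    have "((\<lambda>c. ray_deriv \<zeta> k f (0 + c *s \<zeta>)) has_field_derivative
        directional_deriv \<zeta> (ray_deriv \<zeta> k f) (0 + of_real t *s \<zeta>)) (at (of_real t))"
      using mem[OF that] by (intro holomorphic_several_line_deriv[OF ray_deriv_Suc(1)[OF f S]]) (simp add: smult_of_real)
    then have "((\<lambda>x. ray_deriv \<zeta> k f (0 + of_real x *s \<zeta>)) has_vector_derivative
        directional_deriv \<zeta> (ray_deriv \<zeta> k f) (0 + of_real t *s \<zeta>)) (at t within {0..r})"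
      by (rule has_vector_derivative_real_field)
    then show ?thesis using ray_deriv_Suc(2)[OF f S mem[OF that]]
      by (simp add: Df_def[abs_def] smult_of_real)
  qed
  define I where "I m = (\<lambda>t. (1 - t) ^ (N - 1) * norm (partial_multi m f (t *\<^sub>R \<zeta>)))" for m
  have Iint: "I m integrable_on {0..r}" for m
  proof -
    have "continuous_on {0..r} (\<lambda>t. partial_multi m f (t *\<^sub>R \<zeta>))"
      using holomorphic_several_continuous_on[OF holomorphic_several_partial_multi[OF f S]] \<zeta> r
      by (intro continuous_on_ray)
    then show ?thesis unfolding I_def
      by (intro integrable_continuous_interval continuous_intros)
  qed
  have fin: "finite {m :: 'n \<Rightarrow> nat. sum m UNIV = k}" for k by (rule finite_multi_indices_eq)
  define i where "i = (\<lambda>x. ((r - x) ^ (N - 1) / fact (N - 1)) *\<^sub>R Df N x)"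
  have Taylor: "(i has_integral Df 0 r - (\<Sum>k<N. ((r - 0) ^ k / fact k) *\<^sub>R Df k 0)) {0..r}"
    unfolding i_def using N r Dfd by (intro Taylor_has_integral) auto
  have J: "norm (integral {0..r} i) \<le> integral {0..r} (\<lambda>t. n ^ N * (\<Sum>m | sum m UNIV = N. I m t))"
  proof (rule integral_norm_bound_integral)
    show "i integrable_on {0..r}" using Taylor by blast
    show "(\<lambda>t. n ^ N * (\<Sum>m | sum m UNIV = N. I m t)) integrable_on {0..r}"
      using fin Iint by (intro integrable_on_mult_right integrable_sum) auto
    fix x assume x: "x \<in> {0..r}"
    have "(r - x) ^ (N - 1) / fact (N - 1) \<le> (r - x) ^ (N - 1) / 1"
      using x by (intro divide_left_mono) (auto simp: fact_ge_1)
    also have "\<dots> \<le> (1 - x) ^ (N - 1)" using x r by (simp add: power_mono)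
    finally have "norm (i x) \<le> (1 - x) ^ (N - 1) * norm (Df N x)"
      using x mult_right_mono[of "(r - x) ^ (N - 1) / fact (N - 1)" _ "norm (Df N x)"]
      unfolding i_def by simp
    also have Df: "norm (Df N x) \<le> n ^ N * (\<Sum>m | sum m UNIV = N. norm (partial_multi m f (x *\<^sub>R \<zeta>)))"
      unfolding Df_def n_def by (rule norm_ray_deriv_le[OF \<zeta>])
    finally have "norm (i x) \<le> (1 - x) ^ (N - 1) * (n ^ N * (\<Sum>m | sum m UNIV = N. norm (partial_multi m f (x *\<^sub>R \<zeta>))))"
      using x r by (simp add: mult_left_mono)
    also have "\<dots> = n ^ N * (\<Sum>m | sum m UNIV = N. I m x)"
      unfolding I_def sum_distrib_left by (simp add: mult.left_commute)
    finally show "norm (i x) \<le> n ^ N * (\<Sum>m | sum m UNIV = N. I m x)" .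
  qed
  also have "\<dots> = n ^ N * (\<Sum>m | sum m UNIV = N. integral {0..r} (I m))"
    using fin Iint by (simp add: integral_sum)
  finally have J': "norm (integral {0..r} i) \<le> n ^ N * (\<Sum>m | sum m UNIV = N. integral {0..r} (I m))" .
  have K: "norm (\<Sum>k<N. ((r - 0) ^ k / fact k) *\<^sub>R Df k 0) \<le>
      n ^ N * (\<Sum>m | sum m UNIV \<le> N - 1. norm (partial_multi m f 0))"
  proof -
    have "norm (\<Sum>k<N. ((r - 0) ^ k / fact k) *\<^sub>R Df k 0) \<le>
      (\<Sum>k<N. n ^ N * (\<Sum>m | sum m UNIV = k. norm (partial_multi m f 0)))"
    proof (rule sum_norm_le)
      fix k assume k: "k \<in> {..<N}"
      have "(r - 0) ^ k / fact k \<le> (r - 0) ^ k / 1"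
        using r by (intro divide_left_mono) (auto simp: fact_ge_1)
      also have "\<dots> \<le> 1" using r by (simp add: power_le_one)
      finally have "norm (((r - 0) ^ k / fact k) *\<^sub>R Df k 0) \<le> 1 * norm (Df k 0)"
        using r mult_right_mono[of "(r - 0) ^ k / fact k" 1 "norm (Df k 0)"] by simp
      also have "\<dots> \<le> n ^ k * (\<Sum>m | sum m UNIV = k. norm (partial_multi m f 0))"
        using norm_ray_deriv_le[OF \<zeta>, of k f 0] by (simp add: Df_def n_def)
      also have "\<dots> \<le> n ^ N * (\<Sum>m | sum m UNIV = k. norm (partial_multi m f 0))"
        using k n1 by (intro mult_right_mono power_increasing sum_nonneg) auto
      finally show "norm (((r - 0) ^ k / fact k) *\<^sub>R Df k 0) \<le> \<dots>" .
    qed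
    also have "\<dots> = n ^ N * (\<Sum>k<N. \<Sum>m | sum m UNIV = k. norm (partial_multi m f 0))"
      by (simp add: sum_distrib_left)
    also have "(\<Sum>k<N. \<Sum>m | sum m UNIV = k. norm (partial_multi m f 0)) =
      (\<Sum>m\<in>(\<Union>k<N. {m. sum m UNIV = k}). norm (partial_multi m f 0))"
      using fin by (subst sum.UNION_disjoint) auto
    also have "(\<Union>k<N. {m :: 'n \<Rightarrow> nat. sum m UNIV = k}) = {m. sum m UNIV \<le> N - 1}"
      using N by auto
    finally show ?thesis .
  qed
  have "f (r *\<^sub>R \<zeta>) = (\<Sum>k<N. ((r - 0) ^ k / fact k) *\<^sub>R Df k 0) + integral {0..r} i"
    using Taylor by (simp add: integral_unique Df_def ray_deriv_0)
  then have "norm (f (r *\<^sub>R \<zeta>)) \<le> norm (\<Sum>k<N. ((r - 0) ^ k / fact k) *\<^sub>R Df k 0) + norm (integral {0..r} i)"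
    by (simp add: norm_triangle_ineq)
  with J' K show ?thesis unfolding n_def I_def by (simp only: distrib_left)
qed

section \<open>Growth of Besov functions\<close>

lemma one_minus_norm_square:
  fixes w :: "'a::real_normed_vector"
  assumes "norm w < 1"
  shows "0 < 1 - (norm w)\<^sup>2" "1 - (norm w)\<^sup>2 \<le> 1" "1 - norm w \<le> 1 - (norm w)\<^sup>2"
    "1 - (norm w)\<^sup>2 \<le> 2 * (1 - norm w)"
proof -
  have "(norm w)\<^sup>2 \<le> norm w * 1"
    unfolding power2_eq_square using assms by (intro mult_left_mono) auto
  then show "0 < 1 - (norm w)\<^sup>2" "1 - (norm w)\<^sup>2 \<le> 1" "1 - norm w \<le> 1 - (norm w)\<^sup>2" using assms by auto
  have "0 \<le> (1 - norm w)\<^sup>2" by simp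
  then show "1 - (norm w)\<^sup>2 \<le> 2 * (1 - norm w)" by (simp add: power2_eq_square algebra_simps)
qed

lemma nn_integral_tau_ball:
  fixes h :: "complex ^ 'n \<Rightarrow> ennreal"
  assumes h: "(\<lambda>w. h w * indicator (ball 0 1) w) \<in> borel_measurable borel"
  shows "(\<integral>\<^sup>+w. h w \<partial>tau_ball) =
    (\<integral>\<^sup>+w\<in>ball 0 1. h w * ennreal (1 / (1 - (norm w)\<^sup>2) ^ (CARD('n) + 1)) \<partial>lborel) /
      emeasure lborel (ball (0 :: complex ^ 'n) 1)"
proof -
  define B where "B = ball (0 :: complex ^ 'n) 1"
  have B: "B \<inter> space lborel \<in> sets lborel" by (simp add: B_def)
  have mh: "h \<in> borel_measurable (restrict_space lborel B)"
    using h B by (subst borel_measurable_restrict_space_iff_ennreal) (auto simp: B_def)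
  have md: "(\<lambda>w. ennreal (1 / (1 - (norm w)\<^sup>2) ^ (CARD('n) + 1))) \<in> borel_measurable (restrict_space lborel B)"
    by (intro measurable_restrict_space1) measurable
  have BB: "B \<in> sets (restrict_space lborel B)" using B by (simp add: sets_restrict_space_iff)
  have v: "volume_ball = uniform_measure (restrict_space lborel B) B" by (simp add: volume_ball_def B_def)
  have "(\<integral>\<^sup>+w. h w \<partial>tau_ball) = (\<integral>\<^sup>+w. ennreal (1 / (1 - (norm w)\<^sup>2) ^ (CARD('n) + 1)) * h w \<partial>volume_ball)"
    unfolding tau_ball_def by (rule nn_integral_density) (use mh md in \<open>simp_all add: v\<close>)
  also have "\<dots> = (\<integral>\<^sup>+w. ennreal (1 / (1 - (norm w)\<^sup>2) ^ (CARD('n) + 1)) * h w * indicator B w \<partial>restrict_space lborel B)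
      / emeasure (restrict_space lborel B) B"
    unfolding v by (rule nn_integral_uniform_measure[OF _ BB]) (intro borel_measurable_times_ennreal mh md)
  also have "emeasure (restrict_space lborel B) B = emeasure lborel B"
    using B by (subst emeasure_restrict_space) auto
  also have "(\<integral>\<^sup>+w. ennreal (1 / (1 - (norm w)\<^sup>2) ^ (CARD('n) + 1)) * h w * indicator B w \<partial>restrict_space lborel B)
     = (\<integral>\<^sup>+w\<in>B. h w * ennreal (1 / (1 - (norm w)\<^sup>2) ^ (CARD('n) + 1)) \<partial>lborel)"
    using B by (subst nn_integral_restrict_space) (auto intro!: nn_integral_cong simp: mult_ac indicator_def)
  finally show ?thesis by (simp add: B_def)
qed

text \<open>The radial mean value inequality is integrated over t and the integrals are
  interchanged. A point w with x = 1 - |w|^2 is seen only by those t with 1 - t <= 2x, an interval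
  of length 2x, while comparing dt / (1 - t) with x contributes a factor 1/x; the inner integral is
  therefore bounded by a constant.\<close>

lemma radial_integral_le:
  assumes p: "1 \<le> p"
  shows "\<exists>C>0. \<forall>(g :: complex ^ 'n \<Rightarrow> complex) \<zeta> r.
     holomorphic_several g (ball 0 1) \<longrightarrow> norm \<zeta> = 1 \<longrightarrow> 0 \<le> r \<longrightarrow> r < 1 \<longrightarrow>
     ennreal (integral {0..r} (\<lambda>t. ((1 - t) ^ N * norm (g (t *\<^sub>R \<zeta>))) powr p * (1 / (1 - t)))) \<le> ennreal C *
       (\<integral>\<^sup>+w\<in>ball 0 1. ennreal (((1 - (norm w)\<^sup>2) ^ N * norm (g w)) powr p) *
          ennreal (1 / (1 - (norm w)\<^sup>2) ^ (CARD('n) + 1)) \<partial>lborel)"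
proof -
  define n where "n = CARD('n)"
  obtain C where C: "C > 0" and mv: "\<And>(g :: complex ^ 'n \<Rightarrow> complex) \<zeta> t.
     holomorphic_several g (ball 0 1) \<Longrightarrow> norm \<zeta> = 1 \<Longrightarrow> 0 \<le> t \<Longrightarrow> t < 1 \<Longrightarrow>
     ennreal ((1 - t) ^ (n + 1) * norm (g (t *\<^sub>R \<zeta>)) powr p) \<le> ennreal C *
       (\<integral>\<^sup>+w\<in>{w\<in>ball 0 1. (1 - t) / 2 \<le> 1 - (norm w)\<^sup>2 \<and> 1 - (norm w)\<^sup>2 \<le> 4 * (1 - t)}.
          ennreal (norm (g w) powr p) \<partial>lborel)"
    using radial_mean_value[where ?'n = 'n] p unfolding n_def by blast
  \<comment> \<open>On \<open>T t\<close> the quantities d = 1 - t and x satisfy d <= 2x and x <=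
    4d. The first converts the numerator, the second the n + 2 powers in the denominator: n + 1 from
    the mean value inequality and one from dt / (1 - t).\<close>
  define K where "K = (2 ^ N) powr p * 4 ^ (n + 2)"
  have K: "K > 0" by (simp add: K_def)
  have main: "ennreal (integral {0..r} (\<lambda>t. ((1 - t) ^ N * norm (g (t *\<^sub>R \<zeta>))) powr p * (1 / (1 - t)))) \<le> ennreal (C * K * 2) *
       (\<integral>\<^sup>+w\<in>ball 0 1. ennreal (((1 - (norm w)\<^sup>2) ^ N * norm (g w)) powr p) *
          ennreal (1 / (1 - (norm w)\<^sup>2) ^ (n + 1)) \<partial>lborel)"
    if g: "holomorphic_several g (ball 0 1)" and \<zeta>: "norm \<zeta> = 1" and r: "0 \<le> r" "r < 1"
    for g :: "complex ^ 'n \<Rightarrow> complex" and \<zeta> r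
  proof -
    define x where "x w = 1 - (norm w)\<^sup>2" for w :: "complex ^ 'n"
    define T where "T t = {w :: complex ^ 'n. norm w < 1 \<and> (1 - t) / 2 \<le> x w \<and> x w \<le> 4 * (1 - t)}" for t
    define H where "H w = ennreal ((x w ^ N * norm (g w)) powr p) * ennreal (1 / x w ^ (n + 1)) * indicator (ball 0 1) w" for w
    have contg: "continuous_on (ball 0 1) g" by (rule holomorphic_several_continuous_on[OF g])
    note mg = borel_measurable_powr_norm_indicator[OF contg, of p]
    have mx[measurable]: "x \<in> borel_measurable borel" unfolding x_def[abs_def] by measurable
    have [measurable]: "T t \<in> sets borel" for t unfolding T_def by measurable
    have Heq: "H w = ennreal ((x w ^ N) powr p) * ennreal (1 / x w ^ (n + 1)) *
       (ennreal (norm (g w) powr p) * indicator (ball 0 1) w)" for w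
      using one_minus_norm_square(1)[of w]
      by (auto simp: H_def powr_mult ennreal_mult' mult_ac indicator_def x_def)
    have mH[measurable]: "H \<in> borel_measurable borel"
      unfolding Heq[abs_def] by (intro borel_measurable_times_ennreal mg) measurable
    define F where "F t w = H w * ennreal (1 / x w) * (if w \<in> T t \<and> 0 \<le> t \<and> t \<le> r then 1 else 0)" for t w
    have mF: "(\<lambda>(t, w). F t w) \<in> borel_measurable (lborel \<Otimes>\<^sub>M lborel)"
      unfolding F_def T_def by measurable
    have pt: "ennreal (((1 - t) ^ N * norm (g (t *\<^sub>R \<zeta>))) powr p * (1 / (1 - t))) \<le>
       ennreal (C * K) * (\<integral>\<^sup>+w. F t w \<partial>lborel)" if t: "0 \<le> t" "t \<le> r" for t
    proof -
      define d where "d = 1 - t"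
      have d: "d > 0" using t r by (simp add: d_def)
      define A where "A = (d ^ N) powr p / d ^ (n + 2)"
      have A: "A \<ge> 0" using d by (simp add: A_def)
      have "ennreal (((1 - t) ^ N * norm (g (t *\<^sub>R \<zeta>))) powr p * (1 / (1 - t)))
        = ennreal A * ennreal ((1 - t) ^ (n + 1) * norm (g (t *\<^sub>R \<zeta>)) powr p)"
        using d A unfolding d_def[symmetric]
        by (simp add: ennreal_mult'[symmetric] A_def powr_mult)
      also have "\<dots> \<le> ennreal A * (ennreal C *
        (\<integral>\<^sup>+w\<in>{w\<in>ball 0 1. (1 - t) / 2 \<le> 1 - (norm w)\<^sup>2 \<and> 1 - (norm w)\<^sup>2 \<le> 4 * (1 - t)}.
          ennreal (norm (g w) powr p) \<partial>lborel))"
        using t r by (intro mult_left_mono mv[OF g \<zeta>]) auto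
      also have "\<dots> = ennreal C * (ennreal A * (\<integral>\<^sup>+w\<in>T t. ennreal (norm (g w) powr p) * indicator (ball 0 1) w \<partial>lborel))"
        unfolding T_def x_def mult.left_commute[of "ennreal A"]
        by (intro arg_cong[where f = "\<lambda>x. _ * (_ * x)"] nn_integral_cong) (auto simp: indicator_def)
      also have "ennreal A * (\<integral>\<^sup>+w\<in>T t. ennreal (norm (g w) powr p) * indicator (ball 0 1) w \<partial>lborel)
         = (\<integral>\<^sup>+w. ennreal A * ((ennreal (norm (g w) powr p) * indicator (ball 0 1) w) * indicator (T t) w) \<partial>lborel)"
        using borel_measurable_times_ennreal[OF mg borel_measurable_indicator[of "T t" borel]]
        by (intro nn_integral_cmult[symmetric]) simp
      also have "\<dots> \<le> (\<integral>\<^sup>+w. ennreal K * F t w \<partial>lborel)"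
      proof (rule nn_integral_mono)
        fix w
        show "ennreal A * ((ennreal (norm (g w) powr p) * indicator (ball 0 1) w) * indicator (T t) w) \<le> ennreal K * F t w"
        proof (cases "w \<in> T t")
          case True
          then have w: "norm w < 1" "d / 2 \<le> x w" "x w \<le> 4 * d" by (auto simp: T_def d_def)
          have x: "x w > 0" using w d by simp
          have "(d ^ N) powr p \<le> ((2 * x w) ^ N) powr p"
            using d w p by (intro powr_mono2 power_mono) auto
          also have "\<dots> = (2 ^ N) powr p * (x w ^ N) powr p" using x by (simp add: power_mult_distrib powr_mult)
          finally have 1: "(d ^ N) powr p \<le> (2 ^ N) powr p * (x w ^ N) powr p" .
          have "(x w / 4) ^ (n + 2) \<le> d ^ (n + 2)" using w x by (intro power_mono) auto
          then have "1 / d ^ (n + 2) \<le> 1 / (x w / 4) ^ (n + 2)" using x d by (intro divide_left_mono) auto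
          also have "\<dots> = 4 ^ (n + 2) * (1 / x w ^ (n + 2))" by (simp add: power_divide)
          finally have 2: "1 / d ^ (n + 2) \<le> 4 ^ (n + 2) * (1 / x w ^ (n + 2))" .
          have "A \<le> ((2 ^ N) powr p * (x w ^ N) powr p) * (4 ^ (n + 2) * (1 / x w ^ (n + 2)))"
            using mult_mono[OF 1 2] d by (simp add: A_def)
          also have "\<dots> = K * ((x w ^ N) powr p * (1 / x w ^ (n + 1)) * (1 / x w))"
            by (simp add: K_def mult_ac)
          finally have "ennreal A \<le> ennreal (K * ((x w ^ N) powr p * (1 / x w ^ (n + 1)) * (1 / x w)))"
            by (rule ennreal_leI)
          also have "\<dots> = ennreal K * (ennreal ((x w ^ N) powr p) * ennreal (1 / x w ^ (n + 1)) * ennreal (1 / x w))"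
            using x K by (simp add: ennreal_mult'[symmetric] mult_ac)
          finally have "ennreal A * (ennreal (norm (g w) powr p) * indicator (ball 0 1) w) \<le>
            ennreal K * (ennreal ((x w ^ N) powr p) * ennreal (1 / x w ^ (n + 1)) * ennreal (1 / x w)) * (ennreal (norm (g w) powr p) * indicator (ball 0 1) w)"
            by (rule mult_right_mono) simp
          then show ?thesis using True t by (simp add: F_def Heq mult_ac)
        qed simp
      qed
      also have "\<dots> = ennreal K * (\<integral>\<^sup>+w. F t w \<partial>lborel)"
        unfolding F_def by (intro nn_integral_cmult) measurable
      finally have "ennreal (((1 - t) ^ N * norm (g (t *\<^sub>R \<zeta>))) powr p * (1 / (1 - t))) \<le> ennreal C * (ennreal K * (\<integral>\<^sup>+w. F t w \<partial>lborel))"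
        by (simp add: mult_left_mono)
      then show ?thesis using C K by (simp add: ennreal_mult mult.assoc)
    qed
    have "continuous_on {0..r} (\<lambda>t. g (t *\<^sub>R \<zeta>))" by (rule continuous_on_ray[OF contg \<zeta> r(2)])
    then have "continuous_on {0..r} (\<lambda>t. ((1 - t) ^ N * norm (g (t *\<^sub>R \<zeta>))) powr p * (1 / (1 - t)))"
      using r p by (intro continuous_on_mult continuous_on_powr' continuous_intros) auto
    then have "((\<lambda>t. ((1 - t) ^ N * norm (g (t *\<^sub>R \<zeta>))) powr p * (1 / (1 - t))) has_integral
       integral {0..r} (\<lambda>t. ((1 - t) ^ N * norm (g (t *\<^sub>R \<zeta>))) powr p * (1 / (1 - t)))) {0..r}"
      by (intro integrable_integral integrable_continuous_interval)
    then have "ennreal (integral {0..r} (\<lambda>t. ((1 - t) ^ N * norm (g (t *\<^sub>R \<zeta>))) powr p * (1 / (1 - t)))) =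
      (\<integral>\<^sup>+t. ennreal (((1 - t) ^ N * norm (g (t *\<^sub>R \<zeta>))) powr p * (1 / (1 - t))) * indicator {0..r} t \<partial>lborel)"
      using r by (intro nn_integral_has_integral_lebesgue'[symmetric]) auto
    also have "\<dots> \<le> (\<integral>\<^sup>+t. ennreal (C * K) * (\<integral>\<^sup>+w. F t w \<partial>lborel) \<partial>lborel)"
      using pt by (intro nn_integral_mono) (auto simp: indicator_def)
    also have "\<dots> = ennreal (C * K) * (\<integral>\<^sup>+t. \<integral>\<^sup>+w. F t w \<partial>lborel \<partial>lborel)"
      using mF by (intro nn_integral_cmult) (auto intro: lborel.borel_measurable_nn_integral)
    also have "(\<integral>\<^sup>+t. \<integral>\<^sup>+w. F t w \<partial>lborel \<partial>lborel) = (\<integral>\<^sup>+w. \<integral>\<^sup>+t. F t w \<partial>lborel \<partial>lborel)"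
      using lborel_pair.Fubini'[OF mF] by simp
    also have "\<dots> \<le> (\<integral>\<^sup>+w. 2 * H w \<partial>lborel)"
    proof (rule nn_integral_mono)
      fix w :: "complex ^ 'n"
      show "(\<integral>\<^sup>+t. F t w \<partial>lborel) \<le> 2 * H w"
      proof (cases "norm w < 1")
        case True
        then have x: "x w > 0" using one_minus_norm_square(1)[of w] by (simp add: x_def)
        have "(\<integral>\<^sup>+t. F t w \<partial>lborel) \<le> (\<integral>\<^sup>+t. H w * ennreal (1 / x w) * indicator {1 - 2 * x w..1} t \<partial>lborel)"
          using x by (intro nn_integral_mono) (auto simp: F_def T_def indicator_def)
        also have "\<dots> = H w * (ennreal (1 / x w) * ennreal (2 * x w))"
          using x by (subst nn_integral_cmult_indicator) (simp_all add: mult.assoc)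
        also have "ennreal (1 / x w) * ennreal (2 * x w) = 2"
          using x by (simp add: ennreal_mult'[symmetric])
        finally show ?thesis by (simp add: mult.commute)
      qed (simp add: F_def T_def)
    qed
    also have "\<dots> = 2 * (\<integral>\<^sup>+w. H w \<partial>lborel)" by (intro nn_integral_cmult) measurable
    finally have "ennreal (integral {0..r} (\<lambda>t. ((1 - t) ^ N * norm (g (t *\<^sub>R \<zeta>))) powr p * (1 / (1 - t)))) \<le>
      ennreal (C * K) * (2 * (\<integral>\<^sup>+w. H w \<partial>lborel))"
      by (simp add: mult_left_mono)
    also have "\<dots> = ennreal (C * K * 2) * (\<integral>\<^sup>+w. H w \<partial>lborel)"
      using C K by (simp add: ennreal_mult mult.assoc)
    finally show ?thesis by (simp add: H_def x_def)
  qed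
  show ?thesis
    by (intro exI[of _ "C * K * 2"] conjI allI impI main[unfolded n_def]) (use C K in auto)
qed

text \<open>Jensen's inequality for the weight 1/(1 - t), whose mass on [0, r] is -ln (1 - r);
  taking p-th roots turns the power p - 1 of the mass into 1 - 1/p. For r = 0 the mass vanishes and
  the claim is trivial.\<close>

lemma radial_Holder:
  fixes G :: "real \<Rightarrow> real" and r Y :: real
  assumes p: "1 \<le> p" and N: "0 < N" and r: "0 \<le> r" "r < 1"
    and G: "continuous_on {0..r} G" "\<And>t. t \<in> {0..r} \<Longrightarrow> 0 \<le> G t"
    and Y: "integral {0..r} (\<lambda>t. ((1 - t) ^ N * G t) powr p * (1 / (1 - t))) \<le> Y"
  shows "integral {0..r} (\<lambda>t. (1 - t) ^ (N - 1) * G t) \<le> (- ln (1 - r)) powr (1 - 1/p) * Y powr (1/p)"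
proof (cases "r = 0")
  case False
  then have r0: "0 < r" using r by simp
  define X where "X = integral {0..r} (\<lambda>t. ((1 - t) ^ N * G t) * (1 / (1 - t)))"
  define Z where "Z = integral {0..r} (\<lambda>t. ((1 - t) ^ N * G t) powr p * (1 / (1 - t)))"
  have "((\<lambda>t. 1 / (1 - t)) has_integral (- ln (1 - r) - (- ln (1 - 0)))) {0..r}"
  proof (rule fundamental_theorem_of_calculus[OF r(1)])
    fix t assume "t \<in> {0..r}"
    then have "((\<lambda>t. - ln (1 - t)) has_real_derivative 1 / (1 - t)) (at t within {0..r})"
      using r by (auto intro!: derivative_eq_intros)
    then show "((\<lambda>t. - ln (1 - t)) has_vector_derivative 1 / (1 - t)) (at t within {0..r})"
      by (rule has_real_derivative_iff_has_vector_derivative[THEN iffD1])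
  qed
  then have L: "integral {0..r} (\<lambda>t. 1 / (1 - t)) = - ln (1 - r)" by (simp add: integral_unique)
  have L0: "0 < - ln (1 - r)" using r r0 by simp
  have cw: "continuous_on {0..r} (\<lambda>t. 1 / (1 - t))" using r by (intro continuous_intros) auto
  have u: "continuous_on {0..r} (\<lambda>t. (1 - t) ^ N * G t)" by (intro continuous_intros G)
  have X: "X powr p \<le> (- ln (1 - r)) powr (p - 1) * Z"
    unfolding X_def Z_def L[symmetric]
    by (rule Jensen_powr_weighted[OF u _ cw _ p]) (use G r L0 L in auto)
  have "0 \<le> X" unfolding X_def
  proof (rule integral_nonneg)
    show "(\<lambda>t. ((1 - t) ^ N * G t) * (1 / (1 - t))) integrable_on {0..r}"
      by (intro integrable_continuous_interval continuous_on_mult u cw)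
    show "0 \<le> ((1 - t) ^ N * G t) * (1 / (1 - t))" if "t \<in> {0..r}" for t
      using G(2)[OF that] that r by simp
  qed
  then have "X = (X powr p) powr (1/p)" unfolding powr_powr using p by simp
  also have "\<dots> \<le> ((- ln (1 - r)) powr (p - 1) * Y) powr (1/p)"
  proof (intro powr_mono2)
    have "(- ln (1 - r)) powr (p - 1) * Z \<le> (- ln (1 - r)) powr (p - 1) * Y"
      using Y by (intro mult_left_mono) (simp_all add: Z_def)
    with X show "X powr p \<le> (- ln (1 - r)) powr (p - 1) * Y" by linarith
  qed (use p in auto)
  also have "\<dots> = (- ln (1 - r)) powr (1 - 1/p) * Y powr (1/p)"
  proof -
    have "((- ln (1 - r)) powr (p - 1) * Y) powr (1/p) =
        ((- ln (1 - r)) powr (p - 1)) powr (1/p) * Y powr (1/p)"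
      by (rule powr_mult)
    also have "((- ln (1 - r)) powr (p - 1)) powr (1/p) = (- ln (1 - r)) powr (1 - 1/p)"
      unfolding powr_powr using p by (simp add: diff_divide_distrib)
    finally show ?thesis .
  qed
  also have "X = integral {0..r} (\<lambda>t. (1 - t) ^ (N - 1) * G t)"
    unfolding X_def
  proof (rule integral_cong)
    fix t assume "t \<in> {0..r}"
    then have "1 - t \<noteq> 0" using r by auto
    then show "((1 - t) ^ N * G t) * (1 / (1 - t)) = (1 - t) ^ (N - 1) * G t"
      using N by (cases N) (simp_all add: field_simps)
  qed
  finally show ?thesis .
qed simp

lemma log_weight_ge: "norm z < 1 \<Longrightarrow> ln 2 \<le> ln (2 / (1 - (norm z)\<^sup>2))"
  using one_minus_norm_square[of z] by (subst ln_le_cancel_iff) (auto simp: field_simps)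

lemma besov_norm_finite:
  fixes f :: "complex ^ 'n \<Rightarrow> complex"
  assumes "besov_norm p N f < \<infinity>"
  shows "sum m UNIV = N \<Longrightarrow> Lp_norm p tau_ball (weighted_partial N m f) < \<infinity>"
    and "enn2real (besov_norm p N f) = (\<Sum>m | sum m UNIV \<le> N - 1. norm (partial_multi m f 0)) +
       (\<Sum>m | sum m UNIV = N. enn2real (Lp_norm p tau_ball (weighted_partial N m f)))"
proof -
  have fin: "finite {m :: 'n \<Rightarrow> nat. sum m UNIV = N}" by (rule finite_multi_indices_eq)
  have sum_fin: "(\<Sum>m | sum m UNIV = N. Lp_norm p tau_ball (weighted_partial N m f)) < \<infinity>"
    using assms by (simp add: besov_norm_def)
  show *: "Lp_norm p tau_ball (weighted_partial N m f) < \<infinity>" if "sum m UNIV = N" for m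
    using member_le_sum[of m "{m. sum m UNIV = N}" "\<lambda>m. Lp_norm p tau_ball (weighted_partial N m f)"]
      fin that sum_fin by (auto intro: le_less_trans)
  have "(\<Sum>m | sum m UNIV = N. Lp_norm p tau_ball (weighted_partial N m f)) =
    (\<Sum>m | sum m UNIV = N. ennreal (enn2real (Lp_norm p tau_ball (weighted_partial N m f))))"
    by (intro sum.cong refl) (use * in \<open>auto simp: less_top\<close>)
  then have "besov_norm p N f = ennreal ((\<Sum>m | sum m UNIV \<le> N - 1. norm (partial_multi m f 0)) +
       (\<Sum>m | sum m UNIV = N. enn2real (Lp_norm p tau_ball (weighted_partial N m f))))"
    by (simp add: besov_norm_def sum_ennreal sum_nonneg)
  then show "enn2real (besov_norm p N f) = (\<Sum>m | sum m UNIV \<le> N - 1. norm (partial_multi m f 0)) +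
       (\<Sum>m | sum m UNIV = N. enn2real (Lp_norm p tau_ball (weighted_partial N m f)))"
    by (simp only:) (intro enn2real_ennreal add_nonneg_nonneg sum_nonneg, simp_all)
qed

lemma besov_pointwise:
  assumes p: "1 \<le> p" and N: "0 < N"
  shows "\<exists>C>0. \<forall>(f :: complex ^ 'n \<Rightarrow> complex) z. holomorphic_several f (ball 0 1) \<longrightarrow>
    besov_norm p N f < \<infinity> \<longrightarrow> norm z < 1 \<longrightarrow>
    norm (f z) \<le> C * enn2real (besov_norm p N f) * ln (2 / (1 - (norm z)\<^sup>2)) powr (1 - 1/p)"
proof -
  obtain C where C: "C > 0" and rad: "\<And>(g :: complex ^ 'n \<Rightarrow> complex) \<zeta> r.
     holomorphic_several g (ball 0 1) \<Longrightarrow> norm \<zeta> = 1 \<Longrightarrow> 0 \<le> r \<Longrightarrow> r < 1 \<Longrightarrow>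
     ennreal (integral {0..r} (\<lambda>t. ((1 - t) ^ N * norm (g (t *\<^sub>R \<zeta>))) powr p * (1 / (1 - t)))) \<le> ennreal C *
       (\<integral>\<^sup>+w\<in>ball 0 1. ennreal (((1 - (norm w)\<^sup>2) ^ N * norm (g w)) powr p) *
          ennreal (1 / (1 - (norm w)\<^sup>2) ^ (CARD('n) + 1)) \<partial>lborel)"
    using radial_integral_le[where ?'n = 'n, OF p] by blast
  define v where "v = unit_ball_vol (real DIM(complex ^ 'n))"
  have v: "v > 0" by (simp add: v_def)
  have vol: "emeasure lborel (ball (0 :: complex ^ 'n) 1) = ennreal v"
    by (simp add: emeasure_ball v_def)
  define e where "e = 1 - 1/p"
  have e: "e \<ge> 0" using p by (simp add: e_def)
  \<comment> \<open>One summand for each half of the norm. The derivatives at 0 come without a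
    logarithm and are absorbed because the logarithm is at least ln 2; the integrals carry the
    constant of the radial estimate, with \<open>v\<close> undoing the normalisation of the
    volume.\<close>
  define A where "A = (ln 2) powr (- e) + (C * v) powr (1/p)"
  define B where "B = real CARD('n) ^ N * A"
  have A: "A > 0" by (simp add: A_def add_pos_nonneg)
  then have B: "B > 0" by (simp add: B_def)
  have main: "norm (f z) \<le> B * enn2real (besov_norm p N f) * ln (2 / (1 - (norm z)\<^sup>2)) powr e"
    if f: "holomorphic_several f (ball 0 1)" and bf: "besov_norm p N f < \<infinity>" and z: "norm z < 1"
    for f :: "complex ^ 'n \<Rightarrow> complex" and z
  proof -
    define r where "r = norm z"
    \<comment> \<open>At the origin any unit vector serves as direction; an arbitrary coordinate
      axis is chosen.\<close>
    define \<zeta> where "\<zeta> = (if z = 0 then axis undefined 1 else (1 / norm z) *\<^sub>R z)"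
    have \<zeta>: "norm \<zeta> = 1" "z = r *\<^sub>R \<zeta>" by (auto simp: \<zeta>_def r_def)
    have r: "0 \<le> r" "r < 1" using z by (auto simp: r_def)
    define \<Lambda> where "\<Lambda> = ln (2 / (1 - (norm z)\<^sup>2))"
    have \<Lambda>: "\<Lambda> \<ge> ln 2" unfolding \<Lambda>_def by (rule log_weight_ge[OF z])
    have L: "- ln (1 - r) \<le> \<Lambda>"
    proof -
      have "- ln (1 - r) = ln (1 / (1 - r))" using r by (simp add: ln_div)
      also have "\<dots> \<le> \<Lambda>" unfolding \<Lambda>_def using one_minus_norm_square[OF z] r
        by (subst ln_le_cancel_iff) (auto simp: r_def field_simps)
      finally show ?thesis .
    qed
    have L0: "0 \<le> - ln (1 - r)" using r by simp
    define \<nu> where "\<nu> m = enn2real (Lp_norm p tau_ball (weighted_partial N m f))" for m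
    have I: "integral {0..r} (\<lambda>t. (1 - t) ^ (N - 1) * norm (partial_multi m f (t *\<^sub>R \<zeta>)))
       \<le> (C * v) powr (1/p) * \<Lambda> powr e * \<nu> m" if m: "sum m UNIV = N" for m
    proof -
      define g where "g = partial_multi m f"
      have g: "holomorphic_several g (ball 0 1)" unfolding g_def
        by (rule holomorphic_several_partial_multi[OF f]) simp
      have cg: "continuous_on (ball 0 1) g" by (rule holomorphic_several_continuous_on[OF g])
      define h where "h w = ennreal (norm (weighted_partial N m f w) powr p)" for w
      have heq: "h w = ennreal (((1 - (norm w)\<^sup>2) ^ N * norm (g w)) powr p)" if "norm w < 1" for w
        using one_minus_norm_square(1)[OF that] by (simp add: h_def weighted_partial_def norm_mult norm_power g_def del: of_real_power of_real_diff)
      have cwp: "continuous_on (ball 0 1) (weighted_partial N m f)"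
        unfolding weighted_partial_def using cg unfolding g_def by (intro continuous_intros)
      define I where "I = (\<integral>\<^sup>+w. h w \<partial>tau_ball)"
      have "I = (\<integral>\<^sup>+w\<in>ball 0 1. h w * ennreal (1 / (1 - (norm w)\<^sup>2) ^ (CARD('n) + 1)) \<partial>lborel) / ennreal v"
        unfolding I_def vol[symmetric]
        by (rule nn_integral_tau_ball) (unfold h_def, rule borel_measurable_powr_norm_indicator[OF cwp])
      also have "(\<integral>\<^sup>+w\<in>ball 0 1. h w * ennreal (1 / (1 - (norm w)\<^sup>2) ^ (CARD('n) + 1)) \<partial>lborel)
        = (\<integral>\<^sup>+w\<in>ball 0 1. ennreal (((1 - (norm w)\<^sup>2) ^ N * norm (g w)) powr p) *
          ennreal (1 / (1 - (norm w)\<^sup>2) ^ (CARD('n) + 1)) \<partial>lborel)" (is "_ = ?J")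
        by (intro nn_integral_cong) (simp add: heq indicator_def)
      finally have IJ: "I = ?J / ennreal v" .
      have Lp: "Lp_norm p tau_ball (weighted_partial N m f) = ennreal_powr I (1/p)"
        unfolding Lp_norm_def I_def h_def ..
      have It: "I \<noteq> top" using besov_norm_finite(1)[OF bf m] unfolding Lp
        by (auto simp: ennreal_powr_def)
      then have \<nu>: "\<nu> m = enn2real I powr (1/p)" unfolding \<nu>_def Lp by (simp add: ennreal_powr_def)
      have "ennreal v * (J / ennreal v) = J" for J
        using v ennreal_mult_divide_eq[of "ennreal v" J] by (simp add: ennreal_times_divide mult.commute[of _ J])
      then have "?J = ennreal v * I" unfolding IJ by (rule sym)
      also have "\<dots> = ennreal (v * enn2real I)"
        using v It by (simp add: ennreal_mult' less_top)
      finally have J: "?J = ennreal (v * enn2real I)" .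
      define Y where "Y = C * (v * enn2real I)"
      have "ennreal (integral {0..r} (\<lambda>t. ((1 - t) ^ N * norm (g (t *\<^sub>R \<zeta>))) powr p * (1 / (1 - t)))) \<le> ennreal Y"
        using rad[OF g \<zeta>(1) r] unfolding J Y_def using C v by (simp add: ennreal_mult'[symmetric])
      then have Y: "integral {0..r} (\<lambda>t. ((1 - t) ^ N * norm (g (t *\<^sub>R \<zeta>))) powr p * (1 / (1 - t))) \<le> Y"
        using C v by (simp add: ennreal_le_iff Y_def)
      have "integral {0..r} (\<lambda>t. (1 - t) ^ (N - 1) * norm (g (t *\<^sub>R \<zeta>)))
        \<le> (- ln (1 - r)) powr (1 - 1/p) * Y powr (1/p)"
        by (rule radial_Holder[OF p N r _ _ Y])
          (auto intro!: continuous_on_norm continuous_on_ray[OF cg \<zeta>(1) r(2)])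
      also have "\<dots> \<le> \<Lambda> powr e * Y powr (1/p)"
        unfolding e_def[symmetric] using L L0 e by (intro mult_right_mono powr_mono2) auto
      also have "Y powr (1/p) = (C * v) powr (1/p) * \<nu> m"
        unfolding Y_def \<nu> using C v by (simp add: powr_mult)
      finally show ?thesis by (simp add: g_def mult_ac)
    qed
    define S where "S = (\<Sum>m | sum m UNIV \<le> N - 1. norm (partial_multi m f 0))"
    have S: "S \<ge> 0" by (simp add: S_def sum_nonneg)
    have "ln 2 powr e \<le> \<Lambda> powr e" using \<Lambda> e by (intro powr_mono2) auto
    then have "1 \<le> ln 2 powr (- e) * \<Lambda> powr e"
      by (simp add: powr_minus field_simps)
    then have S': "S * 1 \<le> S * (ln 2 powr (- e) * \<Lambda> powr e)" using S by (intro mult_left_mono)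
    have "norm (f z) \<le> real CARD('n) ^ N * (S +
      (\<Sum>m | sum m UNIV = N. integral {0..r} (\<lambda>t. (1 - t) ^ (N - 1) * norm (partial_multi m f (t *\<^sub>R \<zeta>)))))"
      using radial_Taylor_bound[OF f \<zeta>(1) r N] \<zeta>(2) by (simp add: S_def)
    also have "\<dots> \<le> real CARD('n) ^ N * (S * (ln 2 powr (- e) * \<Lambda> powr e) +
      (\<Sum>m | sum m UNIV = N. (C * v) powr (1/p) * \<Lambda> powr e * \<nu> m))"
      using S' I by (intro mult_left_mono add_mono sum_mono) auto
    also have "\<dots> = real CARD('n) ^ N * \<Lambda> powr e * (ln 2 powr (- e) * S + (C * v) powr (1/p) * (\<Sum>m | sum m UNIV = N. \<nu> m))"
      by (simp add: sum_distrib_left algebra_simps)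
    also have "\<dots> \<le> real CARD('n) ^ N * \<Lambda> powr e * (A * S + A * (\<Sum>m | sum m UNIV = N. \<nu> m))"
      using S by (intro mult_left_mono add_mono mult_right_mono) (auto simp: A_def \<nu>_def intro!: sum_nonneg)
    also have "\<dots> = B * enn2real (besov_norm p N f) * \<Lambda> powr e"
      unfolding besov_norm_finite(2)[OF bf] by (simp add: B_def S_def \<nu>_def algebra_simps)
    finally show ?thesis by (simp add: \<Lambda>_def)
  qed
  show ?thesis unfolding e_def[symmetric]
    by (intro exI[of _ B] conjI allI impI B main)
qed

section \<open>A logarithmic Forelli--Rudin estimate\<close>

text \<open>The non-isotropic (Koranyi) ball of radius h, with its centre a taken inside the unit
  ball instead of on the sphere.\<close>

definition slab :: "complex ^ 'n \<Rightarrow> real \<Rightarrow> (complex ^ 'n) set" where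
  "slab a h = {z. norm z < 1 \<and> norm (1 - cinner z a) \<le> h}"

lemma slab_measurable [measurable]: "slab a h \<in> sets borel"
  unfolding slab_def by measurable

lemma one_minus_cinner_ge:
  assumes "norm a < 1" "norm z < 1"
  shows "1 - norm a \<le> norm (1 - cinner z a)" "1 - norm z \<le> norm (1 - cinner z a)"
    "norm (1 - cinner z a) < 2"
proof -
  have "norm z * norm a \<le> 1 * norm a" "norm z * norm a \<le> norm z * 1"
    using assms by (intro mult_right_mono mult_left_mono; simp)+
  then have c: "norm (cinner z a) \<le> norm a" "norm (cinner z a) \<le> norm z"
    using norm_cinner_le[of z a] by linarith+
  have "1 - norm (cinner z a) \<le> norm (1 - cinner z a)"
    using norm_triangle_ineq2[of 1 "cinner z a"] by simp
  with c show "1 - norm a \<le> norm (1 - cinner z a)" "1 - norm z \<le> norm (1 - cinner z a)" by linarith+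
  have "norm (1 - cinner z a) \<le> 1 + norm (cinner z a)"
    using norm_triangle_ineq4[of 1 "cinner z a"] by simp
  with c assms show "norm (1 - cinner z a) < 2" by linarith
qed

text \<open>Expanding the square, |z - a|^2 < 2 - 2 Re <z,a> = 2 Re (1 - <z,a>). This shows that a
  slab has Euclidean extent of order sqrt h, although it is much thinner in the direction of
  a.\<close>

lemma norm_diff_le_slab:
  assumes "norm a < 1" "norm z < 1" "norm (1 - cinner z a) \<le> h"
  shows "(norm (z - a))\<^sup>2 \<le> 2 * h"
proof -
  have "complex_of_real ((norm (z - a))\<^sup>2) = cinner (z - a) (z - a)" by (rule cinner_self[symmetric])
  also have "\<dots> = cinner z z + cinner a a - (cinner z a + cnj (cinner z a))"
    by (simp add: cinner_linear_left cinner_linear_right cinner_commute[of a z])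
  also have "\<dots> = complex_of_real ((norm z)\<^sup>2 + (norm a)\<^sup>2 - 2 * Re (cinner z a))"
    unfolding cinner_self complex_add_cnj by simp
  finally have *: "(norm (z - a))\<^sup>2 = (norm z)\<^sup>2 + (norm a)\<^sup>2 - 2 * Re (cinner z a)"
    unfolding of_real_eq_iff .
  have "Re (1 - cinner z a) \<le> h" using complex_Re_le_cmod[of "1 - cinner z a"] assms by linarith
  moreover have "(norm z)\<^sup>2 < 1" "(norm a)\<^sup>2 < 1" using assms by (auto simp: abs_square_less_1)
  ultimately show ?thesis unfolding * by simp
qed

text \<open>Translating a slab by multiples of \<open>a\<close> moves it a distance \<open>\<surd>h\<close> inside a ball of radius
  comparable to \<open>\<surd>h\<close>, while every point is covered only by translation vectors from a disc of
  radius comparable to \<open>h\<close>.\<close>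

lemma slab_volume:
  "\<exists>C>0. \<forall>(a :: complex ^ 'n) h. norm a < 1 \<longrightarrow> 1 - norm a \<le> h \<longrightarrow>
     emeasure lborel (slab a h) \<le> ennreal (C * h ^ (CARD('n) + 1))"
proof -
  define n where "n = CARD('n)"
  define v where "v = unit_ball_vol (real DIM(complex ^ 'n))"
  have v: "v > 0" by (simp add: v_def)
  define C where "C = v * 16 * 9 ^ n + v * 2 ^ (n + 1)"
  have C: "C > 0" using v by (simp add: C_def add_pos_pos)
  have main: "emeasure lborel (slab a h) \<le> ennreal (C * h ^ (n + 1))"
    if a: "norm a < 1" and h: "1 - norm a \<le> h" for a :: "complex ^ 'n" and h
  \<comment> \<open>For large h the volume of the unit ball suffices as a bound. For h < 1/2 the
    hypothesis forces |a| > 1/2, so that translations along \<open>a\<close> really move the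
    slab.\<close>
  proof (cases "h \<ge> 1 / 2")
    case True
    have "emeasure lborel (slab a h) \<le> emeasure lborel (ball (0 :: complex ^ 'n) 1)"
      by (intro emeasure_mono) (auto simp: slab_def)
    also have "\<dots> = ennreal v" by (simp add: emeasure_ball v_def)
    also have "v \<le> C * h ^ (n + 1)"
    proof -
      have "(1/2) ^ (n + 1) \<le> h ^ (n + 1)" using True by (intro power_mono) auto
      then have "v * 2 ^ (n + 1) * (1/2) ^ (n + 1) \<le> C * h ^ (n + 1)"
        using v C by (intro mult_mono) (auto simp: C_def)
      then show ?thesis by (simp add: power_divide)
    qed
    finally show ?thesis by (simp add: ennreal_leI)
  next
    case False
    then have h1: "h < 1/2" by simp
    have h0: "h > 0" using a h by simp
    have a1: "norm a > 1/2" using h h1 by simp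
    have a2: "1/4 \<le> (norm a)\<^sup>2" using power_mono[of "1/2" "norm a" 2] a1 by (simp add: power2_eq_square)
    define s where "s = sqrt h"
    have s: "s > 0" "s\<^sup>2 = h" using h0 by (simp_all add: s_def)
    define F where "F k z = (if norm k < s \<and> z + k *s a \<in> slab a h then 1 else 0 :: ennreal)" for k z
    have mF: "(\<lambda>(k, z). F k z) \<in> borel_measurable (lborel \<Otimes>\<^sub>M lborel)"
      unfolding F_def by measurable
    have "ennreal (pi * h) * emeasure lborel (slab a h) =
       (\<integral>\<^sup>+k. emeasure lborel (slab a h) * indicator (ball 0 s) (k :: complex) \<partial>lborel)"
      using s by (subst nn_integral_cmult_indicator) (simp_all add: emeasure_ball unit_ball_vol_2 mult.commute)
    also have "\<dots> = (\<integral>\<^sup>+k. \<integral>\<^sup>+z. F k z \<partial>lborel \<partial>lborel)"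
    proof (rule nn_integral_cong)
      fix k :: complex
      have "(\<integral>\<^sup>+z. F k z \<partial>lborel) = (\<integral>\<^sup>+z. indicator (slab a h) (z + k *s a) * indicator (ball 0 s) k \<partial>lborel)"
        by (intro nn_integral_cong) (auto simp: F_def indicator_def)
      also have "\<dots> = (\<integral>\<^sup>+z. indicator (slab a h) z * indicator (ball 0 s) k \<partial>lborel)"
        by (rule nn_integral_lborel_translate[where F = "\<lambda>z. indicator (slab a h) z * indicator (ball 0 s) k"]) measurable
      also have "\<dots> = emeasure lborel (slab a h) * indicator (ball 0 s) k"
        by (subst nn_integral_multc) auto
      finally show "emeasure lborel (slab a h) * indicator (ball 0 s) k = (\<integral>\<^sup>+z. F k z \<partial>lborel)" by simp
    qed
    also have "\<dots> = (\<integral>\<^sup>+z. \<integral>\<^sup>+k. F k z \<partial>lborel \<partial>lborel)"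
      using lborel_pair.Fubini'[OF mF] by simp
    also have "\<dots> \<le> (\<integral>\<^sup>+z. ennreal (pi * (4 * h)\<^sup>2) * indicator (cball a (3 * s)) z \<partial>lborel)"
    proof (rule nn_integral_mono)
      fix z :: "complex ^ 'n"
      \<comment> \<open>The centre of the disc of admissible translations: 1 - <z + k a, a> equals
        |a|^2 (c - k), and |a|^2 >= 1/4 turns the bound h into |c - k| <= 4h.\<close>
      define c where "c = (1 - cinner z a) / of_real ((norm a)\<^sup>2)"
      have Fle: "F k z \<le> indicator (cball c (4 * h)) k * indicator (cball a (3 * s)) z" for k
      proof (cases "norm k < s \<and> z + k *s a \<in> slab a h")
        case True
        then have z: "norm (z + k *s a) < 1" "norm (1 - cinner (z + k *s a) a) \<le> h" and k: "norm k < s"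
          by (auto simp: slab_def)
        have "(norm (z + k *s a - a))\<^sup>2 \<le> 2 * h" using norm_diff_le_slab[OF a z] .
        also have "\<dots> \<le> (2 * s)\<^sup>2" using s h0 by (simp add: power_mult_distrib)
        finally have "norm (z + k *s a - a) \<le> 2 * s" by (rule power2_le_imp_le) (use s in simp)
        moreover have "norm (k *s a) \<le> s * 1" unfolding norm_vector_smult
          using k a s by (intro mult_mono) auto
        moreover have "norm (z - a) \<le> norm (z + k *s a - a) + norm (k *s a)"
          using norm_triangle_ineq4[of "z + k *s a - a" "k *s a"] by (simp add: algebra_simps)
        ultimately have 1: "z \<in> cball a (3 * s)" by (simp add: dist_norm norm_minus_commute)
        have "complex_of_real ((norm a)\<^sup>2) \<noteq> 0" using a1 by auto
        then have "complex_of_real ((norm a)\<^sup>2) * c = 1 - cinner z a" by (simp add: c_def)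
        then have "1 - cinner (z + k *s a) a = of_real ((norm a)\<^sup>2) * (c - k)"
          by (simp add: cinner_add_left cinner_linear_left cinner_self left_diff_distrib mult.commute)
        then have "(norm a)\<^sup>2 * norm (c - k) \<le> h" using z(2) by (simp add: norm_mult norm_power)
        moreover have "1/4 * norm (c - k) \<le> (norm a)\<^sup>2 * norm (c - k)"
          using a2 by (intro mult_right_mono) auto
        ultimately have "k \<in> cball c (4 * h)" by (simp add: dist_norm)
        with 1 show ?thesis using True by (simp add: F_def)
      qed (auto simp: F_def)
      have "(\<integral>\<^sup>+k. F k z \<partial>lborel) \<le> (\<integral>\<^sup>+k. indicator (cball c (4 * h)) k * indicator (cball a (3 * s)) z \<partial>lborel)"
        by (intro nn_integral_mono Fle)
      also have "\<dots> = emeasure lborel (cball c (4 * h)) * indicator (cball a (3 * s)) z"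
        by (subst nn_integral_multc) (auto intro!: borel_measurable_indicator)
      also have "emeasure lborel (cball c (4 * h)) = ennreal (pi * (4 * h)\<^sup>2)"
        using h0 by (simp add: emeasure_cball unit_ball_vol_2)
      finally show "(\<integral>\<^sup>+k. F k z \<partial>lborel) \<le> ennreal (pi * (4 * h)\<^sup>2) * indicator (cball a (3 * s)) z" .
    qed
    also have "\<dots> = ennreal (pi * (4 * h)\<^sup>2) * ennreal (v * (3 * s) ^ (2 * n))"
      using s by (subst nn_integral_cmult_indicator) (simp_all add: emeasure_cball v_def n_def mult.commute[of _ 2])
    also have "(3 * s) ^ (2 * n) = 9 ^ n * h ^ n"
      unfolding power_mult using s by (simp add: power_mult_distrib)
    also have "ennreal (pi * (4 * h)\<^sup>2) * ennreal (v * (9 ^ n * h ^ n)) = ennreal (pi * h) * ennreal (v * 16 * 9 ^ n * h ^ (n + 1))"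
      using h0 v by (simp add: ennreal_mult'[symmetric] power2_eq_square mult_ac)
    finally have "emeasure lborel (slab a h) \<le> ennreal (v * 16 * 9 ^ n * h ^ (n + 1))"
      using h0 by (subst (asm) ennreal_mult_le_mult_iff) auto
    also have "\<dots> \<le> ennreal (C * h ^ (n + 1))"
      using h0 v by (intro ennreal_leI mult_right_mono) (auto simp: C_def)
    finally show ?thesis .
  qed
  show ?thesis
    by (intro exI[of _ C] conjI allI impI C main[unfolded n_def])
qed

text \<open>The weight is integrated by averaging over the dilations \<open>z \<mapsto> s z\<close> with
  \<open>1 - h \<le> s \<le> 1\<close>, which turns it into a one-dimensional integral in \<open>s\<close>.\<close>

lemma slab_weighted_volume:
  assumes \<alpha>: "-1 < \<alpha>"
  shows "\<exists>C>0. \<forall>(a :: complex ^ 'n) h. norm a < 1 \<longrightarrow> 1 - norm a \<le> h \<longrightarrow> h \<le> 4 \<longrightarrow>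
    (\<integral>\<^sup>+z\<in>slab a h. ennreal ((1 - (norm z)\<^sup>2) powr \<alpha>) \<partial>lborel) \<le> ennreal (C * h powr (real CARD('n) + 1 + \<alpha>))"
proof -
  define n where "n = CARD('n)"
  obtain C0 where C0: "C0 > 0" and vol: "\<And>(a :: complex ^ 'n) h. norm a < 1 \<Longrightarrow> 1 - norm a \<le> h \<Longrightarrow>
     emeasure lborel (slab a h) \<le> ennreal (C0 * h ^ (n + 1))"
    using slab_volume[where ?'n = 'n] unfolding n_def by blast
  \<comment> \<open>After the dilation the weight contains the factor (s + |w|) / s^2, which lies
    between 1 and 4; the maximum bounds its power for either sign of \<alpha>.\<close>
  define K where "K = max 1 (4 powr \<alpha>)"
  have K: "K \<ge> 1" by (simp add: K_def)
  define M where "M = 4 ^ n * K * (2 powr (\<alpha> + 1) / (\<alpha> + 1)) * (C0 * 2 ^ (n + 1))"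
  have M: "M > 0" using K C0 \<alpha> by (simp add: M_def)
  have main: "(\<integral>\<^sup>+z\<in>slab a h. ennreal ((1 - (norm z)\<^sup>2) powr \<alpha>) \<partial>lborel) \<le> ennreal (8 * M * h powr (real n + 1 + \<alpha>))"
    if a: "norm a < 1" and h: "1 - norm a \<le> h" "h \<le> 4" for a :: "complex ^ 'n" and h
  proof -
    have h0: "h > 0" using a h by simp
    \<comment> \<open>The cap 1/2 keeps s >= 1/2, so Jacobian and weight stay bounded; h <= 4
      ensures that the averaging interval still has length at least h/8, the origin of the factor 8
      in the constant.\<close>
    define \<eta> where "\<eta> = min h (1/2)"
    have \<eta>: "0 < \<eta>" "\<eta> \<le> h" "\<eta> \<le> 1/2" "h / 8 \<le> \<eta>" using h0 h by (auto simp: \<eta>_def)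
    define F where "F z = ennreal ((1 - (norm z)\<^sup>2) powr \<alpha>) * indicator (slab a h) z" for z
    have [measurable]: "F \<in> borel_measurable borel" unfolding F_def[abs_def] by measurable
    define I where "I = (\<integral>\<^sup>+z. F z \<partial>lborel)"
    \<comment> \<open>With w = s z one has 1 - |z|^2 = (s - |w|)(s + |w|) / s^2, so for fixed w the
      weight becomes a power of s - |w|, integrable because \<alpha> > -1. The slab is doubled since
      the dilation changes 1 - <z,a> by at most 1 - s <= h.\<close>
    define G where "G s w = (if 1 - \<eta> \<le> s \<and> s \<le> 1 \<and> norm w < s \<and> w \<in> slab a (2 * h)
       then ennreal (4 ^ n * K * (s - norm w) powr \<alpha>) else 0)" for s :: real and w :: "complex ^ 'n"
    have mG: "(\<lambda>(s, w). G s w) \<in> borel_measurable (lborel \<Otimes>\<^sub>M lborel)"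
      unfolding G_def by measurable
    have IG: "I \<le> (\<integral>\<^sup>+w. G s w \<partial>lborel)" if s: "1 - \<eta> \<le> s" "s \<le> 1" for s
    proof -
      have s2: "1/2 \<le> s" using s \<eta> by simp
      have "I = ennreal ((1/s) ^ DIM(complex ^ 'n)) * (\<integral>\<^sup>+w. F ((1/s) *\<^sub>R w) \<partial>lborel)"
        unfolding I_def using s2 by (intro nn_integral_lborel_scale) auto
      also have "\<dots> = (\<integral>\<^sup>+w. ennreal ((1/s) ^ DIM(complex ^ 'n)) * F ((1/s) *\<^sub>R w) \<partial>lborel)"
        by (rule nn_integral_cmult[symmetric]) measurable
      also have "\<dots> \<le> (\<integral>\<^sup>+w. G s w \<partial>lborel)"
      proof (rule nn_integral_mono)
        fix w
        show "ennreal ((1/s) ^ DIM(complex ^ 'n)) * F ((1/s) *\<^sub>R w) \<le> G s w"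
        proof (cases "(1/s) *\<^sub>R w \<in> slab a h")
          case True
          then have w: "norm w / s < 1" and w2: "norm (1 - cinner ((1/s) *\<^sub>R w) a) \<le> h"
            using s2 by (auto simp: slab_def)
          have ws: "norm w < s" using w s2 by (simp add: field_simps)
          have "(1/s) *\<^sub>R w = of_real (1/s) *s w" by (simp only: smult_of_real)
          then have c: "cinner ((1/s) *\<^sub>R w) a = cinner w a / of_real s"
            by (simp add: cinner_linear_left)
          have "1 - cinner w a = of_real s * (1 - cinner ((1/s) *\<^sub>R w) a) + of_real (1 - s)"
            unfolding c using s2 by (simp add: algebra_simps)
          then have "norm (1 - cinner w a) \<le> norm (of_real s * (1 - cinner ((1/s) *\<^sub>R w) a)) + norm (complex_of_real (1 - s))"
            by (metis norm_triangle_ineq)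
          also have "\<dots> \<le> 1 * h + h"
            unfolding norm_mult norm_of_real using s s2 w2 \<eta> by (intro add_mono mult_mono) auto
          finally have wS: "w \<in> slab a (2 * h)" using ws s by (simp add: slab_def)
          have x: "1 - (norm ((1/s) *\<^sub>R w))\<^sup>2 = (s - norm w) * ((s + norm w) / s\<^sup>2)"
            using s2 by (simp add: power_divide field_simps power2_eq_square)
          have q1: "1 \<le> (s + norm w) / s\<^sup>2"
          proof -
            have "s * s \<le> s * 1" using s s2 by (intro mult_left_mono) auto
            then have "s\<^sup>2 \<le> s + norm w" using norm_ge_zero[of w] unfolding power2_eq_square by linarith
            then show ?thesis using s2 by (simp add: pos_le_divide_eq)
          qed
          have q2: "(s + norm w) / s\<^sup>2 \<le> 4"
          proof -
            have "s + norm w \<le> 2 * s" using ws by simp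
            also have "\<dots> \<le> 4 * s\<^sup>2" using mult_right_mono[OF s2, of s] s2 by (simp add: power2_eq_square)
            finally show ?thesis using s2 by (simp add: field_simps)
          qed
          have "((s + norm w) / s\<^sup>2) powr \<alpha> \<le> K"
          proof (cases "\<alpha> \<ge> 0")
            case True
            then have "((s + norm w) / s\<^sup>2) powr \<alpha> \<le> 4 powr \<alpha>" using q1 q2 by (intro powr_mono2) auto
            then show ?thesis by (simp add: K_def)
          next
            case False
            then have "((s + norm w) / s\<^sup>2) powr \<alpha> \<le> 1 powr \<alpha>" using q1 by (intro powr_mono2') auto
            then show ?thesis by (simp add: K_def)
          qed
          then have "(1 - (norm ((1/s) *\<^sub>R w))\<^sup>2) powr \<alpha> \<le> (s - norm w) powr \<alpha> * K"
            unfolding x powr_mult by (intro mult_left_mono) auto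
          moreover have "(1/s) ^ DIM(complex ^ 'n) \<le> 4 ^ n"
          proof -
            have "1/s \<le> 2" using s2 by (simp add: field_simps)
            then have "(1/s) ^ DIM(complex ^ 'n) \<le> 2 ^ DIM(complex ^ 'n)" using s2 by (intro power_mono) auto
            also have "\<dots> = (2\<^sup>2) ^ n" unfolding power_mult[symmetric] by (simp add: n_def mult.commute)
            also have "\<dots> = 4 ^ n" by simp
            finally show ?thesis .
          qed
          ultimately have "(1/s) ^ DIM(complex ^ 'n) * (1 - (norm ((1/s) *\<^sub>R w))\<^sup>2) powr \<alpha> \<le> 4 ^ n * ((s - norm w) powr \<alpha> * K)"
            using s2 by (intro mult_mono) auto
          then have "ennreal ((1/s) ^ DIM(complex ^ 'n)) * F ((1/s) *\<^sub>R w) \<le> ennreal (4 ^ n * K * (s - norm w) powr \<alpha>)"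
            using True s2 unfolding F_def
            by (simp only: indicator_simps mult_1_right) (simp add: ennreal_mult'[symmetric] ennreal_leI mult_ac del: norm_scaleR DIM_cart)
          then show ?thesis using s ws wS by (simp add: G_def)
        qed (simp add: F_def)
      qed
      finally show ?thesis .
    qed
    have "ennreal \<eta> * I = (\<integral>\<^sup>+s. I * indicator {1 - \<eta>..1} s \<partial>lborel)"
      using \<eta> by (subst nn_integral_cmult_indicator) (simp_all add: mult.commute)
    also have "\<dots> \<le> (\<integral>\<^sup>+s. \<integral>\<^sup>+w. G s w \<partial>lborel \<partial>lborel)"
      using IG by (intro nn_integral_mono) (auto simp: indicator_def)
    also have "\<dots> = (\<integral>\<^sup>+w. \<integral>\<^sup>+s. G s w \<partial>lborel \<partial>lborel)"
      using lborel_pair.Fubini'[OF mG] by simp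
    also have "\<dots> \<le> (\<integral>\<^sup>+w. ennreal (4 ^ n * K * ((2 * h) powr (\<alpha> + 1) / (\<alpha> + 1))) * indicator (slab a (2 * h)) w \<partial>lborel)"
    proof (rule nn_integral_mono)
      fix w :: "complex ^ 'n"
      show "(\<integral>\<^sup>+s. G s w \<partial>lborel) \<le> ennreal (4 ^ n * K * ((2 * h) powr (\<alpha> + 1) / (\<alpha> + 1))) * indicator (slab a (2 * h)) w"
      proof (cases "w \<in> slab a (2 * h)")
        case True
        then have w: "norm w < 1" "1 - norm w \<le> 2 * h"
          using one_minus_cinner_ge(2)[OF a, of w] by (auto simp: slab_def)
        define P where "P = (\<lambda>x. ennreal (x powr \<alpha>) * indicator {0..1 - norm w} x)"
        have "((\<lambda>x. x powr \<alpha>) has_integral ((1 - norm w) powr (\<alpha> + 1) / (\<alpha> + 1))) {0..1 - norm w}"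
          using w \<alpha> by (intro has_integral_powr_from_0) auto
        then have Pint: "(\<integral>\<^sup>+x. P x \<partial>lborel) = ennreal ((1 - norm w) powr (\<alpha> + 1) / (\<alpha> + 1))"
          unfolding P_def by (intro nn_integral_has_integral_lebesgue') auto
        have [measurable]: "P \<in> borel_measurable borel" unfolding P_def by measurable
        have "(\<integral>\<^sup>+s. G s w \<partial>lborel) \<le> (\<integral>\<^sup>+s. ennreal (4 ^ n * K) * P (s + (- norm w)) \<partial>lborel)"
          using K by (intro nn_integral_mono) (auto simp: G_def P_def indicator_def ennreal_mult')
        also have "\<dots> = ennreal (4 ^ n * K) * (\<integral>\<^sup>+s. P (s + (- norm w)) \<partial>lborel)"
          by (rule nn_integral_cmult) measurable
        also have "(\<integral>\<^sup>+s. P (s + (- norm w)) \<partial>lborel) = (\<integral>\<^sup>+s. P s \<partial>lborel)"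
          by (rule nn_integral_lborel_translate) measurable
        also have "\<dots> \<le> ennreal ((2 * h) powr (\<alpha> + 1) / (\<alpha> + 1))"
          unfolding Pint using w \<alpha> by (intro ennreal_leI divide_right_mono powr_mono2) auto
        finally have "(\<integral>\<^sup>+s. G s w \<partial>lborel) \<le> ennreal (4 ^ n * K) * ennreal ((2 * h) powr (\<alpha> + 1) / (\<alpha> + 1))"
          by (simp add: mult_left_mono)
        also have "\<dots> = ennreal (4 ^ n * K * ((2 * h) powr (\<alpha> + 1) / (\<alpha> + 1)))"
          using \<alpha> by (intro ennreal_mult''[symmetric]) simp
        finally show ?thesis using True by simp
      qed (simp add: G_def)
    qed
    also have "\<dots> = ennreal (4 ^ n * K * ((2 * h) powr (\<alpha> + 1) / (\<alpha> + 1))) * emeasure lborel (slab a (2 * h))"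
      by (rule nn_integral_cmult_indicator) simp
    also have "\<dots> \<le> ennreal (4 ^ n * K * ((2 * h) powr (\<alpha> + 1) / (\<alpha> + 1))) * ennreal (C0 * (2 * h) ^ (n + 1))"
      using a h h0 by (intro mult_left_mono vol) auto
    also have "\<dots> = ennreal ((4 ^ n * K * ((2 * h) powr (\<alpha> + 1) / (\<alpha> + 1))) * (C0 * (2 * h) ^ (n + 1)))"
      using h0 C0 K \<alpha> by (intro ennreal_mult'[symmetric]) auto
    also have "(4 ^ n * K * ((2 * h) powr (\<alpha> + 1) / (\<alpha> + 1))) * (C0 * (2 * h) ^ (n + 1)) = M * (h powr (\<alpha> + 1) * h ^ (n + 1))"
      by (simp add: M_def powr_mult power_mult_distrib)
    also have "h powr (\<alpha> + 1) * h ^ (n + 1) = h * h powr (real n + 1 + \<alpha>)"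
    proof -
      have "h ^ (n + 1) = h powr (real n + 1)" using h0 powr_realpow[of h "n + 1"] by (simp add: add.commute)
      then have "h powr (\<alpha> + 1) * h ^ (n + 1) = h powr (1 + (real n + 1 + \<alpha>))"
        by (simp add: powr_add[symmetric] algebra_simps)
      then show ?thesis using h0 by (simp only: powr_add powr_one)
    qed
    finally have *: "ennreal \<eta> * I \<le> ennreal (M * (h * h powr (real n + 1 + \<alpha>)))" .
    have "ennreal (h / 8) * I \<le> ennreal \<eta> * I" using \<eta> by (intro mult_right_mono ennreal_leI) auto
    also note *
    also have "ennreal (M * (h * h powr (real n + 1 + \<alpha>))) = ennreal (h / 8) * ennreal (8 * M * h powr (real n + 1 + \<alpha>))"
      using h0 M by (simp add: ennreal_mult'[symmetric] mult_ac)
    finally have "I \<le> ennreal (8 * M * h powr (real n + 1 + \<alpha>))"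
      using h0 by (subst (asm) ennreal_mult_le_mult_iff) auto
    then show ?thesis by (simp add: I_def F_def)
  qed
  show ?thesis
    by (intro exI[of _ "8 * M"] conjI allI impI main[unfolded n_def]) (use M in auto)
qed

text \<open>The critical case: the exponent n + 1 + \<alpha> is the homogeneity of the weighted slab
  volume. The ball is decomposed into dyadic shells where |1 - <z,a>| is about 2^k (1 - |a|). Each
  shell contributes at most a fixed constant, and the number of shells is of the order of the
  logarithm.\<close>

lemma Forelli_Rudin_log:
  assumes \<alpha>: "-1 < \<alpha>"
  shows "\<exists>C>0. \<forall>a :: complex ^ 'n. norm a < 1 \<longrightarrow>
    (\<integral>\<^sup>+z\<in>ball 0 1. ennreal ((1 - (norm z)\<^sup>2) powr \<alpha> * norm (1 - cinner z a) powr (- (real CARD('n) + 1 + \<alpha>))) \<partial>lborel)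
      \<le> ennreal (C * ln (2 / (1 - (norm a)\<^sup>2)))"
proof -
  define \<beta> where "\<beta> = real CARD('n) + 1 + \<alpha>"
  have \<beta>: "\<beta> > 0" using \<alpha> by (simp add: \<beta>_def add_pos_pos)
  obtain C0 where C0: "C0 > 0" and vol: "\<And>(a :: complex ^ 'n) h. norm a < 1 \<Longrightarrow> 1 - norm a \<le> h \<Longrightarrow> h \<le> 4 \<Longrightarrow>
    (\<integral>\<^sup>+z\<in>slab a h. ennreal ((1 - (norm z)\<^sup>2) powr \<alpha>) \<partial>lborel) \<le> ennreal (C0 * h powr \<beta>)"
    using slab_weighted_volume[where ?'n = 'n, OF \<alpha>] unfolding \<beta>_def by blast
  define C where "C = C0 * 2 powr \<beta> * (3 / ln 2)"
  have C: "C > 0" using C0 by (simp add: C_def)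
  have main: "(\<integral>\<^sup>+z\<in>ball 0 1. ennreal ((1 - (norm z)\<^sup>2) powr \<alpha> * norm (1 - cinner z a) powr (- \<beta>)) \<partial>lborel)
      \<le> ennreal (C * ln (2 / (1 - (norm a)\<^sup>2)))" if a: "norm a < 1" for a :: "complex ^ 'n"
  proof -
    define \<delta> where "\<delta> = 1 - norm a"
    have \<delta>: "\<delta> > 0" using a by (simp add: \<delta>_def)
    define A where "A = {k. 2 ^ k * \<delta> < 2}"
    define L where "L = log 2 (2 / \<delta>)"
    have AL: "A \<subseteq> {..<nat \<lceil>L\<rceil>}"
    proof
      fix k assume "k \<in> A"
      then have "2 powr real k < 2 / \<delta>" using \<delta> by (simp add: A_def powr_realpow field_simps)
      then have "real k < L" unfolding L_def by (subst less_log_iff) (use \<delta> in auto)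
      then show "k \<in> {..<nat \<lceil>L\<rceil>}" by simp linarith
    qed
    have finA: "finite A" using AL finite_subset by blast
    define \<Lambda> where "\<Lambda> = ln (2 / (1 - (norm a)\<^sup>2))"
    have \<Lambda>: "ln 2 \<le> \<Lambda>" unfolding \<Lambda>_def by (rule log_weight_ge[OF a])
    \<comment> \<open>Rounding costs 1 and passing from 1 - |a| to 1 - |a|^2 costs another ln 2 / ln
      2; since \<Lambda> >= ln 2, the total 2 + \<Lambda> / ln 2 is at most 3 \<Lambda> / ln
      2.\<close>
    have cardA: "real (card A) \<le> 3 / ln 2 * \<Lambda>"
    proof -
      have "card A \<le> nat \<lceil>L\<rceil>" using card_mono[OF _ AL] by simp
      moreover have "\<delta> \<le> 1" by (simp add: \<delta>_def)
      then have "1 \<le> 2 / \<delta>" using \<delta> by (simp add: pos_le_divide_eq)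
      then have L0: "0 \<le> L" unfolding L_def using \<delta> by (subst zero_le_log_cancel_iff) auto
      ultimately have "real (card A) \<le> L + 1" by linarith
      moreover have "ln (2 / \<delta>) \<le> ln 2 + \<Lambda>"
      proof -
        have "ln (2 / \<delta>) \<le> ln (2 * (2 / (1 - (norm a)\<^sup>2)))"
          using one_minus_norm_square[OF a] \<delta> by (subst ln_le_cancel_iff) (auto simp: \<delta>_def field_simps)
        also have "\<dots> = ln 2 + \<Lambda>"
          unfolding \<Lambda>_def using one_minus_norm_square[OF a] by (intro ln_mult_pos) auto
        finally show ?thesis .
      qed
      then have "L \<le> (ln 2 + \<Lambda>) / ln 2" unfolding L_def log_def by (intro divide_right_mono) auto
      moreover have "(ln 2 + \<Lambda>) / ln 2 + 1 \<le> 3 / ln 2 * \<Lambda>"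
        using \<Lambda> by (simp add: field_simps)
      ultimately show ?thesis by linarith
    qed
    \<comment> \<open>A shell lies in the slab of twice its inner radius, and the kernel is largest
      at the inner radius. Membership of k in \<open>A\<close> keeps the slab radius below 4, as
      \<open>slab_weighted_volume\<close> demands.\<close>
    define F where "F k z = ennreal ((2 ^ k * \<delta>) powr (- \<beta>)) * (ennreal ((1 - (norm z)\<^sup>2) powr \<alpha>) * indicator (slab a (2 * (2 ^ k * \<delta>))) z)" for k z
    have [measurable]: "F k \<in> borel_measurable borel" for k unfolding F_def[abs_def] by measurable
    have "(\<integral>\<^sup>+z\<in>ball 0 1. ennreal ((1 - (norm z)\<^sup>2) powr \<alpha> * norm (1 - cinner z a) powr (- \<beta>)) \<partial>lborel)
      \<le> (\<integral>\<^sup>+z. (\<Sum>k\<in>A. F k z) \<partial>lborel)"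
    proof (rule nn_integral_mono)
      fix z :: "complex ^ 'n"
      show "ennreal ((1 - (norm z)\<^sup>2) powr \<alpha> * norm (1 - cinner z a) powr (- \<beta>)) * indicator (ball 0 1) z \<le> (\<Sum>k\<in>A. F k z)"
      proof (cases "norm z < 1")
        case True
        define y where "y = norm (1 - cinner z a)"
        have y: "\<delta> \<le> y" "y < 2" using one_minus_cinner_ge[OF a True] by (auto simp: y_def \<delta>_def)
        define k where "k = nat \<lfloor>log 2 (y / \<delta>)\<rfloor>"
        have l0: "0 \<le> log 2 (y / \<delta>)" using y \<delta> by simp
        have yd: "2 powr (log 2 (y / \<delta>)) = y / \<delta>" using y \<delta> by (intro powr_log_cancel) auto
        have "real k \<le> log 2 (y / \<delta>)" "log 2 (y / \<delta>) < real k + 1" unfolding k_def using l0 by linarith+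
        then have "2 powr real k \<le> 2 powr log 2 (y / \<delta>)" "2 powr log 2 (y / \<delta>) < 2 powr (real k + 1)"
          by (auto intro: powr_mono powr_less_mono)
        then have "2 powr real k \<le> y / \<delta>" "y / \<delta> < 2 powr (real k + 1)"
          by (simp_all only: yd)
        then have k: "2 ^ k * \<delta> \<le> y" "y < 2 * (2 ^ k * \<delta>)"
          using \<delta> by (simp_all add: powr_add powr_realpow field_simps)
        have kA: "k \<in> A" using k y by (simp add: A_def)
        have "y powr (- \<beta>) \<le> (2 ^ k * \<delta>) powr (- \<beta>)" using k \<delta> \<beta> by (intro powr_mono2') auto
        then have "(1 - (norm z)\<^sup>2) powr \<alpha> * y powr (- \<beta>) \<le> (2 ^ k * \<delta>) powr (- \<beta>) * (1 - (norm z)\<^sup>2) powr \<alpha>"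
          by (subst mult.commute) (intro mult_right_mono, auto)
        then have "ennreal ((1 - (norm z)\<^sup>2) powr \<alpha> * y powr (- \<beta>)) \<le> F k z"
          using k True by (simp add: F_def slab_def y_def ennreal_mult'[symmetric] ennreal_leI)
        also have "\<dots> \<le> (\<Sum>k\<in>A. F k z)" by (rule member_le_sum[OF kA _ finA]) auto
        finally show ?thesis using True by (simp add: y_def)
      qed simp
    qed
    also have "\<dots> = (\<Sum>k\<in>A. \<integral>\<^sup>+z. F k z \<partial>lborel)" by (rule nn_integral_sum) simp
    also have "\<dots> \<le> (\<Sum>k\<in>A. ennreal (C0 * 2 powr \<beta>))"
    proof (rule sum_mono)
      fix k assume "k \<in> A"
      then have k: "2 ^ k * \<delta> < 2" by (simp add: A_def)
      define h where "h = 2 ^ k * \<delta>"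
      have h: "h > 0" "\<delta> \<le> h" using \<delta> mult_right_mono[of 1 "2 ^ k" \<delta>] by (simp_all add: h_def)
      have "(\<integral>\<^sup>+z. F k z \<partial>lborel) = ennreal (h powr (- \<beta>)) * (\<integral>\<^sup>+z\<in>slab a (2 * h). ennreal ((1 - (norm z)\<^sup>2) powr \<alpha>) \<partial>lborel)"
        unfolding F_def h_def by (rule nn_integral_cmult) measurable
      also have "\<dots> \<le> ennreal (h powr (- \<beta>)) * ennreal (C0 * (2 * h) powr \<beta>)"
      proof (intro mult_left_mono vol a)
        show "1 - norm a \<le> 2 * h" using h unfolding \<delta>_def[symmetric] by linarith
        have "h < 2" using k unfolding h_def .
        then show "2 * h \<le> 4" by linarith
      qed simp
      also have "\<dots> = ennreal (C0 * 2 powr \<beta>)"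
        using h C0 by (simp add: ennreal_mult'[symmetric] powr_mult powr_minus)
      finally show "(\<integral>\<^sup>+z. F k z \<partial>lborel) \<le> ennreal (C0 * 2 powr \<beta>)" .
    qed
    also have "\<dots> = ennreal (real (card A) * (C0 * 2 powr \<beta>))"
      using C0 by (simp add: ennreal_mult ennreal_of_nat_eq_real_of_nat)
    also have "\<dots> \<le> ennreal (C * \<Lambda>)"
      using mult_right_mono[OF cardA, of "C0 * 2 powr \<beta>"] C0 by (intro ennreal_leI) (simp add: C_def mult_ac)
    finally show ?thesis by (simp add: \<Lambda>_def)
  qed
  show ?thesis unfolding \<beta>_def[symmetric]
    by (intro exI[of _ C] conjI allI impI C main)
qed

section \<open>Logarithmic test functions\<close>

text \<open>The second argument is the order of differentiation with respect to <z,a>. The family is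
  closed under coordinate derivatives up to factors conj(a_i), and the factorials are already
  included. Order 0 is log (2 / (1 - <z,a>)), split so that the principal branch is only evaluated
  in the right half-plane.\<close>

fun log_kernel :: "complex ^ 'n \<Rightarrow> nat \<Rightarrow> complex ^ 'n \<Rightarrow> complex" where
  "log_kernel a 0 z = of_real (ln 2) - Ln (1 - cinner z a)"
| "log_kernel a (Suc k) z = fact k / (1 - cinner z a) ^ Suc k"

lemma norm_cinner_less_1: "norm a < 1 \<Longrightarrow> norm z < 1 \<Longrightarrow> norm (cinner z a) < 1"
  using norm_cinner_le[of z a] mult_right_mono[of "norm z" 1 "norm a"] by simp

lemma Re_one_minus_cinner_pos: "norm a < 1 \<Longrightarrow> norm z < 1 \<Longrightarrow> 0 < Re (1 - cinner z a)"
  using norm_cinner_less_1[of a z] complex_Re_le_cmod[of "cinner z a"] by simp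

text \<open>The scalar \<open>c\<close> is carried along because iterated derivatives accumulate
  constant factors, and the induction needs a statement stable under them.\<close>

lemma log_kernel_has_derivative:
  assumes a: "norm a < 1" and z: "norm z < 1"
  shows "((\<lambda>z. c * log_kernel a k z) has_derivative (\<lambda>v. c * (cinner v a * log_kernel a (Suc k) z))) (at z)"
proof -
  define w where "w = 1 - cinner z a"
  have w: "w \<noteq> 0" "w \<notin> \<real>\<^sub>\<le>\<^sub>0"
    using Re_one_minus_cinner_pos[OF a z] by (auto simp: w_def complex_nonpos_Reals_iff)
  have "((\<lambda>z. cinner z a) has_derivative (\<lambda>v. cinner v a)) (at z)"
  proof -
    have i: "((\<lambda>x. x $ j) has_derivative (\<lambda>h. h $ j)) (at z)" for j :: 'a
      by (rule bounded_linear_imp_has_derivative[OF bounded_linear_vec_nth])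
    show ?thesis unfolding cinner_def by (intro has_derivative_sum has_derivative_mult_left i)
  qed
  then have inner: "((\<lambda>z. 1 - cinner z a) has_derivative (\<lambda>v. - cinner v a)) (at z)"
    by (auto intro!: derivative_eq_intros)
  have "\<exists>h. (\<forall>z. log_kernel a k z = h (1 - cinner z a)) \<and> (h has_field_derivative - log_kernel a (Suc k) z) (at w)"
  proof (cases k)
    case 0
    have "((\<lambda>u. of_real (ln 2) - Ln u) has_field_derivative - log_kernel a (Suc k) z) (at w)"
      using w by (auto intro!: derivative_eq_intros simp: 0 w_def divide_inverse)
    then show ?thesis using 0 by (intro exI[of _ "\<lambda>u. of_real (ln 2) - Ln u"]) simp
  next
    case (Suc j)
    have "((\<lambda>u. fact j / u ^ Suc j) has_field_derivative - log_kernel a (Suc k) z) (at w)"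
      unfolding Suc log_kernel.simps w_def[symmetric]
      by (rule derivative_eq_intros refl | use w in \<open>simp add: field_simps power2_eq_square\<close>)+
    then show ?thesis using Suc by (intro exI[of _ "\<lambda>u. fact j / u ^ Suc j"]) simp
  qed
  then obtain h where h: "\<And>z. log_kernel a k z = h (1 - cinner z a)"
    and hd: "(h has_field_derivative - log_kernel a (Suc k) z) (at w)" by blast
  have "((\<lambda>z. h (1 - cinner z a)) has_derivative (\<lambda>v. - log_kernel a (Suc k) z * - cinner v a)) (at z)"
    using has_derivative_compose[OF inner hd[unfolded w_def has_field_derivative_def]] .
  then have "((\<lambda>z. c * h (1 - cinner z a)) has_derivative (\<lambda>v. c * (- log_kernel a (Suc k) z * - cinner v a))) (at z)"
    by (rule has_derivative_mult_right)
  then have *: "((\<lambda>z. c * log_kernel a k z) has_derivative (\<lambda>v. c * (- log_kernel a (Suc k) z * - cinner v a))) (at z)"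
    by (subst h)
  have "c * (- L * - cinner v a) = c * (cinner v a * L)" for L v by simp
  then have "(\<lambda>v. c * (- log_kernel a (Suc k) z * - cinner v a)) = (\<lambda>v. c * (cinner v a * log_kernel a (Suc k) z))"
    by (intro ext)
  from *[unfolded this] show ?thesis .
qed

lemma log_kernel_holomorphic:
  fixes a :: "complex ^ 'n"
  assumes "norm a < 1"
  shows "holomorphic_several (\<lambda>z. c * log_kernel a k z) (ball 0 1)"
  unfolding holomorphic_several_def
proof
  fix z :: "complex ^ 'n" assume "z \<in> ball 0 1"
  then have "((\<lambda>z. c * log_kernel a k z) has_derivative (\<lambda>v. c * (cinner v a * log_kernel a (Suc k) z))) (at z)"
    by (intro log_kernel_has_derivative assms) simp
  moreover have "c * (cinner (b *s v) a * L) = b * (c * (cinner v a * L))" for b v L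
    by (simp add: cinner_linear_left)
  ultimately show "\<exists>f'. ((\<lambda>z. c * log_kernel a k z) has_derivative f') (at z) \<and> (\<forall>c v. f' (c *s v) = c * f' v)"
    by blast
qed

lemma complex_partial_log_kernel:
  assumes a: "norm a < 1" and z: "norm z < 1"
  shows "complex_partial i (\<lambda>z. c * log_kernel a k z) z = c * cnj (a $ i) * log_kernel a (Suc k) z"
proof -
  have "((\<lambda>t. c * log_kernel a k (z + t *s axis i 1)) has_field_derivative
     c * (cinner (axis i 1) a * log_kernel a (Suc k) z)) (at 0)"
    by (rule has_field_derivative_line)
      (use log_kernel_has_derivative[OF a z, of c k] in \<open>simp_all add: cinner_linear_left del: log_kernel.simps\<close>)
  then have "complex_partial i (\<lambda>z. c * log_kernel a k z) z = c * (cinner (axis i 1) a * log_kernel a (Suc k) z)"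
    unfolding complex_partial_eq directional_deriv_def by (rule DERIV_imp_deriv)
  also have "cinner (axis i 1) a = cnj (a $ i)"
    by (simp add: cinner_def axis_def if_distrib[of "\<lambda>x. x * _"] cong: if_cong)
  finally show ?thesis by simp
qed

lemma complex_partial_funpow_log_kernel:
  assumes a: "norm a < 1" and z: "norm z < 1"
  shows "(complex_partial i ^^ j) (\<lambda>z. c * log_kernel a k z) z = c * cnj (a $ i) ^ j * log_kernel a (k + j) z"
  using z
proof (induction j arbitrary: z)
  case (Suc j)
  have "(complex_partial i ^^ Suc j) (\<lambda>z. c * log_kernel a k z) z
    = complex_partial i ((complex_partial i ^^ j) (\<lambda>z. c * log_kernel a k z)) z" by simp
  also have "\<dots> = complex_partial i (\<lambda>z. c * cnj (a $ i) ^ j * log_kernel a (k + j) z) z"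
    unfolding complex_partial_eq[of i] using Suc
    by (intro directional_deriv_cong[of "ball 0 1"]) (auto simp flip: complex_partial_eq)
  also have "\<dots> = c * cnj (a $ i) ^ j * cnj (a $ i) * log_kernel a (Suc (k + j)) z"
    by (rule complex_partial_log_kernel[OF a Suc.prems])
  finally show ?case by simp
qed simp

text \<open>\<open>P\<close> stands for the product of the powers of conj(a_i); since |a| < 1, the
  bound |P| <= 1 makes the estimate uniform in a.\<close>

lemma foldr_log_kernel:
  assumes a: "norm a < 1"
  shows "\<exists>P. norm P \<le> 1 \<and> (\<forall>z. norm z < 1 \<longrightarrow>
    foldr (\<lambda>i. complex_partial i ^^ m i) xs (\<lambda>z. c * log_kernel a 0 z) z
      = c * P * log_kernel a (sum_list (map m xs)) z)"
proof (induction xs)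
  case Nil
  show ?case by (intro exI[of _ 1]) simp
next
  case (Cons i xs)
  then obtain P where P: "norm P \<le> 1" "\<And>z. norm z < 1 \<Longrightarrow>
    foldr (\<lambda>i. complex_partial i ^^ m i) xs (\<lambda>z. c * log_kernel a 0 z) z
      = c * P * log_kernel a (sum_list (map m xs)) z" by blast
  have "norm (a $ i) \<le> 1" using Finite_Cartesian_Product.norm_nth_le[of a i] a by simp
  then have "norm (P * cnj (a $ i) ^ m i) \<le> 1"
    using P(1) by (simp add: norm_mult norm_power power_le_one mult_le_one)
  moreover have "foldr (\<lambda>i. complex_partial i ^^ m i) (i # xs) (\<lambda>z. c * log_kernel a 0 z) z
    = c * (P * cnj (a $ i) ^ m i) * log_kernel a (sum_list (map m (i # xs))) z" if z: "norm z < 1" for z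
  proof -
    have "foldr (\<lambda>i. complex_partial i ^^ m i) (i # xs) (\<lambda>z. c * log_kernel a 0 z) z
      = (complex_partial i ^^ m i) (foldr (\<lambda>i. complex_partial i ^^ m i) xs (\<lambda>z. c * log_kernel a 0 z)) z"
      by simp
    also have "\<dots> = (complex_partial i ^^ m i) (\<lambda>z. (c * P) * log_kernel a (sum_list (map m xs)) z) z"
      using P z by (intro complex_partial_funpow_cong[of "ball 0 1"]) auto
    also have "\<dots> = (c * P) * cnj (a $ i) ^ m i * log_kernel a (sum_list (map m xs) + m i) z"
      by (rule complex_partial_funpow_log_kernel[OF a z])
    finally show ?thesis by (simp add: mult.assoc add.commute)
  qed
  ultimately show ?case by blast
qed

lemma norm_partial_multi_log_kernel_le:
  fixes a :: "complex ^ 'n"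
  assumes a: "norm a < 1" and z: "norm z < 1"
  shows "norm (partial_multi m (\<lambda>z. c * log_kernel a 0 z) z) \<le> norm c * norm (log_kernel a (sum m UNIV) z)"
proof -
  obtain P where P: "norm P \<le> 1" "\<And>z. norm z < 1 \<Longrightarrow>
    foldr (\<lambda>i. complex_partial i ^^ m i) coordinates (\<lambda>z. c * log_kernel a 0 z) z
      = c * P * log_kernel a (sum_list (map m coordinates)) z" using foldr_log_kernel[OF a] by blast
  have "sum_list (map m coordinates) = sum m UNIV"
    using coordinates[where 'n = 'n] by (subst sum_list_distinct_conv_sum_set) auto
  then have "norm (partial_multi m (\<lambda>z. c * log_kernel a 0 z) z) = norm P * (norm c * norm (log_kernel a (sum m UNIV) z))"
    unfolding partial_multi_def P(2)[OF z] by (simp add: norm_mult mult_ac)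
  also have "\<dots> \<le> 1 * (norm c * norm (log_kernel a (sum m UNIV) z))"
    using P(1) by (intro mult_right_mono) auto
  finally show ?thesis by simp
qed

lemma weighted_partial_measurable:
  fixes f :: "complex ^ 'n \<Rightarrow> complex"
  assumes "holomorphic_several f (ball 0 1)"
  shows "continuous_on (ball 0 1) (weighted_partial N m f)"
    and "weighted_partial N m f \<in> borel_measurable tau_ball"
proof -
  have "holomorphic_several (partial_multi m f) (ball 0 1)"
    using assms by (rule holomorphic_several_partial_multi) simp
  then show c: "continuous_on (ball 0 1) (weighted_partial N m f)"
    unfolding weighted_partial_def by (intro continuous_intros holomorphic_several_continuous_on)
  have "sets (tau_ball :: (complex ^ 'n) measure) = sets (restrict_space borel (ball 0 1))"
    by (simp add: tau_ball_def volume_ball_def sets_restrict_space)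
  then show "weighted_partial N m f \<in> borel_measurable tau_ball"
    using borel_measurable_continuous_on_restrict[OF c] by (simp cong: measurable_cong_sets)
qed

definition test_fun :: "real \<Rightarrow> complex ^ 'n \<Rightarrow> complex ^ 'n \<Rightarrow> complex" where
  "test_fun p a z = of_real (ln (2 / (1 - (norm a)\<^sup>2)) powr (- 1 / p)) * log_kernel a 0 z"

lemma ennreal_powr_mono: "x \<le> y \<Longrightarrow> 0 < r \<Longrightarrow> ennreal_powr x r \<le> ennreal_powr y r"
  by (auto simp: ennreal_powr_def top_unique less_top intro!: ennreal_leI powr_mono2 enn2real_mono)

text \<open>The p-th power of the weighted N-th derivative of the kernel, integrated against
  \<open>tau_ball\<close>, is the Forelli-Rudin integral with \<alpha> = N p - n - 1. The condition
  N > n/p says \<alpha> > -1, and n + 1 + \<alpha> = N p is precisely the critical exponent. Hence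
  this integral is O(\<Lambda>), which the normalisation \<Lambda>^(-1/p) compensates.\<close>

lemma test_fun_besov:
  assumes p: "1 \<le> p" and N: "0 < N" and Np: "real N > real CARD('n) / p"
  shows "\<exists>C::real. \<forall>a :: complex ^ 'n. norm a < 1 \<longrightarrow> test_fun p a \<in> besov_space p \<and> besov_norm p N (test_fun p a) \<le> ennreal C"
proof -
  define n where "n = CARD('n)"
  define \<alpha> where "\<alpha> = real N * p - real n - 1"
  have "real n < real N * p" using Np p by (simp add: n_def pos_divide_less_eq)
  then have \<alpha>: "-1 < \<alpha>" and \<alpha>n: "real n + 1 + \<alpha> = real N * p" by (simp_all add: \<alpha>_def)
  obtain C0 where C0: "C0 > 0" and FR: "\<And>a :: complex ^ 'n. norm a < 1 \<Longrightarrow>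
    (\<integral>\<^sup>+z\<in>ball 0 1. ennreal ((1 - (norm z)\<^sup>2) powr \<alpha> * norm (1 - cinner z a) powr (- (real N * p))) \<partial>lborel)
      \<le> ennreal (C0 * ln (2 / (1 - (norm a)\<^sup>2)))"
    using Forelli_Rudin_log[where ?'n = 'n, OF \<alpha>] unfolding n_def[symmetric] \<alpha>n by blast
  define v where "v = unit_ball_vol (real DIM(complex ^ 'n))"
  have v: "v > 0" by (simp add: v_def)
  have vol: "emeasure lborel (ball (0 :: complex ^ 'n) 1) = ennreal v"
    by (simp add: emeasure_ball v_def)
  define D where "D = (fact N powr p * C0 / v) powr (1 / p)"
  define C where "C = (\<Sum>m :: 'n \<Rightarrow> nat | sum m UNIV \<le> N - 1. ln 2 powr (- 1 / p) * fact N) + (\<Sum>m :: 'n \<Rightarrow> nat | sum m UNIV = N. D)"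
  have D: "D \<ge> 0" by (simp add: D_def)
  have main: "test_fun p a \<in> besov_space p \<and> besov_norm p N (test_fun p a) \<le> ennreal C" if a: "norm a < 1" for a :: "complex ^ 'n"
  proof -
    define \<Lambda> where "\<Lambda> = ln (2 / (1 - (norm a)\<^sup>2))"
    have \<Lambda>: "ln 2 \<le> \<Lambda>" unfolding \<Lambda>_def by (rule log_weight_ge[OF a])
    have l2: "0 < ln (2 :: real)" by simp
    have \<Lambda>0: "\<Lambda> > 0" using \<Lambda> l2 by linarith
    define c where "c = complex_of_real (\<Lambda> powr (- 1 / p))"
    have nc: "norm c = \<Lambda> powr (- 1 / p)" by (simp add: c_def)
    have t: "test_fun p a = (\<lambda>z. c * log_kernel a 0 z)" by (simp add: test_fun_def c_def \<Lambda>_def fun_eq_iff)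
    have hol: "holomorphic_several (test_fun p a) (ball 0 1)" unfolding t by (rule log_kernel_holomorphic[OF a])
    have Lp: "Lp_norm p tau_ball (weighted_partial N m (test_fun p a)) \<le> ennreal D" if m: "sum m UNIV = N" for m
    proof -
      have "(\<integral>\<^sup>+z. ennreal (norm (weighted_partial N m (test_fun p a) z) powr p) \<partial>tau_ball)
        = (\<integral>\<^sup>+w\<in>ball 0 1. ennreal (norm (weighted_partial N m (test_fun p a) w) powr p)
             * ennreal (1 / (1 - (norm w)\<^sup>2) ^ (CARD('n) + 1)) \<partial>lborel) / ennreal v"
        unfolding vol[symmetric]
        by (rule nn_integral_tau_ball) (rule borel_measurable_powr_norm_indicator[OF weighted_partial_measurable(1)[OF hol]])
      also have "\<dots> \<le> (\<integral>\<^sup>+w. ennreal (fact N powr p / \<Lambda>) * (ennreal ((1 - (norm w)\<^sup>2) powr \<alpha> * norm (1 - cinner w a) powr (- (real N * p))) * indicator (ball 0 1) w) \<partial>lborel) / ennreal v"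
      proof (intro divide_right_mono_ennreal nn_integral_mono)
        fix w :: "complex ^ 'n"
        show "ennreal (norm (weighted_partial N m (test_fun p a) w) powr p)
             * ennreal (1 / (1 - (norm w)\<^sup>2) ^ (CARD('n) + 1)) * indicator (ball 0 1) w \<le>
           ennreal (fact N powr p / \<Lambda>) * (ennreal ((1 - (norm w)\<^sup>2) powr \<alpha> * norm (1 - cinner w a) powr (- (real N * p))) * indicator (ball 0 1) w)"
        proof (cases "norm w < 1")
          case True
          define x y where "x = 1 - (norm w)\<^sup>2" and "y = norm (1 - cinner w a)"
          have x: "x > 0" using one_minus_norm_square(1)[OF True] by (simp add: x_def)
          have y: "y > 0" using cinner_ne_1[OF a True] by (simp add: y_def)
          obtain M where M: "N = Suc M" using N by (cases N) auto
          have "norm (log_kernel a N w) = fact M / y ^ N"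
            by (simp add: M y_def norm_divide norm_mult norm_power)
          also have "\<dots> \<le> fact N / y ^ N" using y unfolding M by (intro divide_right_mono fact_mono) auto
          finally have "\<Lambda> powr (- 1 / p) * norm (log_kernel a N w) \<le> \<Lambda> powr (- 1 / p) * (fact N / y ^ N)"
            by (intro mult_left_mono) auto
          then have "norm (partial_multi m (test_fun p a) w) \<le> \<Lambda> powr (- 1 / p) * (fact N / y ^ N)"
            using norm_partial_multi_log_kernel_le[OF a True, of m c] unfolding m t nc by (rule order_trans[rotated])
          then have "x ^ N * norm (partial_multi m (test_fun p a) w) \<le> x ^ N * (\<Lambda> powr (- 1 / p) * (fact N / y ^ N))"
            using x by (intro mult_left_mono) auto
          moreover have "norm (weighted_partial N m (test_fun p a) w) = x ^ N * norm (partial_multi m (test_fun p a) w)"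
            using x unfolding weighted_partial_def x_def[symmetric] by (simp add: norm_mult norm_power)
          ultimately have "norm (weighted_partial N m (test_fun p a) w) powr p \<le> (x ^ N * (\<Lambda> powr (- 1 / p) * (fact N / y ^ N))) powr p"
            using p x by (intro powr_mono2) auto
          also have "\<dots> = (x ^ N) powr p * ((\<Lambda> powr (- 1 / p)) powr p * (fact N powr p / (y ^ N) powr p))"
            using y by (simp add: powr_mult powr_divide)
          also have "(\<Lambda> powr (- 1 / p)) powr p = 1 / \<Lambda>"
            unfolding powr_powr using p \<Lambda>0 by (simp add: powr_minus divide_inverse)
          also have "(x ^ N) powr p = x powr (real N * p)" using x by (simp add: powr_powr flip: powr_realpow)
          also have "(y ^ N) powr p = y powr (real N * p)" using y by (simp add: powr_powr flip: powr_realpow)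
          finally have "norm (weighted_partial N m (test_fun p a) w) powr p * (1 / x ^ (n + 1))
            \<le> x powr (real N * p) * (1 / \<Lambda> * (fact N powr p / y powr (real N * p))) * (1 / x ^ (n + 1))"
            using x by (intro mult_right_mono) auto
          also have "\<dots> = fact N powr p / \<Lambda> * (x powr \<alpha> * y powr (- (real N * p)))"
          proof -
            have "x powr \<alpha> = x powr (real N * p) / x ^ (n + 1)"
            proof -
              have "x ^ (n + 1) = x powr (real n + 1)" using x powr_realpow[of x "n + 1"] by (simp add: add.commute)
              moreover have "\<alpha> = real N * p - (real n + 1)" by (simp add: \<alpha>_def)
              ultimately show ?thesis by (simp only: powr_diff)
            qed
            then show ?thesis by (simp add: powr_minus divide_inverse mult_ac)
          qed
          finally have "ennreal (norm (weighted_partial N m (test_fun p a) w) powr p * (1 / x ^ (n + 1)))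
             \<le> ennreal (fact N powr p / \<Lambda> * (x powr \<alpha> * y powr (- (real N * p))))" by (rule ennreal_leI)
          then show ?thesis using True x \<Lambda>0 unfolding x_def[symmetric] y_def[symmetric] n_def[symmetric]
            by (simp add: ennreal_mult'[symmetric])
        qed simp
      qed
      also have "\<dots> = (ennreal (fact N powr p / \<Lambda>) * (\<integral>\<^sup>+w\<in>ball 0 1. ennreal ((1 - (norm w)\<^sup>2) powr \<alpha> * norm (1 - cinner w a) powr (- (real N * p))) \<partial>lborel)) / ennreal v"
        by (subst nn_integral_cmult) (auto intro!: borel_measurable_indicator borel_measurable_times_ennreal)
      also have "\<dots> \<le> (ennreal (fact N powr p / \<Lambda>) * ennreal (C0 * \<Lambda>)) / ennreal v"
        unfolding \<Lambda>_def by (intro divide_right_mono_ennreal mult_left_mono FR a) auto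
      also have "\<dots> = ennreal (fact N powr p * C0 / v)"
        using \<Lambda>0 C0 v by (simp add: ennreal_mult'[symmetric] divide_ennreal)
      finally have "Lp_norm p tau_ball (weighted_partial N m (test_fun p a)) \<le> ennreal_powr (ennreal (fact N powr p * C0 / v)) (1 / p)"
        unfolding Lp_norm_def using p by (intro ennreal_powr_mono) auto
      also have "\<dots> = ennreal D" using C0 v by (simp add: ennreal_powr_def D_def)
      finally show ?thesis .
    qed
    have "test_fun p a \<in> besov_space p"
      unfolding besov_space_def mem_Collect_eq
    proof (intro conjI hol exI[of _ N] N Np allI impI)
      fix m :: "'n \<Rightarrow> nat" assume "sum m UNIV = N"
      from Lp[OF this] show "in_Lp p tau_ball (weighted_partial N m (test_fun p a))"
        unfolding in_Lp_def using weighted_partial_measurable(2)[OF hol] by (auto intro: le_less_trans)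
    qed
    moreover have "besov_norm p N (test_fun p a) \<le> (\<Sum>m :: 'n \<Rightarrow> nat | sum m UNIV \<le> N - 1. ennreal (ln 2 powr (- 1 / p) * fact N)) + (\<Sum>m :: 'n \<Rightarrow> nat | sum m UNIV = N. ennreal D)"
      unfolding besov_norm_def
    proof (intro add_mono sum_mono)
      fix m :: "'n \<Rightarrow> nat" assume "m \<in> {m. sum m UNIV \<le> N - 1}"
      then have m: "sum m UNIV \<le> N" by simp
      have "norm (log_kernel a (sum m UNIV) 0) \<le> fact N"
      proof (cases "sum m UNIV")
        case 0
        have "ln 2 \<le> (1 :: real)" using ln_2_less_1 by simp
        also have "(1 :: real) \<le> fact N" by (rule fact_ge_1)
        finally show ?thesis using 0 by (simp add: cinner_def)
      next
        case (Suc k)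
        then have "(fact k :: real) \<le> fact N" using m by (intro fact_mono) auto
        then show ?thesis using Suc by (simp add: cinner_def)
      qed
      moreover have "\<Lambda> powr (- 1 / p) \<le> ln 2 powr (- 1 / p)" using \<Lambda> p by (intro powr_mono2') auto
      ultimately have "norm c * norm (log_kernel a (sum m UNIV) 0) \<le> ln 2 powr (- 1 / p) * fact N"
        unfolding nc by (intro mult_mono) auto
      then show "ennreal (norm (partial_multi m (test_fun p a) 0)) \<le> ennreal (ln 2 powr (- 1 / p) * fact N)"
        using norm_partial_multi_log_kernel_le[OF a, of 0 m c] unfolding t by (intro ennreal_leI) auto
    qed (use Lp in auto)
    moreover have "(\<Sum>m :: 'n \<Rightarrow> nat | sum m UNIV \<le> N - 1. ennreal (ln 2 powr (- 1 / p) * fact N)) + (\<Sum>m :: 'n \<Rightarrow> nat | sum m UNIV = N. ennreal D) = ennreal C"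
      unfolding C_def using D by (subst (1 2) sum_ennreal) (auto simp: sum_nonneg)
    ultimately show ?thesis by simp
  qed
  then show ?thesis by blast
qed

section \<open>Geometry of Bergman balls\<close>

lemma norm_ball_involution_less_1:
  fixes a z :: "complex ^ 'n"
  assumes "norm a < 1" "norm z < 1"
  shows "norm (ball_involution a z) < 1"
  using bij_betwE[OF ball_involution_bij[OF assms(1)]] assms(2) by simp

text \<open>The polarised form of \<open>ball_involution_norm\<close>, which is its diagonal case;
  the off-diagonal values enter when images of two points under the same automorphism are
  compared.\<close>

lemma cinner_ball_involution:
  fixes a w u :: "complex ^ 'n"
  assumes a: "norm a < 1" and w: "norm w < 1" and u: "norm u < 1"
  shows "(1 - cinner (ball_involution a w) (ball_involution a u)) * ((1 - cinner w a) * (1 - cinner a u))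
    = of_real (1 - (norm a)\<^sup>2) * (1 - cinner w u)"
proof -
  define s k where "s = sqrt (1 - (norm a)\<^sup>2)" and "k = 1 / complex_of_real (1 + s)"
  define c d where "c = cinner w a" and "d = cinner a u"
  have "(norm a)\<^sup>2 < 1" using a by (simp add: abs_square_less_1)
  then have s2: "s\<^sup>2 = 1 - (norm a)\<^sup>2" and s0: "s > 0" unfolding s_def by auto
  then have "complex_of_real (1 + s) \<noteq> 0" by (metis add_pos_pos less_irrefl of_real_eq_0_iff zero_less_one)
  then have k: "k * (1 + of_real s) = 1" "cnj k = k" unfolding k_def by simp_all
  have A: "cinner a a = 1 - (of_real s)\<^sup>2"
    using arg_cong[OF s2, of complex_of_real] by (simp add: cinner_self)
  have kA: "k * cinner a a = 1 - of_real s"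
  proof -
    have "k * cinner a a = (k * (1 + of_real s)) * (1 - of_real s)"
      unfolding A by (simp add: algebra_simps power2_eq_square)
    then show ?thesis using k by simp
  qed
  have phi: "ball_involution a x = (1 / (1 - cinner x a)) *s ((1 - cinner x a * k) *s a - of_real s *s x)" for x
    unfolding ball_involution_eq[OF a s_def] k_def by simp
  have c1: "1 - c \<noteq> 0" "1 - d \<noteq> 0"
    using cinner_ne_1[OF a w] cinner_ne_1[OF u a] by (simp_all add: c_def d_def)
  have d: "cnj (cinner u a) = d" unfolding d_def by (rule cinner_commute[symmetric])
  have "cinner (ball_involution a w) (ball_involution a u) * ((1 - c) * (1 - d)) =
    cinner ((1 - c * k) *s a - of_real s *s w) ((1 - cinner u a * k) *s a - of_real s *s u)"
    (is "_ = ?Z")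
  proof -
    have "cinner (ball_involution a w) (ball_involution a u) = 1 / (1 - c) * (cnj (1 / (1 - cinner u a)) * ?Z)"
      unfolding phi cinner_linear_left(2) cinner_linear_right(2) c_def by (rule mult.left_commute)
    also have "cnj (1 / (1 - cinner u a)) = 1 / (1 - d)" using d by simp
    finally show ?thesis using c1 by simp
  qed
  also have "\<dots> = (1 - c * k) * (1 - d * k) * cinner a a - of_real s * (1 - c * k) * d
      - of_real s * (1 - d * k) * c + (of_real s)\<^sup>2 * cinner w u"
    unfolding cinner_linear_left cinner_linear_right complex_cnj_diff complex_cnj_mult d k(2)
      complex_cnj_one complex_cnj_complex_of_real c_def[symmetric] d_def[symmetric]
    by (simp add: power2_eq_square algebra_simps)
  also have "\<dots> = cinner a a - (c + d) * (k * cinner a a + of_real s)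
      + c * d * (k * (k * cinner a a + 2 * of_real s)) + (of_real s)\<^sup>2 * cinner w u"
    by (simp add: algebra_simps)
  also have "k * (k * cinner a a + 2 * of_real s) = 1"
    unfolding kA using k(1) by (simp add: algebra_simps)
  also have "k * cinner a a + of_real s = 1" unfolding kA by simp
  finally have "(1 - cinner (ball_involution a w) (ball_involution a u)) * ((1 - c) * (1 - d))
    = (1 - c) * (1 - d) - (cinner a a - (c + d) + c * d + (of_real s)\<^sup>2 * cinner w u)"
    by (simp add: left_diff_distrib)
  also have "\<dots> = (of_real s)\<^sup>2 * (1 - cinner w u)" unfolding A by (simp add: algebra_simps)
  also have "(complex_of_real s)\<^sup>2 = of_real (1 - (norm a)\<^sup>2)" unfolding s2[symmetric] by simp
  finally show ?thesis by (simp add: c_def d_def)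
qed

text \<open>Invariance of the pseudo-hyperbolic distance. In terms of 1 - |\<phi>|^2 both sides are
  explicit quotients in which every factor involving a cancels. Comparing norms avoids determining
  the unitary map by which the two automorphisms differ.\<close>

lemma norm_ball_involution_invariant:
  fixes a w u :: "complex ^ 'n"
  assumes a: "norm a < 1" and w: "norm w < 1" and u: "norm u < 1"
  shows "norm (ball_involution (ball_involution a u) (ball_involution a w)) = norm (ball_involution u w)"
proof -
  define xa xw xu where "xa = 1 - (norm a)\<^sup>2" and "xw = 1 - (norm w)\<^sup>2" and "xu = 1 - (norm u)\<^sup>2"
  define p q r where "p = norm (1 - cinner w a)" and "q = norm (1 - cinner u a)" and "r = norm (1 - cinner w u)"
  have x: "xa > 0" using one_minus_norm_square(1)[OF a] by (simp add: xa_def)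
  have pqr: "p > 0" "q > 0" "r > 0"
    using cinner_ne_1[OF a w] cinner_ne_1[OF a u] cinner_ne_1[OF u w] by (auto simp: p_def q_def r_def)
  have q': "norm (1 - cinner a u) = q"
    unfolding q_def by (subst cinner_commute) (metis complex_cnj_diff complex_cnj_one complex_mod_cnj)
  define m where "m = norm (1 - cinner (ball_involution a w) (ball_involution a u))"
  have "m * (p * q) = xa * r"
    using arg_cong[OF cinner_ball_involution[OF a w u], of norm] x
    unfolding norm_mult norm_of_real q' p_def[symmetric] r_def[symmetric] m_def[symmetric] xa_def[symmetric]
    by simp
  then have m: "m = xa * r / (p * q)" using pqr by (simp add: field_simps)
  note ia = norm_ball_involution_less_1[OF a w] norm_ball_involution_less_1[OF a u]
  have "1 - (norm (ball_involution (ball_involution a u) (ball_involution a w)))\<^sup>2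
    = (xa * xu / q\<^sup>2) * (xa * xw / p\<^sup>2) / m\<^sup>2"
    unfolding ball_involution_norm[OF ia(2) ia(1)] ball_involution_norm[OF a w] ball_involution_norm[OF a u]
      xa_def xw_def xu_def p_def q_def m_def ..
  also have "\<dots> = xu * xw / r\<^sup>2" unfolding m using x pqr by (simp add: field_simps power2_eq_square)
  also have "\<dots> = 1 - (norm (ball_involution u w))\<^sup>2"
    unfolding ball_involution_norm[OF u w] xu_def xw_def r_def ..
  finally show ?thesis by simp
qed

lemma tanh_artanh:
  fixes x :: real
  assumes "\<bar>x\<bar> < 1"
  shows "tanh (artanh x) = x"
proof -
  have x: "0 < 1 + x" "0 < 1 - x" using assms by auto
  have "exp (- 2 * artanh x) = inverse (exp (ln ((1 + x) / (1 - x))))"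
    by (simp add: artanh_def exp_minus)
  also have "\<dots> = (1 - x) / (1 + x)" using x by (simp add: field_simps)
  finally have e: "exp (- 2 * artanh x) = (1 - x) / (1 + x)" .
  have "1 - (1 - x) / (1 + x) = 2 * x / (1 + x)" "1 + (1 - x) / (1 + x) = 2 / (1 + x)"
    using x by (simp_all add: field_simps)
  then show ?thesis unfolding tanh_real_altdef e using x by simp
qed

lemma mem_bergman_ball_iff_norm:
  fixes a w :: "complex ^ 'n"
  assumes a: "norm a < 1" and w: "norm w < 1"
  shows "w \<in> bergman_ball a R \<longleftrightarrow> norm (ball_involution a w) < tanh R"
proof -
  define x where "x = norm (ball_involution a w)"
  have x: "\<bar>x\<bar> < 1" using norm_ball_involution_less_1[OF a w] by (simp add: x_def)
  have "bergman_dist a w = artanh x" by (simp add: bergman_dist_def artanh_def x_def)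
  then have "w \<in> bergman_ball a R \<longleftrightarrow> artanh x < R" using w by (simp add: bergman_ball_def)
  also have "\<dots> \<longleftrightarrow> tanh (artanh x) < tanh R" by (rule tanh_real_less_iff[symmetric])
  also have "tanh (artanh x) = x" by (rule tanh_artanh[OF x])
  finally show ?thesis by (simp add: x_def)
qed

definition sech_sq :: "real \<Rightarrow> real" where
  "sech_sq R = 1 - (tanh R)\<^sup>2"

lemma sech_sq: "0 < sech_sq R" "sech_sq R \<le> 1"
  using tanh_real_bounds[of R] by (auto simp: sech_sq_def abs_square_less_1)

text \<open>Clearing the denominator in 1 - |\<phi>_a(w)|^2 > 1 - tanh^2 R describes Bergman balls
  by an explicit inequality free of the logarithm, from which openness and all comparability
  statements are derived.\<close>

lemma mem_bergman_ball_iff: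
  fixes a w :: "complex ^ 'n"
  assumes a: "norm a < 1" and R: "0 < R"
  shows "w \<in> bergman_ball a R \<longleftrightarrow> norm w < 1 \<and>
    sech_sq R * (norm (1 - cinner w a))\<^sup>2 < (1 - (norm a)\<^sup>2) * (1 - (norm w)\<^sup>2)"
proof (cases "norm w < 1")
  case True
  have "tanh R > 0" using R by simp
  then have "w \<in> bergman_ball a R \<longleftrightarrow> (norm (ball_involution a w))\<^sup>2 < (tanh R)\<^sup>2"
    unfolding mem_bergman_ball_iff_norm[OF a True]
    using power2_less_imp_less[of "norm (ball_involution a w)" "tanh R"]
      power_strict_mono[of "norm (ball_involution a w)" "tanh R" 2] by auto
  also have "\<dots> \<longleftrightarrow> sech_sq R < 1 - (norm (ball_involution a w))\<^sup>2"
    by (auto simp: sech_sq_def)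
  also have "\<dots> \<longleftrightarrow> sech_sq R * (norm (1 - cinner w a))\<^sup>2 < (1 - (norm a)\<^sup>2) * (1 - (norm w)\<^sup>2)"
    unfolding ball_involution_norm[OF a True] using cinner_ne_1[OF a True] by (simp add: pos_less_divide_eq)
  finally show ?thesis using True by simp
qed (simp add: bergman_ball_def)

lemma open_bergman_ball:
  fixes a :: "complex ^ 'n"
  assumes "norm a < 1" "0 < R"
  shows "open (bergman_ball a R)"
proof -
  have "bergman_ball a R = {w. norm w < 1 \<and>
    sech_sq R * (norm (1 - cinner w a))\<^sup>2 < (1 - (norm a)\<^sup>2) * (1 - (norm w)\<^sup>2)}"
    using mem_bergman_ball_iff[OF assms] by blast
  then show ?thesis
    by (simp only:) (intro open_Collect_conj open_Collect_less continuous_intros)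
qed

text \<open>With x, y for the two defects and d = |1 - <w,a>|, membership says \<kappa> d^2 < x y,
  while d dominates both x/2 and y/2. Inserting either bound cancels one factor and compares x with
  y up to 4/\<kappa>; inserting the result back gives \<kappa>^2 d^2 <= 4 x^2.\<close>

lemma bergman_ball_comparable:
  fixes a w :: "complex ^ 'n"
  assumes a: "norm a < 1" and R: "0 < R" and w: "w \<in> bergman_ball a R"
  shows "1 - (norm w)\<^sup>2 \<le> 4 / sech_sq R * (1 - (norm a)\<^sup>2)"
    and "1 - (norm a)\<^sup>2 \<le> 4 / sech_sq R * (1 - (norm w)\<^sup>2)"
    and "norm (1 - cinner w a) \<le> 2 / sech_sq R * (1 - (norm a)\<^sup>2)"
proof -
  define x y d \<kappa> where "x = 1 - (norm a)\<^sup>2" and "y = 1 - (norm w)\<^sup>2" and "d = norm (1 - cinner w a)" and "\<kappa> = sech_sq R"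
  have w1: "norm w < 1" and lt: "\<kappa> * d\<^sup>2 < x * y"
    using w unfolding mem_bergman_ball_iff[OF a R] by (auto simp: x_def y_def d_def \<kappa>_def)
  have xy: "x > 0" "y > 0" using one_minus_norm_square(1) a w1 by (auto simp: x_def y_def)
  have \<kappa>: "\<kappa> > 0" "\<kappa> \<le> 1" using sech_sq by (auto simp: \<kappa>_def)
  have xd: "x / 2 \<le> d" "y / 2 \<le> d"
    using one_minus_cinner_ge[OF a w1] one_minus_norm_square(4)[OF a] one_minus_norm_square(4)[OF w1]
    by (auto simp: x_def y_def d_def)
  have "\<kappa> * (y / 2)\<^sup>2 \<le> \<kappa> * d\<^sup>2" using xd xy \<kappa> by (intro mult_left_mono power_mono) auto
  then have "\<kappa> * (y / 2)\<^sup>2 < x * y" using lt by simp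
  then have "(\<kappa> * y) * y < (4 * x) * y" by (simp add: power2_eq_square field_simps)
  then have yx: "\<kappa> * y < 4 * x" using xy by (simp only: mult_less_cancel_right_pos)
  have "\<kappa> * (x / 2)\<^sup>2 \<le> \<kappa> * d\<^sup>2" using xd xy \<kappa> by (intro mult_left_mono power_mono) auto
  then have "\<kappa> * (x / 2)\<^sup>2 < x * y" using lt by simp
  then have "(\<kappa> * x) * x < (4 * y) * x" by (simp add: power2_eq_square field_simps)
  then have xy': "\<kappa> * x < 4 * y" using xy by (simp only: mult_less_cancel_right_pos)
  have "(\<kappa> * d)\<^sup>2 = \<kappa> * (\<kappa> * d\<^sup>2)" by (simp add: power2_eq_square)
  also have "\<dots> \<le> \<kappa> * (x * y)" using lt \<kappa> by simp
  also have "\<dots> = x * (\<kappa> * y)" by simp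
  also have "\<dots> \<le> x * (4 * x)" using yx xy by (intro mult_left_mono) auto
  also have "\<dots> = (2 * x)\<^sup>2" by (simp add: power2_eq_square)
  finally have "\<kappa> * d \<le> 2 * x" by (rule power2_le_imp_le) (use xy in simp)
  with yx xy' \<kappa> show "1 - (norm w)\<^sup>2 \<le> 4 / sech_sq R * (1 - (norm a)\<^sup>2)"
    "1 - (norm a)\<^sup>2 \<le> 4 / sech_sq R * (1 - (norm w)\<^sup>2)"
    "norm (1 - cinner w a) \<le> 2 / sech_sq R * (1 - (norm a)\<^sup>2)"
    by (simp_all add: x_def[symmetric] y_def[symmetric] d_def[symmetric] \<kappa>_def[symmetric] pos_le_divide_eq mult.commute)
qed

text \<open>The automorphism \<open>\<phi>\<^sub>a\<close> maps the ball around \<open>a\<close> to the ball around \<open>0\<close>, so that a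
  finite cover of the latter is transported to covers whose cardinality does not depend on \<open>a\<close>.\<close>

lemma bergman_ball_covering:
  assumes R: "0 < R"
  shows "\<exists>U :: (complex ^ 'n) set. finite U \<and> (\<forall>a u. norm a < 1 \<longrightarrow> u \<in> U \<longrightarrow>
      norm (ball_involution a u) < 1 \<and> ball_involution a u \<in> bergman_ball a (R\<^sub>0 + 1)) \<and>
    (\<forall>a. norm a < 1 \<longrightarrow> bergman_ball a R\<^sub>0 \<subseteq> (\<Union>u\<in>U. bergman_ball (ball_involution a u) R))"
proof -
  define K where "K = cball (0 :: complex ^ 'n) (tanh R\<^sub>0)"
  have K1: "norm u < 1" if "u \<in> K" for u using that tanh_real_lt_1[of R\<^sub>0] by (simp add: K_def)
  have self: "u \<in> bergman_ball u R" if "u \<in> K" for u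
    using mem_bergman_ball_iff_norm[of u u R] K1[OF that] R by (simp add: ball_involution_self)
  have "K \<subseteq> (\<Union>u\<in>K. bergman_ball u R)" using self by blast
  then obtain U where U: "U \<subseteq> K" "finite U" "K \<subseteq> (\<Union>u\<in>U. bergman_ball u R)"
    using compactE_image[of K K "\<lambda>u. bergman_ball u R"] open_bergman_ball K1 R
    by (metis K_def compact_cball)
  have "norm (ball_involution a u) < 1 \<and> ball_involution a u \<in> bergman_ball a (R\<^sub>0 + 1)"
    if a: "norm a < 1" and "u \<in> U" for a u
  proof -
    have u: "u \<in> K" using U that by blast
    note n1 = norm_ball_involution_less_1[OF a K1[OF u]]
    \<comment> \<open>A point \<open>u\<close> may lie on the boundary sphere of the compact set
      \<open>K\<close>, so the transported centres are located in a strictly larger Bergman ball;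
      the increment 1 is arbitrary.\<close>
    have "tanh R\<^sub>0 < tanh (R\<^sub>0 + 1)" by simp
    then have "norm u < tanh (R\<^sub>0 + 1)" using u unfolding K_def mem_cball_0 by linarith
    then show ?thesis using n1 mem_bergman_ball_iff_norm[OF a n1]
      by (simp add: ball_involution_involutive[OF a K1[OF u]])
  qed
  moreover have "bergman_ball a R\<^sub>0 \<subseteq> (\<Union>u\<in>U. bergman_ball (ball_involution a u) R)" if a: "norm a < 1" for a
  proof
    fix w assume w: "w \<in> bergman_ball a R\<^sub>0"
    then have w1: "norm w < 1" by (simp add: bergman_ball_def)
    define w' where "w' = ball_involution a w"
    have w'1: "norm w' < 1" unfolding w'_def by (rule norm_ball_involution_less_1[OF a w1])
    have ww: "ball_involution a w' = w" unfolding w'_def by (rule ball_involution_involutive[OF a w1])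
    have "w' \<in> K" using w mem_bergman_ball_iff_norm[OF a w1] by (simp add: K_def w'_def)
    then obtain u where u: "u \<in> U" "w' \<in> bergman_ball u R" using U by blast
    have u1: "norm u < 1" using u U K1 by blast
    have "norm (ball_involution (ball_involution a u) w) < tanh R"
      using u(2) norm_ball_involution_invariant[OF a w'1 u1] unfolding ww mem_bergman_ball_iff_norm[OF u1 w'1] by simp
    then have "w \<in> bergman_ball (ball_involution a u) R"
      using mem_bergman_ball_iff_norm[OF norm_ball_involution_less_1[OF a u1] w1] by simp
    with u show "w \<in> (\<Union>u\<in>U. bergman_ball (ball_involution a u) R)" by blast
  qed
  ultimately show ?thesis using U by blast
qed

text \<open>Comparability keeps 1 - |w|^2 away from 0 when |a| stays away from 1. Together with
  finiteness of the measure on compact sets this controls all centres that are not close to the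
  sphere.\<close>

lemma bergman_balls_in_cball:
  assumes R: "0 < R" and r: "0 \<le> r" "r < 1"
  shows "\<exists>\<rho><1. \<forall>a :: complex ^ 'n. norm a \<le> r \<longrightarrow> bergman_ball a R \<subseteq> cball 0 \<rho>"
proof -
  define c where "c = sech_sq R / 4 * (1 - r\<^sup>2)"
  have r2: "r\<^sup>2 < 1" using r by (simp add: abs_square_less_1)
  have c: "0 < c" using sech_sq(1)[of R] r2 by (simp add: c_def)
  have "bergman_ball a R \<subseteq> cball 0 (sqrt (1 - c))" if "norm a \<le> r" for a :: "complex ^ 'n"
  proof
    fix w assume w: "w \<in> bergman_ball a R"
    have a: "norm a < 1" using that r by simp
    have "(norm a)\<^sup>2 \<le> r\<^sup>2" using that by (intro power_mono) auto
    then have "c \<le> sech_sq R / 4 * (1 - (norm a)\<^sup>2)"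
      unfolding c_def using sech_sq(1)[of R] by (intro mult_left_mono) auto
    also have "\<dots> \<le> 1 - (norm w)\<^sup>2"
      using bergman_ball_comparable(2)[OF a R w] sech_sq(1)[of R] by (simp add: field_simps)
    finally have "(norm w)\<^sup>2 \<le> 1 - c" by simp
    then have "norm w \<le> sqrt (1 - c)" by (rule real_le_rsqrt)
    then show "w \<in> cball 0 (sqrt (1 - c))" by simp
  qed
  moreover have "sqrt (1 - c) < 1" using c by simp
  ultimately show ?thesis by blast
qed

section \<open>Comparability of the logarithmic weights\<close>

lemma powr_comparable:
  fixes x y K s :: real
  assumes "0 < x" "0 < y" "x \<le> K * y" "y \<le> K * x"
  shows "x powr s \<le> K powr \<bar>s\<bar> * y powr s"
proof (cases "s \<ge> 0")
  case True
  then have "x powr s \<le> (K * y) powr s" using assms by (intro powr_mono2) auto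
  then show ?thesis using True by (simp add: powr_mult)
next
  case False
  have K: "K > 0" using assms by (smt (verit) mult_nonpos_nonneg)
  have "y / K \<le> x" using assms K by (simp add: pos_divide_le_eq mult.commute)
  then have "x powr s \<le> (y / K) powr s" using assms K False by (intro powr_mono2') auto
  also have "\<dots> = K powr \<bar>s\<bar> * y powr s" using False by (simp add: powr_divide powr_minus_divide)
  finally show ?thesis .
qed

text \<open>A factor K in the argument adds ln K to the logarithm. Since y <= 1 gives ln (2/y) >= ln
  2, this summand can be absorbed into a multiplicative constant; here the 2 inside the logarithm is
  essential.\<close>

lemma log_comparable:
  fixes x y K :: real
  assumes "0 < x" "0 < y" "y \<le> 1" "y \<le> K * x" "1 \<le> K"
  shows "ln (2 / x) \<le> (1 + ln K / ln 2) * ln (2 / y)"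
proof -
  have "2 / x \<le> K * (2 / y)" using assms(1,2,4) by (simp add: field_simps)
  then have "ln (2 / x) \<le> ln (K * (2 / y))" using assms(1,2,5) by (subst ln_le_cancel_iff) auto
  also have "\<dots> = ln K + ln (2 / y)" using assms(2,5) by (intro ln_mult_pos) auto
  also have "ln K \<le> ln K / ln 2 * ln (2 / y)"
  proof -
    have "ln 2 \<le> ln (2 / y)" using assms(2,3) by (subst ln_le_cancel_iff) (auto simp: field_simps)
    then have "ln K / ln 2 * ln 2 \<le> ln K / ln 2 * ln (2 / y)" using assms(5) by (intro mult_left_mono) auto
    then show ?thesis by simp
  qed
  finally show ?thesis by (simp add: algebra_simps)
qed

definition log_weight :: "real \<Rightarrow> real \<Rightarrow> complex ^ 'n \<Rightarrow> real" where
  "log_weight s u a = (1 - (norm a)\<^sup>2) powr s * ln (2 / (1 - (norm a)\<^sup>2)) powr u"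

lemma log_pos: "norm (a :: complex ^ 'n) < 1 \<Longrightarrow> 0 < ln (2 / (1 - (norm a)\<^sup>2))"
proof -
  assume "norm a < 1"
  then have "ln 2 \<le> ln (2 / (1 - (norm a)\<^sup>2))" by (rule log_weight_ge)
  moreover have "0 < ln (2 :: real)" by simp
  ultimately show ?thesis by linarith
qed

lemma log_weight_pos: "norm a < 1 \<Longrightarrow> 0 < log_weight s u a"
  using one_minus_norm_square(1)[of a] log_pos[of a] by (simp add: log_weight_def)

lemma log_weight_comparable:
  fixes a b :: "complex ^ 'n"
  assumes a: "norm a < 1" and b: "norm b < 1" and K: "1 \<le> K"
    and "1 - (norm a)\<^sup>2 \<le> K * (1 - (norm b)\<^sup>2)" "1 - (norm b)\<^sup>2 \<le> K * (1 - (norm a)\<^sup>2)"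
  shows "log_weight s u a \<le> K powr \<bar>s\<bar> * (1 + ln K / ln 2) powr \<bar>u\<bar> * log_weight s u b"
proof -
  note xa = one_minus_norm_square[OF a] and xb = one_minus_norm_square[OF b]
  have "(1 - (norm a)\<^sup>2) powr s \<le> K powr \<bar>s\<bar> * (1 - (norm b)\<^sup>2) powr s"
    using assms xa xb by (intro powr_comparable) auto
  moreover have "ln (2 / (1 - (norm a)\<^sup>2)) powr u \<le> (1 + ln K / ln 2) powr \<bar>u\<bar> * ln (2 / (1 - (norm b)\<^sup>2)) powr u"
  proof (rule powr_comparable[OF log_pos[OF a] log_pos[OF b]])
    show "ln (2 / (1 - (norm a)\<^sup>2)) \<le> (1 + ln K / ln 2) * ln (2 / (1 - (norm b)\<^sup>2))"
      by (rule log_comparable[OF xa(1) xb(1,2) assms(5) K])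
    show "ln (2 / (1 - (norm b)\<^sup>2)) \<le> (1 + ln K / ln 2) * ln (2 / (1 - (norm a)\<^sup>2))"
      by (rule log_comparable[OF xb(1) xa(1,2) assms(4) K])
  qed
  ultimately have "log_weight s u a \<le> (K powr \<bar>s\<bar> * (1 - (norm b)\<^sup>2) powr s) * ((1 + ln K / ln 2) powr \<bar>u\<bar> * ln (2 / (1 - (norm b)\<^sup>2)) powr u)"
    unfolding log_weight_def by (intro mult_mono) auto
  then show ?thesis by (simp add: log_weight_def mult_ac)
qed

lemma log_weight_lower:
  assumes r: "0 \<le> r" "r < 1"
  shows "\<exists>c>0. \<forall>a :: complex ^ 'n. norm a \<le> r \<longrightarrow> c \<le> log_weight s u a"
proof -
  have r2: "0 < 1 - r\<^sup>2" "1 - r\<^sup>2 \<le> 1" using r by (auto simp: abs_square_less_1)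
  define K where "K = 1 / (1 - r\<^sup>2)"
  have K: "1 \<le> K" using r2 by (simp add: K_def)
  define D where "D = K powr \<bar>s\<bar> * (1 + ln K / ln 2) powr \<bar>u\<bar>"
  have "1 + ln K / ln 2 > 0" using K by (intro add_pos_nonneg) auto
  then have D: "D > 0" using K by (simp add: D_def)
  have main: "log_weight s u (0 :: complex ^ 'n) / D \<le> log_weight s u a" if "norm a \<le> r" for a :: "complex ^ 'n"
  proof -
    have a: "norm a < 1" using that r by simp
    have "(norm a)\<^sup>2 \<le> r\<^sup>2" using that by (intro power_mono) auto
    then have "1 - (norm (0 :: complex ^ 'n))\<^sup>2 \<le> K * (1 - (norm a)\<^sup>2)"
      using r2 by (simp add: K_def pos_le_divide_eq)
    moreover have "1 - (norm a)\<^sup>2 \<le> K * (1 - (norm (0 :: complex ^ 'n))\<^sup>2)"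
    proof -
      have "1 - (norm a)\<^sup>2 \<le> K" using one_minus_norm_square(2)[OF a] K by linarith
      then show ?thesis by simp
    qed
    ultimately have "log_weight s u (0 :: complex ^ 'n) \<le> D * log_weight s u a"
      unfolding D_def using a K by (intro log_weight_comparable) auto
    then show ?thesis using D by (simp add: pos_divide_le_eq mult.commute)
  qed
  then show ?thesis using D log_weight_pos[of "0 :: complex ^ 'n" s u]
    by (intro exI[of _ "log_weight s u (0 :: complex ^ 'n) / D"]) auto
qed

section \<open>The Carleson condition and tent norms\<close>

lemma ennreal_divide_le_iff:
  assumes "0 < W" "0 \<le> Y"
  shows "X / ennreal W \<le> ennreal Y \<longleftrightarrow> X \<le> ennreal (Y * W)"
proof
  assume "X / ennreal W \<le> ennreal Y"
  then have "ennreal W * (X / ennreal W) \<le> ennreal W * ennreal Y" by (rule mult_left_mono) simp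
  moreover have "ennreal W * (X / ennreal W) = X"
    using assms ennreal_mult_divide_eq[of "ennreal W" X] by (simp add: ennreal_times_divide mult.commute[of _ X])
  moreover have "ennreal W * ennreal Y = ennreal (Y * W)" using assms by (simp add: ennreal_mult mult.commute)
  ultimately show "X \<le> ennreal (Y * W)" by simp
next
  assume "X \<le> ennreal (Y * W)"
  then have "X / ennreal W \<le> ennreal (Y * W) / ennreal W" by (rule divide_right_mono_ennreal)
  also have "\<dots> = ennreal Y" using assms by (simp add: divide_ennreal)
  finally show "X / ennreal W \<le> ennreal Y" .
qed

text \<open>The limit in epsilon form with the weight multiplied out, so that later arguments avoid
  division in \<open>ennreal\<close>; r is taken nonnegative because it will be squared.\<close>

lemma vanishing_log_carleson_iff:
  "vanishing_log_carleson s u R \<mu> \<longleftrightarrow> (\<forall>\<epsilon>>0. \<exists>r. 0 \<le> r \<and> r < 1 \<and> (\<forall>a. r < norm a \<longrightarrow> norm a < 1 \<longrightarrow>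
     emeasure \<mu> (bergman_ball a R) \<le> ennreal (\<epsilon> * log_weight s u a)))" (is "_ \<longleftrightarrow> ?E")
proof -
  define F where "F a = emeasure \<mu> (bergman_ball a R) / ennreal (log_weight s u a)" for a
  have v: "vanishing_log_carleson s u R \<mu> \<longleftrightarrow> (F \<longlongrightarrow> 0) (filtercomap norm (at_left 1))"
    by (simp add: vanishing_log_carleson_def F_def[abs_def] log_weight_def)
  have ev: "eventually P (filtercomap norm (at_left 1)) \<longleftrightarrow>
      (\<exists>r. 0 \<le> r \<and> r < 1 \<and> (\<forall>a. r < norm a \<longrightarrow> norm a < 1 \<longrightarrow> P a))" for P :: "complex ^ 'a \<Rightarrow> bool"
  proof
    assume "eventually P (filtercomap norm (at_left 1))"
    then obtain Q where Q: "eventually Q (at_left (1 :: real))" "\<And>a. Q (norm a) \<Longrightarrow> P a"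
      unfolding eventually_filtercomap by blast
    obtain b where "b < 1" "\<And>y. b < y \<Longrightarrow> y < 1 \<Longrightarrow> Q y"
      using Q(1) by (auto simp: eventually_at_left[of 0 "1 :: real"])
    with Q(2) show "\<exists>r. 0 \<le> r \<and> r < 1 \<and> (\<forall>a. r < norm a \<longrightarrow> norm a < 1 \<longrightarrow> P a)"
      by (intro exI[of _ "max b 0"]) auto
  next
    assume "\<exists>r. 0 \<le> r \<and> r < 1 \<and> (\<forall>a. r < norm a \<longrightarrow> norm a < 1 \<longrightarrow> P a)"
    then obtain r where r: "r < 1" "\<And>a. r < norm a \<Longrightarrow> norm a < 1 \<Longrightarrow> P a" by blast
    show "eventually P (filtercomap norm (at_left 1))"
      unfolding eventually_filtercomap
      by (rule exI[of _ "\<lambda>x. r < x \<and> x < 1"]) (use r in \<open>auto simp: eventually_at_left[of 0 "1 :: real"]\<close>)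
  qed
  show ?thesis unfolding v
  proof
    assume lim: "(F \<longlongrightarrow> 0) (filtercomap norm (at_left 1))"
    show ?E
    proof (intro allI impI)
      fix \<epsilon> :: real assume \<epsilon>: "\<epsilon> > 0"
      then have "eventually (\<lambda>a. F a < ennreal \<epsilon>) (filtercomap norm (at_left 1))"
        using order_tendstoD(2)[OF lim, of "ennreal \<epsilon>"] by simp
      then obtain r where r: "0 \<le> r" "r < 1" "\<And>a. r < norm a \<Longrightarrow> norm a < 1 \<Longrightarrow> F a < ennreal \<epsilon>"
        unfolding ev by blast
      have "emeasure \<mu> (bergman_ball a R) \<le> ennreal (\<epsilon> * log_weight s u a)" if "r < norm a" "norm a < 1" for a
      proof -
        have "F a \<le> ennreal \<epsilon>" using r(3)[OF that] by simp
        then show ?thesis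
          unfolding F_def using \<epsilon> log_weight_pos[OF that(2), of s u] by (simp add: ennreal_divide_le_iff)
      qed
      with r show "\<exists>r. 0 \<le> r \<and> r < 1 \<and> (\<forall>a. r < norm a \<longrightarrow> norm a < 1 \<longrightarrow>
        emeasure \<mu> (bergman_ball a R) \<le> ennreal (\<epsilon> * log_weight s u a))" by blast
    qed
  next
    assume E: ?E
    show "(F \<longlongrightarrow> 0) (filtercomap norm (at_left 1))"
    proof (rule order_tendstoI)
      fix y :: ennreal assume "0 < y"
      then obtain z where z: "0 < z" "z < y" using dense by blast
      then have "z \<noteq> top" by auto
      then obtain \<epsilon> where \<epsilon>: "z = ennreal \<epsilon>" "0 \<le> \<epsilon>" by (cases z) auto
      with z have "\<epsilon> > 0" by auto
      then obtain r where r: "0 \<le> r" "r < 1" "\<And>a. r < norm a \<Longrightarrow> norm a < 1 \<Longrightarrow>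
        emeasure \<mu> (bergman_ball a R) \<le> ennreal (\<epsilon> * log_weight s u a)" using E by blast
      have "F a < y" if "r < norm a" "norm a < 1" for a
      proof -
        have "F a \<le> ennreal \<epsilon>"
          unfolding F_def using r(3)[OF that] \<epsilon> log_weight_pos[OF that(2), of s u] by (simp add: ennreal_divide_le_iff)
        then show ?thesis using z \<epsilon>(1) by simp
      qed
      with r show "eventually (\<lambda>a. F a < y) (filtercomap norm (at_left 1))" unfolding ev by blast
    qed simp
  qed
qed

context
  fixes \<mu> :: "(complex ^ 'n) measure"
  assumes \<mu>: "borel_measure_on_ball \<mu>"
begin

lemma borel_in_sets: "S \<in> sets borel \<Longrightarrow> S \<subseteq> ball 0 1 \<Longrightarrow> S \<in> sets \<mu>"
  using \<mu> unfolding borel_measure_on_ball_def by (auto simp: sets_restrict_space_iff)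

lemma bergman_ball_in_sets: "norm a < 1 \<Longrightarrow> 0 < R \<Longrightarrow> bergman_ball a R \<in> sets \<mu>"
  using open_bergman_ball[of a R] by (intro borel_in_sets) (auto simp: bergman_ball_def)

lemma emeasure_cball_finite: "\<rho> < 1 \<Longrightarrow> emeasure \<mu> (cball 0 \<rho>) < \<infinity>"
proof -
  assume "\<rho> < 1"
  then have "compact (cball (0 :: complex ^ 'n) \<rho>)" "cball (0 :: complex ^ 'n) \<rho> \<subseteq> ball 0 1" by auto
  with \<mu> show ?thesis unfolding borel_measure_on_ball_def by blast
qed

lemma holomorphic_several_measurable:
  assumes "holomorphic_several f (ball 0 1)"
  shows "f \<in> borel_measurable \<mu>"
proof -
  have "sets \<mu> = sets (restrict_space borel (ball 0 1))"
    using \<mu> unfolding borel_measure_on_ball_def by blast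
  then show ?thesis
    using borel_measurable_continuous_on_restrict[OF holomorphic_several_continuous_on[OF assms]]
    by (simp cong: measurable_cong_sets)
qed

text \<open>The ball of radius \<open>R\<^sub>0\<close> is covered by balls of radius
  \<open>R\<close>, their number independent of a. Their centres lie in a fixed larger Bergman ball
  around a, so their weights are comparable to that of a and they approach the sphere together with
  a.\<close>

lemma vanishing_log_carleson_change_radius:
  assumes R: "0 < R" and R0: "0 < R\<^sub>0" and v: "vanishing_log_carleson s u R \<mu>"
  shows "vanishing_log_carleson s u R\<^sub>0 \<mu>"
  unfolding vanishing_log_carleson_iff
proof (intro allI impI)
  fix \<epsilon> :: real assume \<epsilon>: "\<epsilon> > 0"
  obtain U :: "(complex ^ 'n) set" where U: "finite U"
    and b: "\<And>a u. norm a < 1 \<Longrightarrow> u \<in> U \<Longrightarrow> norm (ball_involution a u) < 1"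
      "\<And>a u. norm a < 1 \<Longrightarrow> u \<in> U \<Longrightarrow> ball_involution a u \<in> bergman_ball a (R\<^sub>0 + 1)"
    and cov: "\<And>a. norm a < 1 \<Longrightarrow> bergman_ball a R\<^sub>0 \<subseteq> (\<Union>u\<in>U. bergman_ball (ball_involution a u) R)"
    using bergman_ball_covering[OF R, where R\<^sub>0 = R\<^sub>0] by blast
  have R1: "R\<^sub>0 + 1 > 0" using R0 by simp
  define K where "K = 4 / sech_sq (R\<^sub>0 + 1)"
  have K: "1 \<le> K" using sech_sq[of "R\<^sub>0 + 1"] by (simp add: K_def pos_le_divide_eq)
  define D where "D = K powr \<bar>s\<bar> * (1 + ln K / ln 2) powr \<bar>u\<bar>"
  have "1 + ln K / ln 2 > 0" using K by (intro add_pos_nonneg) auto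
  then have D: "D > 0" using K by (simp add: D_def)
  \<comment> \<open>Pays for the comparison constant \<open>D\<close> and for the number of balls;
    the added 1 keeps the divisor positive if \<open>U\<close> is empty.\<close>
  define \<epsilon>' where "\<epsilon>' = \<epsilon> / (D * (real (card U) + 1))"
  have \<epsilon>': "\<epsilon>' > 0" using \<epsilon> D by (simp add: \<epsilon>'_def add_nonneg_pos)
  obtain r where r: "0 \<le> r" "r < 1" and small: "\<And>a. r < norm a \<Longrightarrow> norm a < 1 \<Longrightarrow>
    emeasure \<mu> (bergman_ball a R) \<le> ennreal (\<epsilon>' * log_weight s u a)"
    using v \<epsilon>' unfolding vanishing_log_carleson_iff by blast
  have r2: "0 < 1 - r\<^sup>2" "1 - r\<^sup>2 \<le> 1" using r by (auto simp: abs_square_less_1)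
  \<comment> \<open>Beyond this radius 1 - |a|^2 < (1 - r^2) / K, so every centre c of the cover has
    1 - |c|^2 < 1 - r^2 and the smallness assumption applies to it.\<close>
  define r' where "r' = sqrt (1 - (1 - r\<^sup>2) / K)"
  have "1 - r\<^sup>2 \<le> 1 * K" using r2(2) K by linarith
  then have q: "0 < (1 - r\<^sup>2) / K" "(1 - r\<^sup>2) / K \<le> 1"
    using r2(1) K by (simp, intro pos_divide_le_eq[THEN iffD2]) simp_all
  have r': "0 \<le> r'" "r' < 1" using q by (auto simp: r'_def)
  have "emeasure \<mu> (bergman_ball a R\<^sub>0) \<le> ennreal (\<epsilon> * log_weight s u a)" if a: "r' < norm a" "norm a < 1" for a
  proof -
    have "r'\<^sup>2 < (norm a)\<^sup>2" using a r' by (intro power_strict_mono) auto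
    then have xa: "1 - (norm a)\<^sup>2 < (1 - r\<^sup>2) / K" using q by (simp add: r'_def)
    have bb: "emeasure \<mu> (bergman_ball (ball_involution a u') R) \<le> ennreal (\<epsilon>' * D * log_weight s u a)" if u': "u' \<in> U" for u'
    proof -
      define c where "c = ball_involution a u'"
      have c: "norm c < 1" "c \<in> bergman_ball a (R\<^sub>0 + 1)" using b a u' by (auto simp: c_def)
      note cmp = bergman_ball_comparable(1,2)[OF a(2) R1 c(2), folded K_def]
      have "1 - (norm c)\<^sup>2 < K * ((1 - r\<^sup>2) / K)"
        using cmp(1) mult_strict_left_mono[OF xa, of K] K by linarith
      then have "r\<^sup>2 < (norm c)\<^sup>2" using K by simp
      then have "r < norm c" by (rule power_less_imp_less_base) simp
      then have "emeasure \<mu> (bergman_ball c R) \<le> ennreal (\<epsilon>' * log_weight s u c)" using c(1) by (rule small)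
      also have "\<dots> \<le> ennreal (\<epsilon>' * (D * log_weight s u a))"
        using log_weight_comparable[OF c(1) a(2) K cmp, of s u] \<epsilon>'
        by (intro ennreal_leI mult_left_mono) (auto simp: D_def)
      finally show ?thesis by (simp add: c_def mult.assoc)
    qed
    have "emeasure \<mu> (bergman_ball a R\<^sub>0) \<le> emeasure \<mu> (\<Union>u\<in>U. bergman_ball (ball_involution a u) R)"
      using cov[OF a(2)] U R b a by (intro emeasure_mono sets.finite_UN bergman_ball_in_sets) auto
    also have "\<dots> \<le> (\<Sum>u\<in>U. emeasure \<mu> (bergman_ball (ball_involution a u) R))"
      using U R b a by (intro emeasure_subadditive_finite) (auto intro: bergman_ball_in_sets)
    also have "\<dots> \<le> (\<Sum>u'\<in>U. ennreal (\<epsilon>' * D * log_weight s u a))" by (intro sum_mono bb)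
    also have "\<dots> = ennreal (real (card U) * (\<epsilon>' * D * log_weight s u a))"
      using \<epsilon>' D log_weight_pos[OF a(2), of s u] by (simp add: ennreal_mult ennreal_of_nat_eq_real_of_nat)
    also have "\<dots> \<le> ennreal (\<epsilon> * log_weight s u a)"
    proof (rule ennreal_leI)
      have "real (card U) * (\<epsilon>' * D) \<le> (real (card U) + 1) * (\<epsilon>' * D)"
        using \<epsilon>' D by (intro mult_right_mono) auto
      also have "\<dots> = \<epsilon>"
      proof -
        have "real (card U) + 1 \<noteq> 0" by linarith
        then show ?thesis using D by (simp add: \<epsilon>'_def)
      qed
      finally have "real (card U) * (\<epsilon>' * D) * log_weight s u a \<le> \<epsilon> * log_weight s u a"
        using log_weight_pos[OF a(2), of s u] by (intro mult_right_mono) auto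
      then show "real (card U) * (\<epsilon>' * D * log_weight s u a) \<le> \<epsilon> * log_weight s u a" by (simp add: mult.assoc)
    qed
    finally show ?thesis .
  qed
  with r' show "\<exists>r. 0 \<le> r \<and> r < 1 \<and> (\<forall>a. r < norm a \<longrightarrow> norm a < 1 \<longrightarrow>
     emeasure \<mu> (bergman_ball a R\<^sub>0) \<le> ennreal (\<epsilon> * log_weight s u a))" by blast
qed

end

definition tent_weight :: "real \<Rightarrow> real \<Rightarrow> complex ^ 'n \<Rightarrow> real" where
  "tent_weight s t a = (1 - (norm a)\<^sup>2) powr s * ln (2 / (1 - norm a)) powr t"

text \<open>The tent norm has 1 - |a| inside the logarithm, the Carleson condition 1 - |a|^2. The
  two logarithms differ by at most ln 2, which is at most the smaller one, so they agree up to a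
  factor 2.\<close>

lemma tent_weight_comparable:
  assumes a: "norm a < 1"
  shows "log_weight s t a \<le> 2 powr \<bar>t\<bar> * tent_weight s t a" "tent_weight s t a \<le> 2 powr \<bar>t\<bar> * log_weight s t a"
    "0 < tent_weight s t a"
proof -
  note x = one_minus_norm_square[OF a]
  define L L' where "L = ln (2 / (1 - (norm a)\<^sup>2))" and "L' = ln (2 / (1 - norm a))"
  have L: "0 < L" "ln 2 \<le> L" using log_pos[OF a] log_weight_ge[OF a] by (auto simp: L_def)
  have 1: "L \<le> L'" unfolding L_def L'_def using x a
    by (subst ln_le_cancel_iff) (auto simp: field_simps)
  have "L' \<le> ln (2 * (2 / (1 - (norm a)\<^sup>2)))" unfolding L'_def using x a
    by (subst ln_le_cancel_iff) (auto simp: field_simps)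
  also have "\<dots> = ln 2 + L" unfolding L_def using x by (intro ln_mult_pos) auto
  finally have 2: "L' \<le> 2 * L" using L by simp
  have "L powr t \<le> 2 powr \<bar>t\<bar> * L' powr t" "L' powr t \<le> 2 powr \<bar>t\<bar> * L powr t"
    using L 1 2 by (intro powr_comparable; simp)+
  then have "(1 - (norm a)\<^sup>2) powr s * L powr t \<le> (1 - (norm a)\<^sup>2) powr s * (2 powr \<bar>t\<bar> * L' powr t)"
    "(1 - (norm a)\<^sup>2) powr s * L' powr t \<le> (1 - (norm a)\<^sup>2) powr s * (2 powr \<bar>t\<bar> * L powr t)"
    by (auto intro: mult_left_mono)
  then show "log_weight s t a \<le> 2 powr \<bar>t\<bar> * tent_weight s t a" "tent_weight s t a \<le> 2 powr \<bar>t\<bar> * log_weight s t a"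
    by (simp_all add: log_weight_def tent_weight_def L_def L'_def mult_ac)
  have "L' > 0" using 1 L by simp
  then show "0 < tent_weight s t a" using x by (simp add: tent_weight_def L'_def)
qed

lemma tent_norm_le:
  fixes f :: "complex ^ 'n \<Rightarrow> complex"
  assumes q: "0 < q" and Y: "0 \<le> Y" and "\<And>a. norm a < 1 \<Longrightarrow>
    (\<integral>\<^sup>+z\<in>bergman_ball a R. ennreal (norm (f z) powr q) \<partial>\<mu>) \<le> ennreal (Y * log_weight s t a)"
  shows "tent_norm q s t R \<mu> f \<le> ennreal ((Y * 2 powr \<bar>t\<bar>) powr (1 / q))"
proof -
  have "(SUP a\<in>ball 0 1. (\<integral>\<^sup>+ z\<in>bergman_ball a R. ennreal (norm (f z) powr q) \<partial>\<mu>) /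
        ennreal ((1 - (norm a)\<^sup>2) powr s * ln (2 / (1 - norm a)) powr t)) \<le> ennreal (Y * 2 powr \<bar>t\<bar>)"
  proof (rule SUP_least)
    fix a :: "complex ^ 'n" assume "a \<in> ball 0 1"
    then have a: "norm a < 1" by simp
    have "Y * log_weight s t a \<le> Y * (2 powr \<bar>t\<bar> * tent_weight s t a)"
      using tent_weight_comparable(1)[OF a] Y by (rule mult_left_mono)
    then have "(\<integral>\<^sup>+ z\<in>bergman_ball a R. ennreal (norm (f z) powr q) \<partial>\<mu>) \<le> ennreal (Y * 2 powr \<bar>t\<bar> * tent_weight s t a)"
      using assms(3)[OF a] by (auto simp: mult.assoc intro: order_trans ennreal_leI)
    then show "(\<integral>\<^sup>+ z\<in>bergman_ball a R. ennreal (norm (f z) powr q) \<partial>\<mu>) /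
        ennreal ((1 - (norm a)\<^sup>2) powr s * ln (2 / (1 - norm a)) powr t) \<le> ennreal (Y * 2 powr \<bar>t\<bar>)"
      using ennreal_divide_le_iff[OF tent_weight_comparable(3)[OF a], of "Y * 2 powr \<bar>t\<bar>"] Y
      unfolding tent_weight_def by simp
  qed
  then have "tent_norm q s t R \<mu> f \<le> ennreal_powr (ennreal (Y * 2 powr \<bar>t\<bar>)) (1 / q)"
    unfolding tent_norm_def using q by (intro ennreal_powr_mono) auto
  then show ?thesis using Y by (simp add: ennreal_powr_def)
qed

section \<open>Compactness\<close>

text \<open>Near the sphere the limit condition with epsilon 1 gives the bound; the remaining balls
  lie in one compact set of finite measure, on whose centres the weight is bounded below.\<close>

lemma carleson_constant:
  fixes \<mu> :: "(complex ^ 'n) measure"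
  assumes \<mu>: "borel_measure_on_ball \<mu>" and R: "0 < R" and v: "vanishing_log_carleson s u R \<mu>"
  shows "\<exists>G>0. \<forall>a. norm a < 1 \<longrightarrow> emeasure \<mu> (bergman_ball a R) \<le> ennreal (G * log_weight s u a)"
proof -
  obtain r where r: "0 \<le> r" "r < 1" "\<And>a. r < norm a \<Longrightarrow> norm a < 1 \<Longrightarrow>
    emeasure \<mu> (bergman_ball a R) \<le> ennreal (1 * log_weight s u a)"
    using v unfolding vanishing_log_carleson_iff by (metis zero_less_one)
  obtain \<rho> where \<rho>: "\<rho> < 1" "\<And>a :: complex ^ 'n. norm a \<le> r \<Longrightarrow> bergman_ball a R \<subseteq> cball 0 \<rho>"
    using bergman_balls_in_cball[where ?'n = 'n, OF R r(1,2)] by blast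
  obtain c where c: "c > 0" "\<And>a :: complex ^ 'n. norm a \<le> r \<Longrightarrow> c \<le> log_weight s u a"
    using log_weight_lower[where ?'n = 'n, OF r(1,2)] by blast
  define m where "m = enn2real (emeasure \<mu> (cball 0 \<rho>))"
  have m: "emeasure \<mu> (cball 0 \<rho>) = ennreal m" "m \<ge> 0"
    using emeasure_cball_finite[OF \<mu> \<rho>(1)] by (auto simp: m_def less_top)
  define G where "G = 1 + m / c"
  have G: "G > 0" using m c by (simp add: G_def add_pos_nonneg)
  have "emeasure \<mu> (bergman_ball a R) \<le> ennreal (G * log_weight s u a)" if a: "norm a < 1" for a
  proof (cases "r < norm a")
    case True
    have "1 * log_weight s u a \<le> G * log_weight s u a"
      using m c log_weight_pos[OF a, of s u] by (intro mult_right_mono) (auto simp: G_def)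
    then show ?thesis using r(3)[OF True a] by (auto intro: order_trans ennreal_leI)
  next
    case False
    then have ar: "norm a \<le> r" by simp
    have "cball (0 :: complex ^ 'n) \<rho> \<subseteq> ball 0 1" using \<rho> by auto
    then have "emeasure \<mu> (bergman_ball a R) \<le> emeasure \<mu> (cball 0 \<rho>)"
      using \<rho>(2)[OF ar] by (intro emeasure_mono borel_in_sets[OF \<mu>]) auto
    also have "\<dots> \<le> ennreal (G * log_weight s u a)"
      unfolding m(1)
    proof (rule ennreal_leI)
      have "m = m / c * c" using c by simp
      also have "\<dots> \<le> G * log_weight s u a"
        using m c c(2)[OF ar] by (intro mult_mono) (auto simp: G_def)
      finally show "m \<le> G * log_weight s u a" .
    qed
    finally show ?thesis .
  qed
  with G show ?thesis by blast
qed

lemma nn_integral_bergman_ball_le: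
  fixes \<mu> :: "(complex ^ 'n) measure"
  assumes \<mu>: "borel_measure_on_ball \<mu>" and R: "0 < R" and a: "norm a < 1" and q: "0 < q"
    and f: "\<And>z. z \<in> bergman_ball a R \<Longrightarrow> norm (f z) \<le> B" and B: "0 \<le> B"
  shows "(\<integral>\<^sup>+z\<in>bergman_ball a R. ennreal (norm (f z) powr q) \<partial>\<mu>) \<le> ennreal (B powr q) * emeasure \<mu> (bergman_ball a R)"
proof -
  have "(\<integral>\<^sup>+z\<in>bergman_ball a R. ennreal (norm (f z) powr q) \<partial>\<mu>) \<le> (\<integral>\<^sup>+z. ennreal (B powr q) * indicator (bergman_ball a R) z \<partial>\<mu>)"
    using f q by (intro nn_integral_mono) (auto simp: indicator_def intro!: ennreal_leI powr_mono2)
  also have "\<dots> = ennreal (B powr q) * emeasure \<mu> (bergman_ball a R)"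
    using bergman_ball_in_sets[OF \<mu> a R] by (rule nn_integral_cmult_indicator)
  finally show ?thesis .
qed

text \<open>The growth exponent \<open>1 - 1/p\<close> of Besov functions accounts for the exponent
  \<open>t - q + q / p\<close> in the Carleson condition.\<close>

lemma tent_integral_le:
  fixes \<mu> :: "(complex ^ 'n) measure"
  assumes \<mu>: "borel_measure_on_ball \<mu>" and R: "0 < R" and q: "0 < q" and p: "1 \<le> p"
  shows "\<exists>M>0. \<forall>B G f a. 0 \<le> B \<longrightarrow> 0 \<le> G \<longrightarrow> norm a < 1 \<longrightarrow>
    (\<forall>z. norm z < 1 \<longrightarrow> norm (f z) \<le> B * ln (2 / (1 - (norm z)\<^sup>2)) powr (1 - 1/p)) \<longrightarrow>
    emeasure \<mu> (bergman_ball a R) \<le> ennreal (G * log_weight s (t - q + q / p) a) \<longrightarrow>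
    (\<integral>\<^sup>+z\<in>bergman_ball a R. ennreal (norm (f z :: complex) powr q) \<partial>\<mu>) \<le> ennreal (B powr q * M * G * log_weight s t a)"
proof -
  define e where "e = 1 - 1/p"
  have e: "e \<ge> 0" using p by (simp add: e_def)
  define K where "K = 4 / sech_sq R"
  have K: "1 \<le> K" using sech_sq[of R] by (simp add: K_def pos_le_divide_eq)
  define L where "L = 1 + ln K / ln 2"
  have L: "L > 0" unfolding L_def using K by (intro add_pos_nonneg) auto
  define M where "M = (L powr e) powr q"
  have M: "M > 0" using L by (simp add: M_def)
  have main: "(\<integral>\<^sup>+z\<in>bergman_ball a R. ennreal (norm (f z) powr q) \<partial>\<mu>) \<le> ennreal (B powr q * M * G * log_weight s t a)"
    if B: "0 \<le> B" and G: "0 \<le> G" and a: "norm a < 1"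
      and f: "\<And>z. norm z < 1 \<Longrightarrow> norm (f z) \<le> B * ln (2 / (1 - (norm z)\<^sup>2)) powr e"
      and em: "emeasure \<mu> (bergman_ball a R) \<le> ennreal (G * log_weight s (t - q + q / p) a)"
    for B G and f :: "complex ^ 'n \<Rightarrow> complex" and a
  proof -
    define \<Lambda> where "\<Lambda> = ln (2 / (1 - (norm a)\<^sup>2))"
    have \<Lambda>: "\<Lambda> > 0" unfolding \<Lambda>_def by (rule log_pos[OF a])
    have fle: "norm (f z) \<le> B * (L * \<Lambda>) powr e" if z: "z \<in> bergman_ball a R" for z
    proof -
      have z1: "norm z < 1" using z by (simp add: bergman_ball_def)
      note cmp = bergman_ball_comparable(1,2)[OF a R z, folded K_def]
      have "ln (2 / (1 - (norm z)\<^sup>2)) \<le> L * \<Lambda>"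
        unfolding L_def \<Lambda>_def
        by (rule log_comparable[OF one_minus_norm_square(1)[OF z1] one_minus_norm_square(1,2)[OF a] cmp(2) K])
      then have "ln (2 / (1 - (norm z)\<^sup>2)) powr e \<le> (L * \<Lambda>) powr e"
        using log_pos[OF z1] e by (intro powr_mono2) auto
      then show ?thesis using f[OF z1] B by (auto intro: order_trans mult_left_mono)
    qed
    have "(\<integral>\<^sup>+z\<in>bergman_ball a R. ennreal (norm (f z) powr q) \<partial>\<mu>) \<le>
      ennreal ((B * (L * \<Lambda>) powr e) powr q) * emeasure \<mu> (bergman_ball a R)"
      using B by (intro nn_integral_bergman_ball_le[OF \<mu> R a q] fle) auto
    also have "\<dots> \<le> ennreal ((B * (L * \<Lambda>) powr e) powr q) * ennreal (G * log_weight s (t - q + q / p) a)"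
      by (rule mult_left_mono[OF em]) simp
    also have "\<dots> = ennreal ((B * (L * \<Lambda>) powr e) powr q * (G * log_weight s (t - q + q / p) a))"
      using G log_weight_pos[OF a, of s "t - q + q / p"] by (intro ennreal_mult[symmetric]) auto
    also have "(B * (L * \<Lambda>) powr e) powr q * (G * log_weight s (t - q + q / p) a) = B powr q * M * G * log_weight s t a"
    proof -
      have "log_weight s t a = (\<Lambda> powr e) powr q * log_weight s (t - q + q / p) a"
      proof -
        have "t = e * q + (t - q + q / p)" using p by (simp add: e_def field_simps)
        then have "\<Lambda> powr t = (\<Lambda> powr e) powr q * \<Lambda> powr (t - q + q / p)"
          unfolding powr_powr powr_add[symmetric] by (rule arg_cong)
        then show ?thesis by (simp add: log_weight_def \<Lambda>_def)
      qed
      then show ?thesis by (simp add: powr_mult M_def mult_ac)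
    qed
    finally show ?thesis .
  qed
  show ?thesis unfolding e_def[symmetric]
    by (intro exI[of _ M] conjI allI impI M main) auto
qed

text \<open>The order N that witnesses membership may differ from the order fixed for the norm, so
  the constant depends on the function. This is enough to place each single function in the tent
  space.\<close>

lemma besov_space_pointwise:
  fixes f :: "complex ^ 'n \<Rightarrow> complex"
  assumes p: "1 \<le> p" and f: "f \<in> besov_space p"
  shows "\<exists>B\<ge>0. \<forall>z. norm z < 1 \<longrightarrow> norm (f z) \<le> B * ln (2 / (1 - (norm z)\<^sup>2)) powr (1 - 1/p)"
proof -
  obtain N where hol: "holomorphic_several f (ball 0 1)" and N: "0 < N"
    and in_Lp: "\<And>m. sum m UNIV = N \<Longrightarrow> in_Lp p tau_ball (weighted_partial N m f)"
    using f unfolding besov_space_def by blast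
  have "(\<Sum>m | sum m UNIV = N. Lp_norm p tau_ball (weighted_partial N m f)) < \<infinity>"
    using in_Lp finite_multi_indices_eq[where ?'n = 'n and k = N] by (simp add: in_Lp_def)
  moreover have "(\<Sum>m | sum m UNIV \<le> N - 1. ennreal (norm (partial_multi m f 0))) < \<infinity>"
    by (simp add: sum_ennreal)
  ultimately have "besov_norm p N f < \<infinity>" by (simp add: besov_norm_def)
  moreover obtain C where "C > 0" and C: "\<And>(f :: complex ^ 'n \<Rightarrow> complex) z. holomorphic_several f (ball 0 1) \<Longrightarrow>
    besov_norm p N f < \<infinity> \<Longrightarrow> norm z < 1 \<Longrightarrow>
    norm (f z) \<le> C * enn2real (besov_norm p N f) * ln (2 / (1 - (norm z)\<^sup>2)) powr (1 - 1/p)"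
    using besov_pointwise[where ?'n = 'n, OF p N] by blast
  ultimately show ?thesis using hol
    by (intro exI[of _ "C * enn2real (besov_norm p N f)"]) auto
qed

text \<open>For centres close to the sphere the small Carleson constant beats the uniform growth
  bound of the sequence. The balls around the other centres lie in one compact set, where uniform
  convergence applies.\<close>

lemma vanishing_imp_compact:
  fixes \<mu> :: "(complex ^ 'n) measure"
  assumes p: "1 \<le> p" and q: "0 < q" and R: "0 < R" and N: "0 < N" and \<mu>: "borel_measure_on_ball \<mu>"
    and v: "vanishing_log_carleson s (t - q + q / p) R \<mu>"
  shows "compact_besov_tent p N q s t R \<mu> inclusion"
proof -
  obtain G where G: "G > 0" and em: "\<And>a. norm a < 1 \<Longrightarrow>
    emeasure \<mu> (bergman_ball a R) \<le> ennreal (G * log_weight s (t - q + q / p) a)"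
    using carleson_constant[OF \<mu> R v] by blast
  obtain M where M: "M > 0" and int: "\<And>B G (f :: complex ^ 'n \<Rightarrow> complex) a. 0 \<le> B \<Longrightarrow> 0 \<le> G \<Longrightarrow> norm a < 1 \<Longrightarrow>
    (\<And>z. norm z < 1 \<Longrightarrow> norm (f z) \<le> B * ln (2 / (1 - (norm z)\<^sup>2)) powr (1 - 1/p)) \<Longrightarrow>
    emeasure \<mu> (bergman_ball a R) \<le> ennreal (G * log_weight s (t - q + q / p) a) \<Longrightarrow>
    (\<integral>\<^sup>+z\<in>bergman_ball a R. ennreal (norm (f z) powr q) \<partial>\<mu>) \<le> ennreal (B powr q * M * G * log_weight s t a)"
    using tent_integral_le[OF \<mu> R q p, of s t] by blast
  obtain C where C: "C > 0" and pw: "\<And>(f :: complex ^ 'n \<Rightarrow> complex) z. holomorphic_several f (ball 0 1) \<Longrightarrow>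
    besov_norm p N f < \<infinity> \<Longrightarrow> norm z < 1 \<Longrightarrow>
    norm (f z) \<le> C * enn2real (besov_norm p N f) * ln (2 / (1 - (norm z)\<^sup>2)) powr (1 - 1/p)"
    using besov_pointwise[where ?'n = 'n, OF p N] by blast
  have hol: "holomorphic_several f (ball 0 1)" if "f \<in> besov_space p" for f :: "complex ^ 'n \<Rightarrow> complex"
    using that by (simp add: besov_space_def)
  define D where "D = M * G * 2 powr \<bar>t\<bar>"
  have D: "D > 0" using M G by (simp add: D_def)
  have tn: "tent_norm q s t R \<mu> f \<le> ennreal ((B powr q * D) powr (1 / q))"
    if B: "0 \<le> B" and f: "\<And>z. norm z < 1 \<Longrightarrow> norm (f z) \<le> B * ln (2 / (1 - (norm z)\<^sup>2)) powr (1 - 1/p)"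
    for B and f :: "complex ^ 'n \<Rightarrow> complex"
    using tent_norm_le[OF q _ int[OF B less_imp_le[OF G] _ f em]] M G by (simp add: D_def mult.assoc)
  have bounded: "bounded_besov_tent p N q s t R \<mu> inclusion"
    unfolding bounded_besov_tent_def inclusion_def
  proof (intro conjI ballI allI exI[of _ "C * D powr (1 / q)"])
    fix f :: "complex ^ 'n \<Rightarrow> complex" assume f: "f \<in> besov_space p"
    obtain B where "B \<ge> 0" "\<And>z. norm z < 1 \<Longrightarrow> norm (f z) \<le> B * ln (2 / (1 - (norm z)\<^sup>2)) powr (1 - 1/p)"
      using besov_space_pointwise[OF p f] by blast
    from tn[OF this] have "tent_norm q s t R \<mu> f < \<infinity>" by (auto intro: le_less_trans)
    then show "f \<in> tent_space q s t R \<mu>"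
      unfolding tent_space_def using holomorphic_several_measurable[OF \<mu> hol[OF f]] by simp
    show "tent_norm q s t R \<mu> f \<le> ennreal (C * D powr (1 / q)) * besov_norm p N f"
    proof (cases "besov_norm p N f < \<infinity>")
      case True
      define b where "b = enn2real (besov_norm p N f)"
      have b: "besov_norm p N f = ennreal b" "b \<ge> 0" using True by (auto simp: b_def less_top)
      have "tent_norm q s t R \<mu> f \<le> ennreal (((C * b) powr q * D) powr (1 / q))"
        using b C pw[OF hol[OF f] True] by (intro tn) (auto simp: b_def)
      also have "((C * b) powr q * D) powr (1 / q) = C * D powr (1 / q) * b"
      proof -
        have "((C * b) powr q * D) powr (1 / q) = ((C * b) powr q) powr (1 / q) * D powr (1 / q)"
          by (rule powr_mult)
        also have "((C * b) powr q) powr (1 / q) = C * b"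
          unfolding powr_powr using q C b by simp
        finally show ?thesis by simp
      qed
      also have "ennreal (C * D powr (1 / q) * b) = ennreal (C * D powr (1 / q)) * besov_norm p N f"
        using b by (simp add: ennreal_mult'')
      finally show ?thesis .
    next
      case False
      then have "besov_norm p N f = top" by (simp add: less_top[symmetric])
      then show ?thesis using C D by (simp add: ennreal_mult_top)
    qed
  qed auto
  have "(\<lambda>k. tent_norm q s t R \<mu> (f k)) \<longlonglongrightarrow> 0"
    if f: "\<And>k. f k \<in> besov_space p" and bd: "\<exists>b::real. \<forall>k. besov_norm p N (f k) \<le> ennreal b"
      and ul: "\<And>K. compact K \<Longrightarrow> K \<subseteq> ball 0 1 \<Longrightarrow> uniform_limit K f (\<lambda>_. 0) sequentially"
    for f :: "nat \<Rightarrow> complex ^ 'n \<Rightarrow> complex"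
  proof -
    obtain b0 :: real where b0: "\<And>k. besov_norm p N (f k) \<le> ennreal b0" using bd by blast
    \<comment> \<open>\<open>ennreal\<close> truncates negative reals, so \<open>b0\<close> itself
      may be negative.\<close>
    define B where "B = C * max b0 0"
    have B: "B \<ge> 0" using C by (simp add: B_def)
    have fB: "norm (f k z) \<le> B * ln (2 / (1 - (norm z)\<^sup>2)) powr (1 - 1/p)" if z: "norm z < 1" for k z
    proof -
      have fin: "besov_norm p N (f k) < \<infinity>" using b0[of k] by (auto intro: le_less_trans)
      have "enn2real (besov_norm p N (f k)) \<le> max b0 0"
        using b0[of k] by (intro enn2real_leI) (auto intro: order_trans ennreal_leI)
      then have "C * enn2real (besov_norm p N (f k)) * ln (2 / (1 - (norm z)\<^sup>2)) powr (1 - 1/p)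
        \<le> B * ln (2 / (1 - (norm z)\<^sup>2)) powr (1 - 1/p)"
        unfolding B_def using C by (intro mult_right_mono mult_left_mono) auto
      with pw[OF hol[OF f] fin z] show ?thesis by linarith
    qed
    have small: "\<forall>\<^sub>F k in sequentially. tent_norm q s t R \<mu> (f k) \<le> ennreal \<epsilon>" if \<epsilon>: "\<epsilon> > 0" for \<epsilon>
    proof -
      define T where "T = 2 powr \<bar>t\<bar>"
      have T: "T > 0" by (simp add: T_def)
      \<comment> \<open>Chosen so that the bound (Y * 2^|t|)^(1/q) of \<open>tent_norm_le\<close> is
        exactly \<epsilon>.\<close>
      define Y where "Y = \<epsilon> powr q / T"
      have Y: "Y > 0" using \<epsilon> T by (simp add: Y_def)
      define \<epsilon>1 where "\<epsilon>1 = Y / (B powr q * M + 1)"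
      have den: "B powr q * M + 1 > 0" using M by (simp add: add_nonneg_pos)
      have \<epsilon>1: "\<epsilon>1 > 0" using Y den by (simp add: \<epsilon>1_def)
      have \<epsilon>1Y: "B powr q * M * \<epsilon>1 \<le> Y"
      proof -
        have "B powr q * M * \<epsilon>1 \<le> (B powr q * M + 1) * \<epsilon>1" using \<epsilon>1 by (intro mult_right_mono) auto
        also have "\<dots> = Y" using den by (simp add: \<epsilon>1_def)
        finally show ?thesis .
      qed
      obtain r where r: "0 \<le> r" "r < 1" "\<And>a. r < norm a \<Longrightarrow> norm a < 1 \<Longrightarrow>
        emeasure \<mu> (bergman_ball a R) \<le> ennreal (\<epsilon>1 * log_weight s (t - q + q / p) a)"
        using v \<epsilon>1 unfolding vanishing_log_carleson_iff by blast
      obtain \<rho> where \<rho>: "\<rho> < 1" "\<And>a :: complex ^ 'n. norm a \<le> r \<Longrightarrow> bergman_ball a R \<subseteq> cball 0 \<rho>"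
        using bergman_balls_in_cball[where ?'n = 'n, OF R r(1,2)] by blast
      obtain c where c: "c > 0" "\<And>a :: complex ^ 'n. norm a \<le> r \<Longrightarrow> c \<le> log_weight s t a"
        using log_weight_lower[where ?'n = 'n, OF r(1,2)] by blast
      have sub: "cball (0 :: complex ^ 'n) \<rho> \<subseteq> ball 0 1" using \<rho> by auto
      define m where "m = enn2real (emeasure \<mu> (cball 0 \<rho>))"
      have m: "emeasure \<mu> (cball 0 \<rho>) = ennreal m" "m \<ge> 0"
        using emeasure_cball_finite[OF \<mu> \<rho>(1)] by (auto simp: m_def less_top)
      \<comment> \<open>Size to which the sequence must fall on the compact set: \<eta>^q times its
        measure \<open>m\<close> is at most Y c, and c bounds the weight from below. The 1 covers m
        = 0.\<close>
      define \<eta> where "\<eta> = (Y * c / (m + 1)) powr (1 / q)"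
      have \<eta>: "\<eta> > 0" using Y c m by (simp add: \<eta>_def)
      have \<eta>q: "\<eta> powr q * m \<le> Y * c"
      proof -
        have "\<eta> powr q = Y * c / (m + 1)" unfolding \<eta>_def powr_powr using q Y c m by simp
        then have "\<eta> powr q * m = Y * c * (m / (m + 1))" by simp
        also have "\<dots> \<le> Y * c * 1" using Y c m by (intro mult_left_mono) auto
        finally show ?thesis by simp
      qed
      have "uniform_limit (cball 0 \<rho>) f (\<lambda>_. 0) sequentially" using sub by (intro ul) auto
      then have "\<forall>\<^sub>F k in sequentially. \<forall>z\<in>cball 0 \<rho>. dist (f k z) 0 < \<eta>"
        using \<eta> by (rule uniform_limitD)
      then show ?thesis
      proof eventually_elim
        case (elim k)
        have "tent_norm q s t R \<mu> (f k) \<le> ennreal ((Y * 2 powr \<bar>t\<bar>) powr (1 / q))"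
        proof (rule tent_norm_le[OF q])
          fix a :: "complex ^ 'n" assume a: "norm a < 1"
          show "(\<integral>\<^sup>+z\<in>bergman_ball a R. ennreal (norm (f k z) powr q) \<partial>\<mu>) \<le> ennreal (Y * log_weight s t a)"
          proof (cases "r < norm a")
            case True
            have "(\<integral>\<^sup>+z\<in>bergman_ball a R. ennreal (norm (f k z) powr q) \<partial>\<mu>) \<le> ennreal (B powr q * M * \<epsilon>1 * log_weight s t a)"
              using int[OF B less_imp_le[OF \<epsilon>1] a fB r(3)[OF True a]] .
            also have "\<dots> \<le> ennreal (Y * log_weight s t a)"
              using \<epsilon>1Y log_weight_pos[OF a, of s t] by (intro ennreal_leI mult_right_mono) auto
            finally show ?thesis .
          next
            case False
            then have ar: "norm a \<le> r" by simp
            have "(\<integral>\<^sup>+z\<in>bergman_ball a R. ennreal (norm (f k z) powr q) \<partial>\<mu>) \<le> ennreal (\<eta> powr q) * emeasure \<mu> (bergman_ball a R)"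
              using elim \<rho>(2)[OF ar] \<eta> by (intro nn_integral_bergman_ball_le[OF \<mu> R a q]) (auto simp: less_imp_le)
            also have "\<dots> \<le> ennreal (\<eta> powr q) * ennreal m"
              unfolding m(1)[symmetric] using \<rho>(2)[OF ar] sub
              by (intro mult_left_mono emeasure_mono borel_in_sets[OF \<mu>]) auto
            also have "\<dots> = ennreal (\<eta> powr q * m)" using m by (simp add: ennreal_mult)
            also have "\<dots> \<le> ennreal (Y * log_weight s t a)"
            proof (rule ennreal_leI)
              have "Y * c \<le> Y * log_weight s t a" using Y c(2)[OF ar] by (intro mult_left_mono) auto
              with \<eta>q show "\<eta> powr q * m \<le> Y * log_weight s t a" by linarith
            qed
            finally show ?thesis .
          qed
        qed (use Y in simp)
        also have "(Y * 2 powr \<bar>t\<bar>) powr (1 / q) = \<epsilon>"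
        proof -
          have "Y * 2 powr \<bar>t\<bar> = \<epsilon> powr q" using T by (simp add: Y_def T_def)
          then show ?thesis using \<epsilon> q by (simp add: powr_powr)
        qed
        finally show ?case .
      qed
    qed
    show ?thesis
    proof (rule order_tendstoI)
      fix y :: ennreal assume "0 < y"
      then obtain z where z: "0 < z" "z < y" using dense by blast
      then obtain \<epsilon> where \<epsilon>: "z = ennreal \<epsilon>" "0 \<le> \<epsilon>" by (cases z) auto
      with z have "\<epsilon> > 0" by auto
      from small[OF this] show "\<forall>\<^sub>F k in sequentially. tent_norm q s t R \<mu> (f k) < y"
        by (rule eventually_mono) (use z \<epsilon>(1) in auto)
    qed simp
  qed
  with bounded show ?thesis unfolding compact_besov_tent_def inclusion_def by blast
qed

section \<open>Necessity of the vanishing condition\<close>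

text \<open>For |z| <= \<rho> the argument 1 - <z,a> stays in a compact disc around 1 that misses
  the branch cut, whatever a is; the bound is therefore uniform in a.\<close>

lemma log_kernel_bounded:
  assumes "\<rho> < 1"
  shows "\<exists>M. \<forall>a z :: complex ^ 'n. norm a < 1 \<longrightarrow> norm z \<le> \<rho> \<longrightarrow> norm (log_kernel a 0 z) \<le> M"
proof -
  define f where "f w = complex_of_real (ln 2) - Ln w" for w
  have "cball (1 :: complex) \<rho> \<inter> \<real>\<^sub>\<le>\<^sub>0 = {}"
  proof -
    have "w \<notin> \<real>\<^sub>\<le>\<^sub>0" if "w \<in> cball 1 \<rho>" for w :: complex
    proof
      assume "w \<in> \<real>\<^sub>\<le>\<^sub>0"
      then have "Re w \<le> 0" by (simp add: complex_nonpos_Reals_iff)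
      moreover have "1 - Re w \<le> norm (1 - w)" using complex_Re_le_cmod[of "1 - w"] by simp
      ultimately show False using that assms by (simp add: dist_norm)
    qed
    then show ?thesis by blast
  qed
  then have "continuous_on (cball 1 \<rho>) f"
    unfolding f_def by (intro continuous_intros) auto
  then have "compact (f ` cball 1 \<rho>)" by (intro compact_continuous_image) auto
  then obtain M where M: "\<And>w. w \<in> cball 1 \<rho> \<Longrightarrow> norm (f w) \<le> M"
    using compact_imp_bounded bounded_iff by (metis image_eqI)
  have "norm (log_kernel a 0 z) \<le> M" if a: "norm a < 1" and z: "norm z \<le> \<rho>" for a z :: "complex ^ 'n"
  proof -
    have "norm (cinner z a) \<le> norm z * norm a" by (rule norm_cinner_le)
    also have "\<dots> \<le> norm z * 1" using a by (intro mult_left_mono) auto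
    finally have "1 - cinner z a \<in> cball 1 \<rho>" using z by (simp add: dist_norm)
    then have "norm (f (1 - cinner z a)) \<le> M" by (rule M)
    then show ?thesis by (simp add: f_def)
  qed
  then show ?thesis by blast
qed

text \<open>On the Bergman ball |1 - <z,a>| is at most a constant times 1 - |a|^2, so the real part
  of the kernel is at least \<Lambda> minus the logarithm of a constant. For large \<Lambda> half of
  \<Lambda> remains, and the normalisation lowers its power to 1 - 1/p.\<close>

lemma norm_test_fun_ge:
  fixes a :: "complex ^ 'n"
  assumes p: "1 \<le> p" and R: "0 < R" and a: "norm a < 1" and z: "z \<in> bergman_ball a R"
    and large: "2 * ln (2 / sech_sq R) \<le> ln (2 / (1 - (norm a)\<^sup>2))"
  shows "ln (2 / (1 - (norm a)\<^sup>2)) powr (1 - 1/p) / 2 \<le> norm (test_fun p a z)"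
proof -
  define \<Lambda> where "\<Lambda> = ln (2 / (1 - (norm a)\<^sup>2))"
  have \<Lambda>: "\<Lambda> > 0" unfolding \<Lambda>_def by (rule log_pos[OF a])
  have z1: "norm z < 1" using z by (simp add: bergman_ball_def)
  define w where "w = 1 - cinner z a"
  have w: "w \<noteq> 0" unfolding w_def by (rule cinner_ne_1[OF a z1])
  have x: "0 < 1 - (norm a)\<^sup>2" by (rule one_minus_norm_square(1)[OF a])
  have k: "0 < 2 / sech_sq R" using sech_sq(1)[of R] by simp
  have "ln (norm w) \<le> ln (2 / sech_sq R * (1 - (norm a)\<^sup>2))"
    using bergman_ball_comparable(3)[OF a R z] w x k unfolding w_def by (subst ln_le_cancel_iff) auto
  also have "\<dots> = ln (2 / sech_sq R) + ln (1 - (norm a)\<^sup>2)" using x k by (rule ln_mult_pos[rotated])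
  also have "ln (1 - (norm a)\<^sup>2) = ln 2 - \<Lambda>" using x by (simp add: \<Lambda>_def ln_div)
  finally have "\<Lambda> / 2 \<le> ln 2 - ln (norm w)" using large by (simp add: \<Lambda>_def)
  also have "\<dots> = Re (log_kernel a 0 z)" using w by (simp add: w_def)
  also have "\<dots> \<le> norm (log_kernel a 0 z)" by (rule complex_Re_le_cmod)
  finally have "\<Lambda> powr (- 1 / p) * (\<Lambda> / 2) \<le> \<Lambda> powr (- 1 / p) * norm (log_kernel a 0 z)"
    by (intro mult_left_mono) auto
  also have "\<dots> = norm (test_fun p a z)" by (simp add: test_fun_def \<Lambda>_def norm_mult)
  also have "\<Lambda> powr (- 1 / p) * (\<Lambda> / 2) = \<Lambda> powr (1 - 1/p) / 2"
  proof -
    have "\<Lambda> powr (- 1 / p) * \<Lambda> powr 1 = \<Lambda> powr (1 - 1/p)" unfolding powr_add[symmetric] by simp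
    then show ?thesis using \<Lambda> by simp
  qed
  finally show ?thesis by (simp add: \<Lambda>_def)
qed

text \<open>If the limit fails, there are centres tending to the sphere whose balls carry at least
  \<epsilon> times the weight. The test functions at these centres satisfy the hypotheses of
  compactness, but their tent norms, tested at the same centres, stay away from 0.\<close>

lemma compact_imp_vanishing:
  fixes \<mu> :: "(complex ^ 'n) measure"
  assumes p: "1 \<le> p" and q: "0 < q" and R: "0 < R" and N: "0 < N" and Np: "real N > real CARD('n) / p"
    and \<mu>: "borel_measure_on_ball \<mu>" and cpt: "compact_besov_tent p N q s t R \<mu> inclusion"
  shows "vanishing_log_carleson s (t - q + q / p) R \<mu>"
  unfolding vanishing_log_carleson_iff
proof (rule ccontr)
  define u where "u = t - q + q / p"
  assume "\<not> (\<forall>\<epsilon>>0. \<exists>r. 0 \<le> r \<and> r < 1 \<and> (\<forall>a. r < norm a \<longrightarrow> norm a < 1 \<longrightarrow>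
     emeasure \<mu> (bergman_ball a R) \<le> ennreal (\<epsilon> * log_weight s (t - q + q / p) a)))"
  then obtain \<epsilon> where \<epsilon>: "\<epsilon> > 0" and bad: "\<And>r. 0 \<le> r \<Longrightarrow> r < 1 \<Longrightarrow> \<exists>a. r < norm a \<and> norm a < 1 \<and>
     \<not> emeasure \<mu> (bergman_ball a R) \<le> ennreal (\<epsilon> * log_weight s u a)"
    unfolding u_def by blast
  have "\<forall>k. \<exists>a. 1 - 1 / real (Suc k) < norm a \<and> norm a < 1 \<and>
     \<not> emeasure \<mu> (bergman_ball a R) \<le> ennreal (\<epsilon> * log_weight s u a)"
    by (intro allI bad) (auto simp: field_simps)
  then obtain a where a: "\<And>k. 1 - 1 / real (Suc k) < norm (a k)" "\<And>k. norm (a k) < 1"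
    and big: "\<And>k. \<not> emeasure \<mu> (bergman_ball (a k) R) \<le> ennreal (\<epsilon> * log_weight s u (a k))"
    by metis
  define \<Lambda> where "\<Lambda> k = ln (2 / (1 - (norm (a k))\<^sup>2))" for k
  have \<Lambda>: "\<Lambda> k > 0" for k unfolding \<Lambda>_def by (rule log_pos[OF a(2)])
  have \<Lambda>_lim: "filterlim \<Lambda> at_top sequentially"
  proof (rule filterlim_at_top_mono)
    show "filterlim (\<lambda>k. ln (real (Suc k))) at_top sequentially"
      by (rule filterlim_compose[OF ln_at_top]) (rule filterlim_compose[OF filterlim_real_sequentially filterlim_Suc])
    show "\<forall>\<^sub>F k in sequentially. ln (real (Suc k)) \<le> \<Lambda> k"
    proof (rule always_eventually, rule allI)
      fix k
      have "1 - (norm (a k))\<^sup>2 \<le> 2 * (1 - norm (a k))" by (rule one_minus_norm_square(4)[OF a(2)])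
      also have "\<dots> \<le> 2 * (1 / real (Suc k))" using a(1)[of k] by (intro mult_left_mono) linarith+
      finally have "real (Suc k) \<le> 2 / (1 - (norm (a k))\<^sup>2)"
        using one_minus_norm_square(1)[OF a(2)[of k]] by (simp add: field_simps)
      then show "ln (real (Suc k)) \<le> \<Lambda> k"
        unfolding \<Lambda>_def using one_minus_norm_square(1)[OF a(2)[of k]] by (subst ln_le_cancel_iff) auto
    qed
  qed
  define f where "f k = test_fun p (a k)" for k
  obtain C :: real where C: "\<And>a :: complex ^ 'n. norm a < 1 \<Longrightarrow> test_fun p a \<in> besov_space p \<and> besov_norm p N (test_fun p a) \<le> ennreal C"
    using test_fun_besov[where ?'n = 'n, OF p N Np] by blast
  have ul: "uniform_limit K f (\<lambda>_. 0) sequentially" if K: "compact K" "K \<subseteq> ball 0 1" for K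
  proof -
    obtain \<rho> where \<rho>: "\<rho> < 1" "\<And>z. z \<in> K \<Longrightarrow> norm z \<le> \<rho>"
    proof (cases "K = {}")
      case False
      then obtain z0 where "z0 \<in> K" "\<And>z. z \<in> K \<Longrightarrow> norm z \<le> norm z0"
        using continuous_attains_sup[OF K(1), of norm] by (auto intro: continuous_intros)
      with K(2) that[of "norm z0"] show ?thesis by auto
    qed (use that[of 0] in auto)
    obtain M where M: "\<And>a z :: complex ^ 'n. norm a < 1 \<Longrightarrow> norm z \<le> \<rho> \<Longrightarrow> norm (log_kernel a 0 z) \<le> M"
      using log_kernel_bounded[where ?'n = 'n, OF \<rho>(1)] by blast
    \<comment> \<open>The kernels are bounded on \<open>K\<close> uniformly in k, so the local decay
      comes from the normalising factor alone.\<close>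
    have "((\<lambda>k. \<Lambda> k powr (- 1 / p)) \<longlongrightarrow> 0) sequentially"
      using p by (intro tendsto_neg_powr \<Lambda>_lim) auto
    then have lim: "((\<lambda>k. \<Lambda> k powr (- 1 / p) * M) \<longlongrightarrow> 0) sequentially"
      by (rule tendsto_mult_left_zero)
    show ?thesis
    proof (rule uniform_limitI)
      fix e :: real assume "e > 0"
      then have "\<forall>\<^sub>F k in sequentially. \<Lambda> k powr (- 1 / p) * M < e" using lim by (intro order_tendstoD)
      then show "\<forall>\<^sub>F k in sequentially. \<forall>z\<in>K. dist (f k z) 0 < e"
      proof eventually_elim
        case (elim k)
        show ?case
        proof
          fix z assume "z \<in> K"
          have "dist (f k z) 0 = \<Lambda> k powr (- 1 / p) * norm (log_kernel (a k) 0 z)"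
            by (simp add: f_def test_fun_def \<Lambda>_def norm_mult)
          also have "\<dots> \<le> \<Lambda> k powr (- 1 / p) * M"
            using M[OF a(2) \<rho>(2)[OF \<open>z \<in> K\<close>]] by (intro mult_left_mono) auto
          finally show "dist (f k z) 0 < e" using elim by simp
        qed
      qed
    qed
  qed
  have lim: "(\<lambda>k. tent_norm q s t R \<mu> (f k)) \<longlonglongrightarrow> 0"
  proof (rule cpt[unfolded compact_besov_tent_def inclusion_def, THEN conjunct2, THEN spec, THEN mp], intro conjI exI allI impI)
    show "f k \<in> besov_space p" "besov_norm p N (f k) \<le> ennreal C" for k
      using C[OF a(2)] by (simp_all add: f_def)
  qed (use ul in auto)
  \<comment> \<open>The factor (1/2)^q comes from the lower bound for the test functions, 2^(-|t|)
    from exchanging the weight of the tent norm for that of the Carleson condition.\<close>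
  define Y where "Y = (1/2) powr q * \<epsilon> / 2 powr \<bar>t\<bar>"
  have Y: "Y > 0" using \<epsilon> by (simp add: Y_def)
  have ev1: "\<forall>\<^sub>F k in sequentially. tent_norm q s t R \<mu> (f k) < ennreal (Y powr (1 / q))"
    using Y by (intro order_tendstoD(2)[OF lim]) simp
  have ev2: "\<forall>\<^sub>F k in sequentially. 2 * ln (2 / sech_sq R) \<le> \<Lambda> k"
    using \<Lambda>_lim unfolding filterlim_at_top by blast
  have "\<forall>\<^sub>F k in sequentially. False"
    using ev1 ev2
  proof eventually_elim
    case (elim k)
    define S where "S = (SUP a\<in>ball 0 1. (\<integral>\<^sup>+ z\<in>bergman_ball a R. ennreal (norm (f k z) powr q) \<partial>\<mu>) /
        ennreal ((1 - (norm a)\<^sup>2) powr s * ln (2 / (1 - norm a)) powr t))"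
    note tw = tent_weight_comparable[OF a(2)[of k], where s = s and t = t]
    define b where "b = (\<Lambda> k powr (1 - 1/p) / 2) powr q"
    have "ennreal (Y * tent_weight s t (a k)) \<le> ennreal (b * (\<epsilon> * log_weight s u (a k)))"
    proof (rule ennreal_leI)
      have "t = (1 - 1/p) * q + u" using p by (simp add: u_def field_simps)
      then have "\<Lambda> k powr t = (\<Lambda> k powr (1 - 1/p)) powr q * \<Lambda> k powr u"
        unfolding powr_powr powr_add[symmetric] by (rule arg_cong)
      moreover have "b = (1/2) powr q * (\<Lambda> k powr (1 - 1/p)) powr q"
        unfolding b_def powr_mult[symmetric] by simp
      ultimately have eq: "b * (\<epsilon> * log_weight s u (a k)) = (1/2) powr q * \<epsilon> * log_weight s t (a k)"
        by (simp add: log_weight_def \<Lambda>_def mult_ac)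
      have "Y * tent_weight s t (a k) \<le> Y * (2 powr \<bar>t\<bar> * log_weight s t (a k))"
        using tw(2) Y by (intro mult_left_mono) auto
      also have "\<dots> = b * (\<epsilon> * log_weight s u (a k))" unfolding eq by (simp add: Y_def)
      finally show "Y * tent_weight s t (a k) \<le> b * (\<epsilon> * log_weight s u (a k))" .
    qed
    also have "\<dots> = ennreal b * ennreal (\<epsilon> * log_weight s u (a k))"
      by (rule ennreal_mult') (simp add: b_def)
    also have "\<dots> \<le> ennreal b * emeasure \<mu> (bergman_ball (a k) R)"
      using big[of k] by (intro mult_left_mono) auto
    also have "\<dots> = (\<integral>\<^sup>+z. ennreal b * indicator (bergman_ball (a k) R) z \<partial>\<mu>)"
      using bergman_ball_in_sets[OF \<mu> a(2) R] by (rule nn_integral_cmult_indicator[symmetric])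
    also have "\<dots> \<le> (\<integral>\<^sup>+ z\<in>bergman_ball (a k) R. ennreal (norm (f k z) powr q) \<partial>\<mu>)"
    proof (rule nn_integral_mono)
      fix z
      show "ennreal b * indicator (bergman_ball (a k) R) z \<le> ennreal (norm (f k z) powr q) * indicator (bergman_ball (a k) R) z"
      proof (cases "z \<in> bergman_ball (a k) R")
        case True
        have "\<Lambda> k powr (1 - 1/p) / 2 \<le> norm (f k z)"
          unfolding f_def \<Lambda>_def using elim(2) by (intro norm_test_fun_ge[OF p R a(2) True]) (simp add: \<Lambda>_def)
        then have "b \<le> norm (f k z) powr q" unfolding b_def using q by (intro powr_mono2) auto
        then show ?thesis using True by (simp add: ennreal_leI)
      qed simp
    qed
    finally have I: "ennreal (Y * tent_weight s t (a k)) \<le> (\<integral>\<^sup>+ z\<in>bergman_ball (a k) R. ennreal (norm (f k z) powr q) \<partial>\<mu>)" .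
    have "ennreal Y = ennreal (Y * tent_weight s t (a k)) / ennreal (tent_weight s t (a k))"
      using tw(3) Y by (simp add: divide_ennreal)
    also have "\<dots> \<le> (\<integral>\<^sup>+ z\<in>bergman_ball (a k) R. ennreal (norm (f k z) powr q) \<partial>\<mu>) / ennreal (tent_weight s t (a k))"
      by (rule divide_right_mono_ennreal[OF I])
    also have "\<dots> \<le> S"
      unfolding S_def tent_weight_def using a(2)[of k] by (intro SUP_upper) simp
    finally have "ennreal_powr (ennreal Y) (1 / q) \<le> tent_norm q s t R \<mu> (f k)"
      unfolding tent_norm_def S_def using q by (intro ennreal_powr_mono) auto
    then have "ennreal (Y powr (1 / q)) \<le> tent_norm q s t R \<mu> (f k)" using Y by (simp add: ennreal_powr_def)
    with elim(1) show False by simp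
  qed
  then show False by simp
qed

theorem theorem3p2:
  fixes p q s t R\<^sub>0 :: real and N :: nat and \<mu> :: "(complex ^ 'n) measure"
  assumes "1 \<le> p" and "0 < q" and "0 < R\<^sub>0"
    and "0 < N" and "real N > real CARD('n) / p"
    and "borel_measure_on_ball \<mu>"
  shows "(compact_besov_tent p N q s t R\<^sub>0 \<mu> inclusion \<longleftrightarrow>
            (\<exists>R>0. vanishing_log_carleson s (t - q + q / p) R \<mu>)) \<and>
         (compact_besov_tent p N q s t R\<^sub>0 \<mu> inclusion \<longleftrightarrow>
            (\<forall>R>0. vanishing_log_carleson s (t - q + q / p) R \<mu>))"
  \<comment> \<open>Compactness at \<open>R\<^sub>0\<close> gives the condition at
    \<open>R\<^sub>0\<close>, the change of radius gives it at every radius; conversely, the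
    condition at one radius yields it at \<open>R\<^sub>0\<close> and hence compactness. Both
    quantifiers are thus equivalent to the same statement.\<close>
  using assms vanishing_log_carleson_change_radius[OF assms(6)]
    vanishing_imp_compact[OF assms(1-4,6)] compact_imp_vanishing[OF assms]
  by blast

end
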